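(* Let $\varepsilon>0$ and let $I$ be a set of rectangles that admits an $\varepsilon$-granular container packing with $K=O_\varepsilon(1)$ containers into an $a\times b$ knapsack. Then there is a pseudo-polynomial-time algorithm that packs all the rectangles of $I$ into an $(1+2\varepsilon)a\times b$ knapsack (respectively, into an $a\times(1+2\varepsilon)b$ knapsack). This holds both with and without $90^\circ$ rotations.
   Context: Rectangles have positive integer widths and heights; a packing places them axis-parallel with pairwise disjoint interiors (with rotations allowed, each may be rotated by $90^\circ$). A container is an axis-parallel box together with a set of rectangles packed inside it, of one of three types: horizontal (every horizontal line meets at most one packed rectangle), vertical (every vertical line meets at most one packed rectangle), or $\varepsilon$-granular area container of size $w\times h$ (every packed rectangle has width at most $\varepsilon w$ and height at most $\varepsilon h$). An $\varepsilon$-granular container packing is a packing in which containers have pairwise disjoint interiors and every rectangle lies inside some container respecting its type. Pseudo-polynomial time means time polynomial in the input size and in the largest integer value in the input. $O_\varepsilon(1)$ is a quantity depending only on $\varepsilon$. *)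

theory Defs
  imports "HOL-Analysis.Analysis" "HOL-Library.Log_Nat"
begin

section \<open>Rectangles and packings\<close>

text \<open>A rectangle is the pair of its width and its height. A set of rectangles is given as a list,
  so that different rectangles may have the same dimensions; rectangle number \<open>i\<close> is \<open>rs ! i\<close>.
  A placement gives, for every rectangle number, the position of the lower left corner of the placed
  rectangle and whether the rectangle is rotated by 90 degrees.\<close>

type_synonym rect = "nat \<times> nat"
type_synonym placement = "nat \<Rightarrow> (real \<times> real) \<times> bool"

definition placed_width :: "rect list \<Rightarrow> placement \<Rightarrow> nat \<Rightarrow> real" where
  "placed_width rs P i = real (if snd (P i) then snd (rs ! i) else fst (rs ! i))"

definition placed_height :: "rect list \<Rightarrow> placement \<Rightarrow> nat \<Rightarrow> real" where
  "placed_height rs P i = real (if snd (P i) then fst (rs ! i) else snd (rs ! i))"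

definition region :: "rect list \<Rightarrow> placement \<Rightarrow> nat \<Rightarrow> (real \<times> real) set" where
  "region rs P i =
     cbox (fst (P i)) (fst (P i) + (placed_width rs P i, placed_height rs P i))"

definition is_packing :: "bool \<Rightarrow> real \<Rightarrow> real \<Rightarrow> rect list \<Rightarrow> placement \<Rightarrow> bool" where
  "is_packing rot A B rs P \<longleftrightarrow>
     (\<forall>i < length rs. region rs P i \<subseteq> cbox (0, 0) (A, B)) \<and>
     (\<forall>i < length rs. \<forall>j < length rs. i \<noteq> j \<longrightarrow>
        interior (region rs P i) \<inter> interior (region rs P j) = {}) \<and>
     (\<not> rot \<longrightarrow> (\<forall>i < length rs. \<not> snd (P i)))"

section \<open>Containers\<close>

datatype container_kind = Horizontal | Vertical | Area

record container =
  corner :: "real \<times> real"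
  cwidth :: real
  cheight :: real
  kind :: container_kind
  contents :: "nat set"

definition cregion :: "container \<Rightarrow> (real \<times> real) set" where
  "cregion C = cbox (corner C) (corner C + (cwidth C, cheight C))"

text \<open>A line meets a rectangle if it meets its interior: rectangles stacked on top of each
  other in a horizontal container may share a boundary line.\<close>

fun respects_kind :: "real \<Rightarrow> rect list \<Rightarrow> placement \<Rightarrow> container \<Rightarrow> container_kind \<Rightarrow> bool" where
  "respects_kind \<epsilon> rs P C Horizontal \<longleftrightarrow>
     (\<forall>y. \<forall>i \<in> contents C. \<forall>j \<in> contents C.
        interior (region rs P i) \<inter> {p. snd p = y} \<noteq> {} \<and>
        interior (region rs P j) \<inter> {p. snd p = y} \<noteq> {} \<longrightarrow> i = j)"
| "respects_kind \<epsilon> rs P C Vertical \<longleftrightarrow>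
     (\<forall>x. \<forall>i \<in> contents C. \<forall>j \<in> contents C.
        interior (region rs P i) \<inter> {p. fst p = x} \<noteq> {} \<and>
        interior (region rs P j) \<inter> {p. fst p = x} \<noteq> {} \<longrightarrow> i = j)"
| "respects_kind \<epsilon> rs P C Area \<longleftrightarrow>
     (\<forall>i \<in> contents C. placed_width rs P i \<le> \<epsilon> * cwidth C \<and>
                        placed_height rs P i \<le> \<epsilon> * cheight C)"

definition is_container :: "real \<Rightarrow> rect list \<Rightarrow> placement \<Rightarrow> container \<Rightarrow> bool" where
  "is_container \<epsilon> rs P C \<longleftrightarrow>
     0 < cwidth C \<and> 0 < cheight C \<and>
     contents C \<subseteq> {..<length rs} \<and>
     (\<forall>i \<in> contents C. region rs P i \<subseteq> cregion C) \<and>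
     respects_kind \<epsilon> rs P C (kind C)"

definition is_container_packing ::
  "bool \<Rightarrow> real \<Rightarrow> real \<Rightarrow> real \<Rightarrow> rect list \<Rightarrow> placement \<Rightarrow> container list \<Rightarrow> bool" where
  "is_container_packing rot \<epsilon> A B rs P Cs \<longleftrightarrow>
     is_packing rot A B rs P \<and>
     (\<forall>C \<in> set Cs. is_container \<epsilon> rs P C \<and> cregion C \<subseteq> cbox (0, 0) (A, B)) \<and>
     (\<forall>k < length Cs. \<forall>l < length Cs. k \<noteq> l \<longrightarrow>
        interior (cregion (Cs ! k)) \<inter> interior (cregion (Cs ! l)) = {}) \<and>
     (\<forall>i < length rs. \<exists>C \<in> set Cs. i \<in> contents C)"

definition admits_container_packing ::
  "bool \<Rightarrow> real \<Rightarrow> nat \<Rightarrow> real \<Rightarrow> real \<Rightarrow> rect list \<Rightarrow> bool" where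
  "admits_container_packing rot \<epsilon> K A B rs \<longleftrightarrow>
     (\<exists>P Cs. length Cs \<le> K \<and> is_container_packing rot \<epsilon> A B rs P Cs)"

section \<open>Algorithms\<close>

text \<open>Algorithms are structured programs of a random access machine whose memory cells hold natural
  numbers; \<open>Mem e\<close> is the content of the cell with address \<open>e\<close>, and \<open>Minus\<close> is truncated
  subtraction. Every operation, memory access and assignment costs one unit of time. As there is no
  multiplication, numbers have at most linearly many bits in the running time, the input size and the
  (fixed) program, so that unit cost is polynomially
  equivalent to logarithmic cost and to Turing machine time.\<close>

type_synonym memory = "nat \<Rightarrow> nat"

datatype aexp = Const nat | Mem aexp | Plus aexp aexp | Minus aexp aexp

datatype com =
    Skip
  | Assign aexp aexp
  | Seq com com
  | If aexp com com
  | While aexp com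

fun aval :: "aexp \<Rightarrow> memory \<Rightarrow> nat" where
  "aval (Const n) M = n"
| "aval (Mem e) M = M (aval e M)"
| "aval (Plus e f) M = aval e M + aval f M"
| "aval (Minus e f) M = aval e M - aval f M"

fun acost :: "aexp \<Rightarrow> nat" where
  "acost (Const n) = 1"
| "acost (Mem e) = 1 + acost e"
| "acost (Plus e f) = 1 + acost e + acost f"
| "acost (Minus e f) = 1 + acost e + acost f"

text \<open>\<open>exec c M t M'\<close>: started in memory \<open>M\<close>, the program \<open>c\<close> halts after time \<open>t\<close> in memory \<open>M'\<close>.
  \<open>Assign e f\<close> stores the value of \<open>f\<close> in the cell whose address is the value of \<open>e\<close>; a test
  succeeds if its value is not zero.\<close>

inductive exec :: "com \<Rightarrow> memory \<Rightarrow> nat \<Rightarrow> memory \<Rightarrow> bool" where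
  exec_Skip: "exec Skip M 1 M"
| exec_Assign: "exec (Assign e f) M (1 + acost e + acost f) (M(aval e M := aval f M))"
| exec_Seq: "exec c M t M' \<Longrightarrow> exec d M' t' M'' \<Longrightarrow> exec (Seq c d) M (t + t') M''"
| exec_IfTrue: "aval e M \<noteq> 0 \<Longrightarrow> exec c M t M' \<Longrightarrow> exec (If e c d) M (1 + acost e + t) M'"
| exec_IfFalse: "aval e M = 0 \<Longrightarrow> exec d M t M' \<Longrightarrow> exec (If e c d) M (1 + acost e + t) M'"
| exec_WhileFalse: "aval e M = 0 \<Longrightarrow> exec (While e c) M (1 + acost e) M"
| exec_WhileTrue: "aval e M \<noteq> 0 \<Longrightarrow> exec c M t M' \<Longrightarrow> exec (While e c) M' t' M'' \<Longrightarrow>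
    exec (While e c) M (1 + acost e + t + t') M''"

inductive_cases exec_SkipE: "exec Skip M t M'"
inductive_cases exec_AssignE: "exec (Assign e f) M t M'"
inductive_cases exec_SeqE: "exec (Seq c d) M t M'"
inductive_cases exec_IfE: "exec (If e c d) M t M'"
inductive_cases exec_WhileE: "exec (While e c) M t M'"

lemma exec_deterministic:
  "exec c M t M' \<Longrightarrow> exec c M u N \<Longrightarrow> u = t \<and> N = M'"
proof (induction arbitrary: u N rule: exec.induct)
  case (exec_Skip M)
  then show ?case by (auto elim: exec_SkipE)
next
  case (exec_Assign e f M)
  then show ?case by (auto elim: exec_AssignE)
next
  case (exec_Seq c M t M' d t' M'')
  from exec_Seq.prems obtain v v' N' where
    "u = v + v'" "exec c M v N'" "exec d N' v' N" by (auto elim: exec_SeqE)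
  with exec_Seq.IH show ?case by metis
next
  case (exec_IfTrue e M c t M' d)
  from exec_IfTrue.prems exec_IfTrue.hyps obtain v where
    "u = 1 + acost e + v" "exec c M v N" by (auto elim: exec_IfE)
  with exec_IfTrue.IH show ?case by metis
next
  case (exec_IfFalse e M d t M' c)
  from exec_IfFalse.prems exec_IfFalse.hyps obtain v where
    "u = 1 + acost e + v" "exec d M v N" by (auto elim: exec_IfE)
  with exec_IfFalse.IH show ?case by metis
next
  case (exec_WhileFalse e M c)
  from exec_WhileFalse.prems exec_WhileFalse.hyps show ?case by (auto elim: exec_WhileE)
next
  case (exec_WhileTrue e M c t M' t' M'')
  from exec_WhileTrue.prems exec_WhileTrue.hyps obtain v v' N' where
    "u = 1 + acost e + v + v'" "exec c M v N'" "exec (While e c) N' v' N"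
    by (auto elim: exec_WhileE)
  with exec_WhileTrue.IH show ?case by metis
qed

text \<open>The input integers stand in the first memory cells, all other cells are 0. The size of the
  input is the number of its bits.\<close>

definition valid_instance :: "nat \<Rightarrow> nat \<Rightarrow> rect list \<Rightarrow> bool" where
  "valid_instance a b rs \<longleftrightarrow> 0 < a \<and> 0 < b \<and> (\<forall>(w, h) \<in> set rs. 0 < w \<and> 0 < h)"

definition encode :: "nat \<Rightarrow> nat \<Rightarrow> rect list \<Rightarrow> nat list" where
  "encode a b rs = [a, b, length rs] @ concat (map (\<lambda>(w, h). [w, h]) rs)"

definition input_size :: "nat \<Rightarrow> nat \<Rightarrow> rect list \<Rightarrow> nat" where
  "input_size a b rs = (\<Sum>x\<leftarrow>encode a b rs. floorlog 2 x)"

definition max_value :: "nat \<Rightarrow> nat \<Rightarrow> rect list \<Rightarrow> nat" where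
  "max_value a b rs = Max (set (encode a b rs))"

definition initial_memory :: "nat \<Rightarrow> nat \<Rightarrow> rect list \<Rightarrow> memory" where
  "initial_memory a b rs k = (if k < length (encode a b rs) then encode a b rs ! k else 0)"

definition pseudo_polynomial_time :: "com \<Rightarrow> bool" where
  "pseudo_polynomial_time p \<longleftrightarrow>
     (\<exists>c d. \<forall>a b rs. valid_instance a b rs \<longrightarrow>
        (\<exists>t M. exec p (initial_memory a b rs) t M \<and>
               t \<le> c * (input_size a b rs + max_value a b rs) ^ d))"

text \<open>The output consists of rational coordinates, with their common denominator in cell 0, and one
  rotation flag per rectangle.\<close>

definition output_placement :: "memory \<Rightarrow> placement" where
  "output_placement M i =
     ((real (M (3 * i + 1)) / real (M 0), real (M (3 * i + 2)) / real (M 0)), M (3 * i + 3) \<noteq> 0)"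

definition computes_packing ::
  "com \<Rightarrow> bool \<Rightarrow> nat \<Rightarrow> nat \<Rightarrow> rect list \<Rightarrow> real \<Rightarrow> real \<Rightarrow> bool" where
  "computes_packing p rot a b rs A B \<longleftrightarrow>
     (\<exists>t M. exec p (initial_memory a b rs) t M \<and> 0 < M 0 \<and>
            is_packing rot A B rs (output_placement M))"

end

theory Submission
  imports Defs
begin

text \<open>
  Stretching the x-direction by the factor \<open>1 + 2 * \<epsilon>\<close> and rounding all coordinates down turns the
  containers into boxes with integral corners.
  Whether a set of rectangles fits into such a box follows from bounds on their widths and heights
  and three sums: the total area, the total width of the rectangles above a height threshold, and the
  total height. For an area box, sort the rectangles by height, put a suitable number of them side by
  side on the bottom, which gives a staircase, and fill the remaining space from the top downwards with
  rows (next fit decreasing height). If this fails for two particular choices of that number, the area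
  of the rectangles exceeds the area of the container.

  The algorithm guesses the boxes, the bounds and the sums, finds an assignment of the rectangles to the boxes
  with these sums by dynamic programming, places the rectangles in every box as above and checks the
  result. The knapsack width is tried in increasing order and the first success is taken, so that
  \<open>\<epsilon>\<close> need not be computable. All loops are truncated at a number that is polynomial in the input
  values for a fixed number of containers, and so the time is bounded whatever the input is.
  The second claim follows by exchanging the coordinates.
\<close>

section \<open>A language of bounded loops\<close>

text \<open>Only one side of the knapsack grows, so an area container is widened but keeps its
  height. With the container scaled to the unit square, rows in a box of width
  \<open>1 + 2 * \<epsilon>\<close> lose a gap of up to \<open>\<epsilon>\<close> at the end of each
  row and also the height of the first row, again up to \<open>\<epsilon>\<close>. They are thus
  safe for area \<open>(1 + \<epsilon>) * (1 - \<epsilon>)\<close>, while the area may be 1. The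
  staircase makes up for the missing \<open>\<epsilon>\<^sup>2\<close>: it lowers the first row, and
  tall rectangles that remain in the first row contribute area above the height at which the row
  estimate counts them. Small and large \<open>\<epsilon>\<close>, separated by
  \<open>3 * \<epsilon>\<^sup>2 = 1\<close>, need different pairs of staircases. The sums required
  of all boxes form one subset sum problem: they are the digits of a single number whose base
  exceeds every possible sum. The assignment found may differ from that of the given packing, but it
  has the same sums.\<close>

type_synonym store = "nat \<Rightarrow> nat \<Rightarrow> nat"

definition upd :: "store \<Rightarrow> nat \<Rightarrow> nat \<Rightarrow> nat \<Rightarrow> store" where
  "upd \<sigma> j i v = \<sigma>(j := (\<sigma> j)(i := v))"

lemma upd_other [simp]: "j' \<noteq> j \<Longrightarrow> upd \<sigma> j i v j' = \<sigma> j'"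
  by (simp add: upd_def)

lemma upd_same [simp]: "upd \<sigma> j i v j = (\<sigma> j)(i := v)"
  by (simp add: upd_def)

text \<open>The arrays are interleaved with stride 64, so each of them is unbounded, and entry 0 of
  array \<open>j\<close> is memory cell \<open>j\<close>. The stride is a power of two because the
  machine can only add: an address costs six doublings.\<close>

definition mem :: "store \<Rightarrow> memory" where
  "mem \<sigma> k = \<sigma> (k mod 64) (k div 64)"

lemma mem_at [simp]: "j < 64 \<Longrightarrow> mem \<sigma> (64 * i + j) = \<sigma> j i"
  by (simp add: mem_def)

lemma mem_upd: "j < 64 \<Longrightarrow> mem (upd \<sigma> j i v) = (mem \<sigma>)(64 * i + j := v)"
proof
  fix k :: nat assume "j < 64"
  have "k = 64 * (k div 64) + k mod 64" by simp
  then have "k = 64 * i + j \<longleftrightarrow> k div 64 = i \<and> k mod 64 = j" using \<open>j < 64\<close> by auto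
  then show "mem (upd \<sigma> j i v) k = ((mem \<sigma>)(64 * i + j := v)) k"
    by (auto simp: mem_def upd_def)
qed

text \<open>Every memory comes from a store, so compiled programs can be started after machine code
  that knows nothing of arrays.\<close>

lemma mem_surj: "mem (\<lambda>j i. M (64 * i + j)) = M"
  by (simp add: mem_def fun_eq_iff)

section \<open>Syntax, semantics and compilation of the loop language\<close>

datatype ex = Num nat | Arr nat ex | Add ex ex | Sub ex ex

fun ev :: "ex \<Rightarrow> store \<Rightarrow> nat" where
  "ev (Num n) \<sigma> = n"
| "ev (Arr j e) \<sigma> = \<sigma> j (ev e \<sigma>)"
| "ev (Add e f) \<sigma> = ev e \<sigma> + ev f \<sigma>"
| "ev (Sub e f) \<sigma> = ev e \<sigma> - ev f \<sigma>"

definition dbl :: "aexp \<Rightarrow> aexp" where "dbl e = Plus e e"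

definition address :: "nat \<Rightarrow> aexp \<Rightarrow> aexp" where
  "address j e = Plus (dbl (dbl (dbl (dbl (dbl (dbl e)))))) (Const j)"

lemma aval_dbl [simp]: "aval (dbl e) M = 2 * aval e M"
  by (simp add: dbl_def)

lemma aval_address [simp]: "aval (address j e) M = 64 * aval e M + j"
  by (simp add: address_def)

fun comp_ex :: "ex \<Rightarrow> aexp" where
  "comp_ex (Num n) = Const n"
| "comp_ex (Arr j e) = Mem (address j (comp_ex e))"
| "comp_ex (Add e f) = Plus (comp_ex e) (comp_ex f)"
| "comp_ex (Sub e f) = Minus (comp_ex e) (comp_ex f)"

fun wf_ex :: "ex \<Rightarrow> bool" where
  "wf_ex (Num n) = True"
| "wf_ex (Arr j e) = (j < 64 \<and> wf_ex e)"
| "wf_ex (Add e f) = (wf_ex e \<and> wf_ex f)"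
| "wf_ex (Sub e f) = (wf_ex e \<and> wf_ex f)"

lemma aval_comp_ex [simp]: "wf_ex e \<Longrightarrow> aval (comp_ex e) (mem \<sigma>) = ev e \<sigma>"
  by (induction e) auto

datatype cm =
    Nop
  | Put nat ex ex
  | Then cm cm (infixr ";;" 60)
  | Test ex cm cm
  | For nat ex cm

text \<open>Array 0 holds the loop counters and array 1 the loop bounds, both indexed by the number of the
  loop; cell 0 of array 2 holds a number by which all loop bounds are truncated. Because of this
  truncation the running time is bounded by a polynomial in that number, whatever the program does.\<close>

abbreviation scalar :: "nat \<Rightarrow> ex" where "scalar j \<equiv> Arr j (Num 0)"
abbreviation counter :: "nat \<Rightarrow> ex" where "counter s \<equiv> Arr 0 (Num s)"
abbreviation limit :: ex where "limit \<equiv> Arr 2 (Num 0)"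

text \<open>The counter is written before the first and after every iteration. It therefore equals
  the number of completed iterations for an arbitrary body \<open>f\<close>.\<close>

fun iter :: "(store \<Rightarrow> store) \<Rightarrow> nat \<Rightarrow> nat \<Rightarrow> store \<Rightarrow> store" where
  "iter f s 0 \<sigma> = upd \<sigma> 0 s 0"
| "iter f s (Suc i) \<sigma> = upd (f (iter f s i \<sigma>)) 0 s (Suc i)"

primrec sem :: "cm \<Rightarrow> store \<Rightarrow> store" where
  "sem Nop \<sigma> = \<sigma>"
| "sem (Put j e f) \<sigma> = upd \<sigma> j (ev e \<sigma>) (ev f \<sigma>)"
| "sem (c ;; d) \<sigma> = sem d (sem c \<sigma>)"
| "sem (Test e c d) \<sigma> = (if ev e \<sigma> \<noteq> 0 then sem c \<sigma> else sem d \<sigma>)"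
| "sem (For s e c) \<sigma> =
     iter (sem c) s (min (ev e \<sigma>) (\<sigma> 2 0)) (upd \<sigma> 1 s (min (ev e \<sigma>) (\<sigma> 2 0)))"

primrec mods :: "cm \<Rightarrow> nat set" where
  "mods Nop = {}"
| "mods (Put j e f) = {j}"
| "mods (c ;; d) = mods c \<union> mods d"
| "mods (Test e c d) = mods c \<union> mods d"
| "mods (For s e c) = mods c"

primrec slots :: "cm \<Rightarrow> nat set" where
  "slots Nop = {}"
| "slots (Put j e f) = {}"
| "slots (c ;; d) = slots c \<union> slots d"
| "slots (Test e c d) = slots c \<union> slots d"
| "slots (For s e c) = insert s (slots c)"

text \<open>Writing is confined to arrays beyond 2, which keeps counters, loop bounds and the
  truncation number out of reach of loop bodies; nested loops must have different numbers. These two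
  rules give termination and the time bound, whatever a program is meant to do.\<close>

primrec wf_cm :: "cm \<Rightarrow> bool" where
  "wf_cm Nop = True"
| "wf_cm (Put j e f) = (2 < j \<and> j < 64 \<and> wf_ex e \<and> wf_ex f)"
| "wf_cm (c ;; d) = (wf_cm c \<and> wf_cm d)"
| "wf_cm (Test e c d) = (wf_ex e \<and> wf_cm c \<and> wf_cm d)"
| "wf_cm (For s e c) = (wf_ex e \<and> wf_cm c \<and> s \<notin> slots c)"

text \<open>With truncated subtraction, \<open>Sub e (Sub e limit)\<close> is the minimum of
  \<open>e\<close> and \<open>limit\<close>, which is how the loop bound is truncated. The bound is
  evaluated once, before the loop.\<close>

primrec compile :: "cm \<Rightarrow> com" where
  "compile Nop = Skip"
| "compile (Put j e f) = Assign (address j (comp_ex e)) (comp_ex f)"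
| "compile (c ;; d) = Seq (compile c) (compile d)"
| "compile (Test e c d) = If (comp_ex e) (compile c) (compile d)"
| "compile (For s e c) =
     Seq (Assign (address 1 (Const s)) (comp_ex (Sub e (Sub e limit))))
    (Seq (Assign (address 0 (Const s)) (Const 0))
         (While (comp_ex (Sub (Arr 1 (Num s)) (counter s)))
            (Seq (compile c) (Assign (address 0 (Const s)) (comp_ex (Add (counter s) (Num 1)))))))"

lemma iter_other:
  assumes "\<And>\<sigma>. f \<sigma> j = \<sigma> j" "j \<noteq> 0"
  shows "iter f s m \<sigma> j = \<sigma> j"
  using assms by (induction m) auto

lemma sem_unmodified [simp]: "1 < j \<Longrightarrow> j \<notin> mods c \<Longrightarrow> sem c \<sigma> j = \<sigma> j"
proof (induction c arbitrary: \<sigma>)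
  case (For s e c)
  then show ?case by (simp add: iter_other)
qed auto

lemma wf_cm_mods: "wf_cm c \<Longrightarrow> j \<in> mods c \<Longrightarrow> 2 < j"
  by (induction c) auto

lemma iter_slots:
  assumes "\<And>\<sigma>. f \<sigma> j s' = \<sigma> j s'" "s' \<noteq> s"
  shows "iter f s m \<sigma> j s' = \<sigma> j s'"
  using assms by (induction m) (auto simp: upd_def)

lemma sem_slots: "wf_cm c \<Longrightarrow> j < 2 \<Longrightarrow> s \<notin> slots c \<Longrightarrow> sem c \<sigma> j s = \<sigma> j s"
proof (induction c arbitrary: \<sigma>)
  case (For s' e c)
  then show ?case by (simp add: iter_slots upd_def)
qed auto

lemma sem_counter [simp]: "wf_cm c \<Longrightarrow> s \<notin> slots c \<Longrightarrow> sem c \<sigma> 0 s = \<sigma> 0 s"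
  by (simp add: sem_slots)

text \<open>The loop itself writes its counter and its bound, so an invariant has to survive
  arbitrary changes of these two cells. In return, the step may use that the counter equals the
  index of the iteration.\<close>

lemma For_rule:
  assumes "I 0 \<sigma>"
    and "m = min (ev e \<sigma>) (\<sigma> 2 0)"
    and "\<And>i \<tau> v. I i \<tau> \<Longrightarrow> I i (upd \<tau> 0 s v)"
    and "\<And>i \<tau> v. I i \<tau> \<Longrightarrow> I i (upd \<tau> 1 s v)"
    and "\<And>i \<tau>. i < m \<Longrightarrow> I i \<tau> \<Longrightarrow> \<tau> 0 s = i \<Longrightarrow> I (Suc i) (sem c \<tau>)"
  shows "I m (sem (For s e c) \<sigma>)"
proof -
  have "k \<le> m \<Longrightarrow> I k (iter (sem c) s k \<tau>) \<and> iter (sem c) s k \<tau> 0 s = k" if "I 0 \<tau>" for k \<tau>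
    using that by (induction k) (auto intro!: assms(3,5))
  from this[of "upd \<sigma> 1 s m" m] show ?thesis
    using assms(1,2,4) by auto
qed

section \<open>Running time of compiled programs\<close>

primrec time_factor :: "cm \<Rightarrow> nat" where
  "time_factor Nop = 1"
| "time_factor (Put j e f) = 1 + acost (address j (comp_ex e)) + acost (comp_ex f)"
| "time_factor (c ;; d) = time_factor c + time_factor d"
| "time_factor (Test e c d) = 1 + acost (comp_ex e) + time_factor c + time_factor d"
| "time_factor (For s e c) =
     2 + acost (address 1 (Const s)) + acost (comp_ex (Sub e (Sub e limit))) +
     acost (address 0 (Const s)) + acost (Const 0) +
     1 + acost (comp_ex (Sub (Arr 1 (Num s)) (counter s))) +
     (1 + acost (comp_ex (Sub (Arr 1 (Num s)) (counter s))) + time_factor c +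
      (1 + acost (address 0 (Const s)) + acost (comp_ex (Add (counter s) (Num 1)))))"

primrec depth :: "cm \<Rightarrow> nat" where
  "depth Nop = 0"
| "depth (Put j e f) = 0"
| "depth (c ;; d) = max (depth c) (depth d)"
| "depth (Test e c d) = max (depth c) (depth d)"
| "depth (For s e c) = Suc (depth c)"

lemma le_mult_power: "(t::nat) \<le> k * (V + 1) ^ d \<Longrightarrow> d \<le> d' \<Longrightarrow> t \<le> k * (V + 1) ^ d'"
  by (meson le_trans mult_le_mono2 power_increasing le_add2)

lemma const_le_power: "(1::nat) \<le> (V + 1) ^ d"
  by simp

lemma loop_time_step: "x \<le> k \<Longrightarrow> u \<le> c + r * k \<Longrightarrow> x + u \<le> c + (1 + r) * (k::nat)"
  by simp

lemma loop_time:
  assumes "t \<le> c + m * (k * p)" "m \<le> v" "(1::nat) \<le> v * p"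
  shows "c1 + (c0 + t) \<le> (c1 + c0 + c + k) * (v * p)"
proof -
  have "m * (k * p) \<le> v * (k * p)" using assms(2) by simp
  moreover have "c1 + c0 + c \<le> (c1 + c0 + c) * (v * p)"
    using assms(3) by (metis mult.right_neutral mult_le_mono2)
  ultimately have "c1 + (c0 + t) \<le> (c1 + c0 + c) * (v * p) + v * (k * p)"
    using assms(1) by linarith
  then show ?thesis by (simp only: distrib_right mult.left_commute[of v])
qed

text \<open>Termination and time come from the syntax alone: a body runs at most
  \<open>\<sigma> 2 0\<close> times, a number that no well-formed program changes. Nesting
  multiplies by it, sequencing adds.\<close>

theorem exec_compile:
  assumes "wf_cm c"
  shows "\<exists>t. exec (compile c) (mem \<sigma>) t (mem (sem c \<sigma>)) \<and>
    t \<le> time_factor c * (\<sigma> 2 0 + 1) ^ depth c"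
  using assms
proof (induction c arbitrary: \<sigma>)
  case Nop
  then show ?case by (auto intro: exec_Skip)
next
  case (Put j e f)
  have "exec (compile (Put j e f)) (mem \<sigma>) (time_factor (Put j e f)) (mem (sem (Put j e f) \<sigma>))"
    using exec_Assign[of "address j (comp_ex e)" "comp_ex f" "mem \<sigma>"] Put.prems
    by (simp add: mem_upd)
  then show ?case by auto
next
  case (Then c d)
  let ?V = "\<sigma> 2 0"
  have 2: "sem c \<sigma> 2 = \<sigma> 2" using Then.prems wf_cm_mods[of c 2] by force
  obtain t where t: "exec (compile c) (mem \<sigma>) t (mem (sem c \<sigma>))"
      "t \<le> time_factor c * (?V + 1) ^ depth c"
    using Then by auto
  obtain u where u: "exec (compile d) (mem (sem c \<sigma>)) u (mem (sem d (sem c \<sigma>)))"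
      "u \<le> time_factor d * (?V + 1) ^ depth d"
    using Then 2 by (metis wf_cm.simps(3))
  have "t + u \<le> time_factor c * (?V + 1) ^ depth (c ;; d) + time_factor d * (?V + 1) ^ depth (c ;; d)"
    using le_mult_power[OF t(2), of "depth (c ;; d)"] le_mult_power[OF u(2), of "depth (c ;; d)"]
    by simp
  also have "\<dots> = time_factor (c ;; d) * (?V + 1) ^ depth (c ;; d)"
    by (simp only: time_factor.simps distrib_right)
  finally show ?case using exec_Seq[OF t(1) u(1)] by (metis compile.simps(3) sem.simps(3))
next
  case (Test e c d)
  let ?V = "\<sigma> 2 0" and ?d = "depth (Test e c d)"
  have e: "aval (comp_ex e) (mem \<sigma>) = ev e \<sigma>" using Test.prems by simp
  have 1: "1 + acost (comp_ex e) + t \<le> time_factor (Test e c d) * (?V + 1) ^ ?d"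
    if "t \<le> k * (?V + 1) ^ d'" "k \<le> time_factor c + time_factor d" "d' \<le> ?d" for t k d'
  proof -
    have "t \<le> k * (?V + 1) ^ ?d" using that le_mult_power by blast
    also have "\<dots> \<le> (time_factor c + time_factor d) * (?V + 1) ^ ?d" using that(2) by simp
    finally have "t \<le> (time_factor c + time_factor d) * (?V + 1) ^ ?d" .
    moreover have "1 + acost (comp_ex e) \<le> (1 + acost (comp_ex e)) * (?V + 1) ^ ?d"
      using const_le_power[of ?V ?d] by (metis mult.right_neutral mult_le_mono2)
    ultimately show ?thesis by (simp only: time_factor.simps distrib_right)
  qed
  show ?case
  proof (cases "ev e \<sigma> = 0")
    case True
    obtain t where t: "exec (compile d) (mem \<sigma>) t (mem (sem d \<sigma>))"
        "t \<le> time_factor d * (?V + 1) ^ depth d"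
      using Test by auto
    have "exec (compile (Test e c d)) (mem \<sigma>) (1 + acost (comp_ex e) + t) (mem (sem (Test e c d) \<sigma>))"
      using True e t(1) by (auto intro: exec_IfFalse[simplified])
    moreover have "1 + acost (comp_ex e) + t \<le> time_factor (Test e c d) * (?V + 1) ^ ?d"
      by (rule 1[OF t(2)]) simp_all
    ultimately show ?thesis by blast
  next
    case False
    obtain t where t: "exec (compile c) (mem \<sigma>) t (mem (sem c \<sigma>))"
        "t \<le> time_factor c * (?V + 1) ^ depth c"
      using Test by auto
    have "exec (compile (Test e c d)) (mem \<sigma>) (1 + acost (comp_ex e) + t) (mem (sem (Test e c d) \<sigma>))"
      using False e t(1) by (auto intro: exec_IfTrue[simplified])
    moreover have "1 + acost (comp_ex e) + t \<le> time_factor (Test e c d) * (?V + 1) ^ ?d"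
      by (rule 1[OF t(2)]) simp_all
    ultimately show ?thesis by blast
  qed
next
  case (For s e c)
  let ?V = "\<sigma> 2 0" and ?m = "min (ev e \<sigma>) (\<sigma> 2 0)"
  let ?te = "comp_ex (Sub (Arr 1 (Num s)) (counter s))"
  let ?inc = "Assign (address 0 (Const s)) (comp_ex (Add (counter s) (Num 1)))"
  let ?b = "Seq (compile c) ?inc"
  let ?it = "iter (sem c) s"
  let ?ci = "1 + acost (address 0 (Const s)) + acost (comp_ex (Add (counter s) (Num 1)))"
  let ?k = "1 + acost ?te + time_factor c + ?ci"
  let ?\<sigma> = "upd \<sigma> 1 s ?m"
  have wf: "wf_cm c" "s \<notin> slots c" "wf_ex e" using For.prems by auto
  have n2: "2 \<notin> mods c" using wf_cm_mods[OF wf(1), of 2] by auto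
  have it2: "?it i ?\<sigma> 2 = \<sigma> 2" for i by (subst iter_other) (auto simp: n2)
  have itb: "?it i ?\<sigma> 1 s = ?m" for i
    by (induction i) (auto simp: sem_slots[OF wf(1) _ wf(2)])
  have itc: "?it i ?\<sigma> 0 s = i" for i by (cases i) auto
  have test: "aval ?te (mem (?it i ?\<sigma>)) = ?m - i" for i
  proof -
    have "aval ?te (mem (?it i ?\<sigma>)) = ?it i ?\<sigma> 1 s - ?it i ?\<sigma> 0 s"
      by (subst aval_comp_ex) simp_all
    then show ?thesis by (simp only: itb itc)
  qed
  \<comment> \<open>Induction on the number of remaining iterations, which is exactly the value of
    the loop test.\<close>
  have loop: "\<exists>t. exec (While ?te ?b) (mem (?it i ?\<sigma>)) t (mem (?it ?m ?\<sigma>)) \<and>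
      t \<le> 1 + acost ?te + (?m - i) * (?k * (?V + 1) ^ depth c)" if "i \<le> ?m" for i
    using that
  proof (induction "?m - i" arbitrary: i)
    case 0
    then have "i = ?m" by linarith
    have "aval ?te (mem (?it i ?\<sigma>)) = 0"
      unfolding test using \<open>i = ?m\<close> by linarith
    from exec_WhileFalse[OF this] \<open>i = ?m\<close> show ?case by auto
  next
    case (Suc x)
    then have "i < ?m" "x = ?m - Suc i" by linarith+
    have nz: "aval ?te (mem (?it i ?\<sigma>)) \<noteq> 0"
      unfolding test using \<open>i < ?m\<close> by linarith
    obtain t where t: "exec (compile c) (mem (?it i ?\<sigma>)) t (mem (sem c (?it i ?\<sigma>)))"
        "t \<le> time_factor c * (?V + 1) ^ depth c"
      using For.IH[OF wf(1), of "?it i ?\<sigma>"] it2 by auto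
    have "aval (comp_ex (Add (counter s) (Num 1))) (mem (sem c (?it i ?\<sigma>)))
        = Suc (sem c (?it i ?\<sigma>) 0 s)"
      by (subst aval_comp_ex) simp_all
    then have "aval (comp_ex (Add (counter s) (Num 1))) (mem (sem c (?it i ?\<sigma>))) = Suc i"
      by (simp only: sem_counter[OF wf(1,2)] itc)
    moreover have "aval (address 0 (Const s)) (mem (sem c (?it i ?\<sigma>))) = 64 * s + 0" by simp
    moreover have "mem (?it (Suc i) ?\<sigma>) = (mem (sem c (?it i ?\<sigma>)))(64 * s + 0 := Suc i)"
      by (simp only: iter.simps mem_upd)
    ultimately have "exec ?inc (mem (sem c (?it i ?\<sigma>))) ?ci (mem (?it (Suc i) ?\<sigma>))"
      using exec_Assign[of "address 0 (Const s)" "comp_ex (Add (counter s) (Num 1))"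
          "mem (sem c (?it i ?\<sigma>))"] by metis
    from exec_Seq[OF t(1) this] have b: "exec ?b (mem (?it i ?\<sigma>)) (t + ?ci) (mem (?it (Suc i) ?\<sigma>))" .
    obtain u where u: "exec (While ?te ?b) (mem (?it (Suc i) ?\<sigma>)) u (mem (?it ?m ?\<sigma>))"
        "u \<le> 1 + acost ?te + (?m - Suc i) * (?k * (?V + 1) ^ depth c)"
      using Suc.hyps(1)[OF \<open>x = ?m - Suc i\<close>] \<open>i < ?m\<close> by auto
    have "(1 + acost ?te) + ?ci \<le> ((1 + acost ?te) + ?ci) * (?V + 1) ^ depth c"
      using const_le_power[of ?V "depth c"] by (metis mult.right_neutral mult_le_mono2)
    with t(2) have "1 + acost ?te + (t + ?ci) \<le> ?k * (?V + 1) ^ depth c"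
      by (simp add: algebra_simps)
    from loop_time_step[OF this u(2)] have "1 + acost ?te + (t + ?ci) + u
        \<le> 1 + acost ?te + (1 + (?m - Suc i)) * (?k * (?V + 1) ^ depth c)" .
    moreover have "1 + (?m - Suc i) = ?m - i" using \<open>i < ?m\<close> by linarith
    ultimately show ?case using exec_WhileTrue[OF nz b u(1)] by metis
  qed
  obtain t where t: "exec (While ?te ?b) (mem (?it 0 ?\<sigma>)) t (mem (?it ?m ?\<sigma>))"
      "t \<le> 1 + acost ?te + ?m * (?k * (?V + 1) ^ depth c)"
    using loop[of 0] by auto
  have a1: "exec (Assign (address 1 (Const s)) (comp_ex (Sub e (Sub e limit)))) (mem \<sigma>)
      (1 + acost (address 1 (Const s)) + acost (comp_ex (Sub e (Sub e limit)))) (mem ?\<sigma>)"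
  proof -
    have "aval (comp_ex (Sub e (Sub e limit))) (mem \<sigma>) = ?m"
      using wf(3) by (subst aval_comp_ex) auto
    then show ?thesis
      using exec_Assign[of "address 1 (Const s)" "comp_ex (Sub e (Sub e limit))" "mem \<sigma>"]
        mem_upd[of 1 \<sigma> s ?m] by (simp del: comp_ex.simps)
  qed
  have a0: "exec (Assign (address 0 (Const s)) (Const 0)) (mem ?\<sigma>)
      (1 + acost (address 0 (Const s)) + acost (Const 0)) (mem (?it 0 ?\<sigma>))"
    using exec_Assign[of "address 0 (Const s)" "Const 0" "mem ?\<sigma>"] mem_upd[of 0 ?\<sigma> s 0] by simp
  let ?c1 = "1 + acost (address 1 (Const s)) + acost (comp_ex (Sub e (Sub e limit)))"
  let ?c0 = "1 + acost (address 0 (Const s)) + acost (Const 0)"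
  have "?c1 + (?c0 + t) \<le> (?c1 + ?c0 + (1 + acost ?te) + ?k) * ((?V + 1) * (?V + 1) ^ depth c)"
    by (rule loop_time[OF t(2)]) (simp, metis const_le_power power_Suc)
  also have "\<dots> = time_factor (For s e c) * (?V + 1) ^ depth (For s e c)"
    by (simp only: time_factor.simps depth.simps power_Suc add.assoc[symmetric]) simp
  finally have "?c1 + (?c0 + t) \<le> time_factor (For s e c) * (?V + 1) ^ depth (For s e c)" .
  moreover have "exec (compile (For s e c)) (mem \<sigma>) (?c1 + (?c0 + t)) (mem (sem (For s e c) \<sigma>))"
    using exec_Seq[OF a1 exec_Seq[OF a0 t(1)]] by (simp only: compile.simps sem.simps)
  ultimately show ?case by blast
qed

section \<open>Assigning the rectangles to the boxes\<close>

abbreviation (input) "W_ar \<equiv> 5 :: nat"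
abbreviation (input) "H_ar \<equiv> 6 :: nat"
abbreviation (input) "Box_ar \<equiv> 7 :: nat"
abbreviation (input) "Rot_ar \<equiv> 8 :: nat"
abbreviation (input) "Pw_ar \<equiv> 9 :: nat"
abbreviation (input) "Ph_ar \<equiv> 10 :: nat"
abbreviation (input) "Px_ar \<equiv> 11 :: nat"
abbreviation (input) "Py_ar \<equiv> 12 :: nat"
abbreviation (input) "Tab_ar \<equiv> 13 :: nat"
abbreviation (input) "Sky_ar \<equiv> 14 :: nat"
abbreviation (input) "BoxX_ar \<equiv> 15 :: nat"
abbreviation (input) "BoxY_ar \<equiv> 16 :: nat"
abbreviation (input) "BoxW_ar \<equiv> 17 :: nat"
abbreviation (input) "BoxH_ar \<equiv> 18 :: nat"
abbreviation (input) "Tall_ar \<equiv> 19 :: nat"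
abbreviation (input) "MaxW_ar \<equiv> 20 :: nat"
abbreviation (input) "MaxH_ar \<equiv> 21 :: nat"
abbreviation (input) "Side_ar \<equiv> 22 :: nat"
abbreviation (input) "AreaC_ar \<equiv> 23 :: nat"
abbreviation (input) "TallC_ar \<equiv> 24 :: nat"
abbreviation (input) "HeightC_ar \<equiv> 25 :: nat"
abbreviation (input) "n_sc \<equiv> 26 :: nat"
abbreviation (input) "height_sc \<equiv> 27 :: nat"
abbreviation (input) "width_sc \<equiv> 28 :: nat"
abbreviation (input) "target_sc \<equiv> 29 :: nat"
abbreviation (input) "flag_sc \<equiv> 30 :: nat"
abbreviation (input) "base_sc \<equiv> 31 :: nat"
abbreviation (input) "rest_sc \<equiv> 32 :: nat"
abbreviation (input) "w_sc \<equiv> 33 :: nat"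
abbreviation (input) "h_sc \<equiv> 34 :: nat"
abbreviation (input) "weight_sc \<equiv> 35 :: nat"
abbreviation (input) "area_sc \<equiv> 36 :: nat"
abbreviation (input) "code_sc \<equiv> 37 :: nat"
abbreviation (input) "row_sc \<equiv> 38 :: nat"
abbreviation (input) "y_sc \<equiv> 39 :: nat"
abbreviation (input) "x_sc \<equiv> 40 :: nat"
abbreviation (input) "side_sc \<equiv> 41 :: nat"
abbreviation (input) "ok_sc \<equiv> 42 :: nat"

section \<open>Multiplication by repeated addition, and the weights\<close>

abbreviation assign :: "nat \<Rightarrow> ex \<Rightarrow> cm" where "assign j e \<equiv> Put j (Num 0) e"

text \<open>The machine cannot multiply, so a product is a loop of additions. Since loop bounds are
  truncated, the first factor must not exceed the truncation number; the second may be arbitrarily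
  large. Slot 5 is reserved for such innermost loops.\<close>

definition accum :: "nat \<Rightarrow> ex \<Rightarrow> ex \<Rightarrow> cm" where
  "accum j e f = For 5 e (assign j (Add (scalar j) f))"

lemma mods_accum [simp]: "mods (accum j e f) = {j}"
  and slots_accum [simp]: "slots (accum j e f) = {5}"
  and wf_accum [simp]: "wf_cm (accum j e f) \<longleftrightarrow> wf_ex e \<and> wf_ex f \<and> 2 < j \<and> j < 64"
  by (auto simp: accum_def)

text \<open>The added expression may refer to counters of enclosing loops. What it must not depend
  on is the accumulator, slot 5 and the array of loop bounds, as these change while the loop
  runs.\<close>

lemma sem_accum:
  assumes f: "\<And>\<tau>. (\<And>j'. 1 < j' \<Longrightarrow> j' \<noteq> j \<Longrightarrow> \<tau> j' = \<sigma> j') \<Longrightarrow> (\<And>s. s \<noteq> 5 \<Longrightarrow> \<tau> 0 s = \<sigma> 0 s) \<Longrightarrow> ev f \<tau> = c"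
    and j: "2 < j"
  shows "sem (accum j e f) \<sigma> j 0 = \<sigma> j 0 + min (ev e \<sigma>) (\<sigma> 2 0) * c"
proof -
  let ?I = "\<lambda>i \<tau>. (\<forall>j'. 1 < j' \<longrightarrow> j' \<noteq> j \<longrightarrow> \<tau> j' = \<sigma> j') \<and> (\<forall>s. s \<noteq> 5 \<longrightarrow> \<tau> 0 s = \<sigma> 0 s) \<and>
    \<tau> j 0 = \<sigma> j 0 + i * c"
  have "?I (min (ev e \<sigma>) (\<sigma> 2 0)) (sem (accum j e f) \<sigma>)"
    unfolding accum_def
  proof (rule For_rule[where I = ?I], goal_cases)
    case (5 i \<tau>)
    then have "ev f \<tau> = c" using f by blast
    with 5 j show ?case by auto
  qed (use j in auto)
  then show ?thesis by simp
qed

definition item_w :: "store \<Rightarrow> bool \<Rightarrow> nat \<Rightarrow> nat" where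
  "item_w \<sigma> r i = (if r then \<sigma> H_ar i else \<sigma> W_ar i)"

definition item_h :: "store \<Rightarrow> bool \<Rightarrow> nat \<Rightarrow> nat" where
  "item_h \<sigma> r i = (if r then \<sigma> W_ar i else \<sigma> H_ar i)"

text \<open>If the coefficients are powers of a large base, then adding weights adds up the area,
  the width of the tall rectangles and the height of every box in separate digits of one
  number.\<close>

definition weight :: "store \<Rightarrow> nat \<Rightarrow> bool \<Rightarrow> nat \<Rightarrow> nat" where
  "weight \<sigma> k r i = item_h \<sigma> r i * item_w \<sigma> r i * \<sigma> AreaC_ar k +
     (if \<sigma> Tall_ar k < item_h \<sigma> r i then item_w \<sigma> r i * \<sigma> TallC_ar k else 0) +
     item_h \<sigma> r i * \<sigma> HeightC_ar k"

definition allowed :: "store \<Rightarrow> nat \<Rightarrow> bool \<Rightarrow> nat \<Rightarrow> bool" where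
  "allowed \<sigma> k r i \<longleftrightarrow> item_w \<sigma> r i \<le> \<sigma> MaxW_ar k \<and> item_h \<sigma> r i \<le> \<sigma> MaxH_ar k"

text \<open>The three bounds are on the loop counts in the computation of a weight, so truncation
  does not falsify it.\<close>

definition small_items :: "store \<Rightarrow> bool" where
  "small_items \<sigma> \<longleftrightarrow> (\<forall>i < \<sigma> n_sc 0. \<forall>r. item_w \<sigma> r i \<le> \<sigma> 2 0 \<and> item_h \<sigma> r i \<le> \<sigma> 2 0 \<and>
     item_h \<sigma> r i * item_w \<sigma> r i \<le> \<sigma> 2 0)"

definition calc :: "bool \<Rightarrow> ex \<Rightarrow> ex \<Rightarrow> cm" where
  "calc r ei ek =
     assign w_sc (Arr (if r then H_ar else W_ar) ei) ;;
     assign h_sc (Arr (if r then W_ar else H_ar) ei) ;;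
     assign area_sc (Num 0) ;;
     accum area_sc (scalar h_sc) (scalar w_sc) ;;
     assign weight_sc (Num 0) ;;
     accum weight_sc (scalar area_sc) (Arr AreaC_ar ek) ;;
     Test (Sub (scalar h_sc) (Arr Tall_ar ek)) (accum weight_sc (scalar w_sc) (Arr TallC_ar ek)) Nop ;;
     accum weight_sc (scalar h_sc) (Arr HeightC_ar ek)"

lemma mods_calc [simp]: "mods (calc r ei ek) = {33, 34, 35, 36}"
  and slots_calc [simp]: "slots (calc r ei ek) = {5}"
  and wf_calc [simp]: "wf_cm (calc r ei ek) \<longleftrightarrow> wf_ex ei \<and> wf_ex ek"
  by (auto simp: calc_def)

text \<open>The index \<open>ei\<close> is the loop counter when the table is filled, and counts
  from the end when the table is traced back. The first assumption is what both have in common: the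
  value depends on the number of rectangles and on counter 6 only.\<close>

lemma sem_calc:
  assumes "\<And>\<tau>. \<tau> n_sc = \<sigma> n_sc \<Longrightarrow> \<tau> 0 6 = \<sigma> 0 6 \<Longrightarrow> ev ei \<tau> = i" and "wf_ex ei"
    and "i < \<sigma> n_sc 0" and "small_items \<sigma>"
  shows "sem (calc r ei (counter 3)) \<sigma> w_sc 0 = item_w \<sigma> r i"
    and "sem (calc r ei (counter 3)) \<sigma> h_sc 0 = item_h \<sigma> r i"
    and "sem (calc r ei (counter 3)) \<sigma> weight_sc 0 = weight \<sigma> (\<sigma> 0 3) r i"
proof -
  let ?c1 = "assign w_sc (Arr (if r then H_ar else W_ar) ei) ;;
     assign h_sc (Arr (if r then W_ar else H_ar) ei) ;; assign area_sc (Num 0)"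
  let ?c2 = "accum area_sc (scalar h_sc) (scalar w_sc)"
  let ?c3 = "assign weight_sc (Num 0)"
  let ?c4 = "accum weight_sc (scalar area_sc) (Arr AreaC_ar (counter 3))"
  let ?c5 = "Test (Sub (scalar h_sc) (Arr Tall_ar (counter 3))) (accum weight_sc (scalar w_sc) (Arr TallC_ar (counter 3))) Nop"
  let ?c6 = "accum weight_sc (scalar h_sc) (Arr HeightC_ar (counter 3))"
  define \<sigma>1 where "\<sigma>1 = sem ?c1 \<sigma>"
  define \<sigma>2 where "\<sigma>2 = sem ?c2 \<sigma>1"
  define \<sigma>3 where "\<sigma>3 = sem ?c3 \<sigma>2"
  define \<sigma>4 where "\<sigma>4 = sem ?c4 \<sigma>3"
  define \<sigma>5 where "\<sigma>5 = sem ?c5 \<sigma>4"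
  define \<sigma>6 where "\<sigma>6 = sem ?c6 \<sigma>5"
  have eq: "sem (calc r ei (counter 3)) \<sigma> = \<sigma>6"
    by (simp add: calc_def \<sigma>1_def \<sigma>2_def \<sigma>3_def \<sigma>4_def \<sigma>5_def \<sigma>6_def)
  have small: "item_w \<sigma> r i \<le> \<sigma> 2 0" "item_h \<sigma> r i \<le> \<sigma> 2 0"
     "item_h \<sigma> r i * item_w \<sigma> r i \<le> \<sigma> 2 0"
    using assms(3,4) by (auto simp: small_items_def)
  have ei: "ev ei \<sigma> = i" "ev ei (upd \<sigma> w_sc 0 v) = i" for v
    using assms(1)[of \<sigma>] assms(1)[of "upd \<sigma> w_sc 0 v"] by simp_all
  have 1: "\<sigma>1 w_sc 0 = item_w \<sigma> r i" "\<sigma>1 h_sc 0 = item_h \<sigma> r i" "\<sigma>1 area_sc 0 = 0"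
    by (auto simp: \<sigma>1_def item_w_def item_h_def ei)
  have o1: "\<sigma>1 j = \<sigma> j" if "j \<notin> {33, 34, 36}" for j
    using that by (auto simp: \<sigma>1_def)
  have o2: "\<sigma>2 j = \<sigma>1 j" if "j \<noteq> 36" "1 < j" for j
    using that by (auto simp: \<sigma>2_def)
  have c2: "\<sigma>2 0 3 = \<sigma> 0 3" by (simp add: \<sigma>2_def o1)
  have 2: "\<sigma>2 area_sc 0 = item_h \<sigma> r i * item_w \<sigma> r i"
    unfolding \<sigma>2_def by (subst sem_accum[where c = "item_w \<sigma> r i"]) (auto simp: 1 o1 small)
  have o4: "\<sigma>4 j = \<sigma>2 j" if "j \<noteq> 35" "1 < j" for j
    using that by (auto simp: \<sigma>4_def \<sigma>3_def)
  have c4: "\<sigma>4 0 3 = \<sigma> 0 3" by (simp add: \<sigma>4_def \<sigma>3_def c2)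
  have 4: "\<sigma>4 weight_sc 0 = item_h \<sigma> r i * item_w \<sigma> r i * \<sigma> AreaC_ar (\<sigma> 0 3)"
    unfolding \<sigma>4_def
    by (subst sem_accum[where c = "\<sigma> AreaC_ar (\<sigma> 0 3)"])
      (auto simp: \<sigma>3_def 2 o2 o1 c2 small)
  have o5: "\<sigma>5 j = \<sigma>4 j" if "j \<noteq> 35" "1 < j" for j
    using that by (auto simp: \<sigma>5_def)
  have c5: "\<sigma>5 0 3 = \<sigma> 0 3" by (simp add: \<sigma>5_def c4)
  have h4: "\<sigma>4 h_sc 0 = item_h \<sigma> r i" "\<sigma>4 w_sc 0 = item_w \<sigma> r i" "\<sigma>4 2 0 = \<sigma> 2 0"
    by (simp_all add: o4 o2 o1 1)
  have t: "\<sigma>4 Tall_ar = \<sigma> Tall_ar" "\<sigma>4 TallC_ar = \<sigma> TallC_ar" "\<sigma>4 HeightC_ar = \<sigma> HeightC_ar"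
    by (simp_all add: o4 o2 o1)
  have 5: "\<sigma>5 weight_sc 0 = item_h \<sigma> r i * item_w \<sigma> r i * \<sigma> AreaC_ar (\<sigma> 0 3) +
     (if \<sigma> Tall_ar (\<sigma> 0 3) < item_h \<sigma> r i then item_w \<sigma> r i * \<sigma> TallC_ar (\<sigma> 0 3) else 0)"
  proof -
    have "sem (accum weight_sc (scalar w_sc) (Arr TallC_ar (counter 3))) \<sigma>4 weight_sc 0
        = \<sigma>4 weight_sc 0 + item_w \<sigma> r i * \<sigma> TallC_ar (\<sigma> 0 3)"
      by (subst sem_accum[where c = "\<sigma> TallC_ar (\<sigma> 0 3)"]) (auto simp: c4 t h4 small)
    then show ?thesis by (auto simp: \<sigma>5_def h4 t c4 4)
  qed
  have 6: "\<sigma>6 weight_sc 0 = weight \<sigma> (\<sigma> 0 3) r i"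
    unfolding \<sigma>6_def
    by (subst sem_accum[where c = "\<sigma> HeightC_ar (\<sigma> 0 3)"])
      (auto simp: 5 o5 c5 t h4 small weight_def)
  show "sem (calc r ei (counter 3)) \<sigma> weight_sc 0 = weight \<sigma> (\<sigma> 0 3) r i"
    unfolding eq by (rule 6)
  show "sem (calc r ei (counter 3)) \<sigma> w_sc 0 = item_w \<sigma> r i"
    "sem (calc r ei (counter 3)) \<sigma> h_sc 0 = item_h \<sigma> r i"
    unfolding eq by (simp_all add: \<sigma>6_def o5 h4)
qed

definition same_on :: "nat set \<Rightarrow> store \<Rightarrow> store \<Rightarrow> bool" where
  "same_on J \<tau> \<sigma> \<longleftrightarrow> (\<forall>j \<in> J. \<tau> j = \<sigma> j)"

text \<open>Everything that the weights, \<open>allowed\<close> and the shape of the table depend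
  on. The dynamic program leaves these arrays alone, so statements about later stores can be carried
  back to the first one.\<close>

abbreviation input_ids :: "nat set" where
  "input_ids \<equiv> {2, 5, 6, 19, 20, 21, 23, 24, 25, 26}"

lemma same_on_upd [simp]: "j \<notin> J \<Longrightarrow> same_on J (upd \<tau> j i v) \<sigma> = same_on J \<tau> \<sigma>"
  by (auto simp: same_on_def upd_def)

lemma same_on_sem: "same_on J \<tau> \<sigma> \<Longrightarrow> J \<inter> mods c = {} \<Longrightarrow> \<forall>j \<in> J. 1 < j \<Longrightarrow> same_on J (sem c \<tau>) \<sigma>"
  unfolding same_on_def by (metis disjoint_iff sem_unmodified)

lemma same_on_inputs:
  assumes "same_on input_ids \<tau> \<sigma>"
  shows "weight \<tau> k r i = weight \<sigma> k r i" "allowed \<tau> k r i = allowed \<sigma> k r i"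
    "item_w \<tau> r i = item_w \<sigma> r i" "item_h \<tau> r i = item_h \<sigma> r i"
    "small_items \<tau> = small_items \<sigma>" "\<tau> n_sc = \<sigma> n_sc" "\<tau> 2 = \<sigma> 2"
  using assms
  by (auto simp: same_on_def weight_def allowed_def item_w_def item_h_def small_items_def)

section \<open>Dynamic programming over the total weight\<close>

primrec reach :: "store \<Rightarrow> nat \<Rightarrow> bool set \<Rightarrow> nat \<Rightarrow> nat \<Rightarrow> bool" where
  "reach \<sigma> K R 0 g \<longleftrightarrow> g = 0"
| "reach \<sigma> K R (Suc i) g \<longleftrightarrow>
     (\<exists>k<K. \<exists>r\<in>R. allowed \<sigma> k r i \<and> weight \<sigma> k r i \<le> g \<and> reach \<sigma> K R i (g - weight \<sigma> k r i))"

definition rotations :: "bool \<Rightarrow> bool set" where "rotations rot = (if rot then {False, True} else {False})"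

text \<open>The table keeps this number as the last choice on a way to a total. It is never 0,
  because 0 marks totals that are out of reach.\<close>

definition code :: "nat \<Rightarrow> bool \<Rightarrow> nat" where "code k r = k + k + (if r then 2 else 1)"

lemma code_inj: "code k r = code k' r' \<longleftrightarrow> k = k' \<and> r = r'"
  by (auto simp: code_def split: if_splits; presburger)

text \<open>An entry that is set already is simply overwritten: it is irrelevant which of several
  ways to the same total is remembered.\<close>

definition fill_choice :: "bool \<Rightarrow> cm" where
  "fill_choice r =
     calc r (counter 6) (counter 3) ;;
     Test (Sub (scalar w_sc) (Arr MaxW_ar (counter 3))) Nop
    (Test (Sub (scalar h_sc) (Arr MaxH_ar (counter 3))) Nop
    (For 4 limit
      (Test (Arr Tab_ar (Add (scalar base_sc) (counter 4)))
        (Test (Sub limit (Add (counter 4) (scalar weight_sc)))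
          (Put Tab_ar (Add (Add (scalar base_sc) limit) (Add (counter 4) (scalar weight_sc)))
             (Add (Add (counter 3) (counter 3)) (Num (if r then 2 else 1))))
          Nop)
        Nop)))"

text \<open>\<open>base_sc\<close> is the start of the current row, the product of row number and
  row length; it is kept up to date by additions.\<close>

definition fill_table :: "nat \<Rightarrow> bool \<Rightarrow> cm" where
  "fill_table K rot =
     assign base_sc (Num 0) ;;
     For 2 limit (Put Tab_ar (counter 2) (Num 0)) ;;
     Put Tab_ar (Num 0) (Num 1) ;;
     For 6 (scalar n_sc)
      (For 2 limit (Put Tab_ar (Add (Add (scalar base_sc) limit) (counter 2)) (Num 0)) ;;
       For 3 (Num K) (fill_choice False ;; (if rot then fill_choice True else Nop)) ;;
       assign base_sc (Add (scalar base_sc) limit))"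

lemma mods_fill_choice [simp]: "mods (fill_choice r) = {13, 33, 34, 35, 36}"
  and slots_fill_choice [simp]: "slots (fill_choice r) = {4, 5}"
  and wf_fill_choice [simp]: "wf_cm (fill_choice r)"
  by (auto simp: fill_choice_def)

lemma mods_fill_table [simp]: "mods (fill_table K rot) = {13, 31, 33, 34, 35, 36}"
  and slots_fill_table [simp]: "slots (fill_table K rot) = {2, 3, 4, 5, 6}"
  and wf_fill_table [simp]: "wf_cm (fill_table K rot)"
  by (auto simp: fill_table_def)

text \<open>The state of a new table row when the moves in \<open>S\<close> from the old row \<open>i\<close> have been made.\<close>

definition row_moves :: "store \<Rightarrow> nat \<Rightarrow> (nat \<times> nat \<times> bool) set \<Rightarrow> (nat \<Rightarrow> nat) \<Rightarrow> bool" where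
  "row_moves \<sigma> i S T \<longleftrightarrow> (\<forall>g < \<sigma> 2 0.
     (T (Suc i * \<sigma> 2 0 + g) \<noteq> 0 \<longrightarrow> (\<exists>(g', k, r) \<in> S. T (Suc i * \<sigma> 2 0 + g) = code k r \<and>
        allowed \<sigma> k r i \<and> g = g' + weight \<sigma> k r i \<and> T (i * \<sigma> 2 0 + g') \<noteq> 0)) \<and>
     (\<forall>(g', k, r) \<in> S. allowed \<sigma> k r i \<and> g = g' + weight \<sigma> k r i \<and> T (i * \<sigma> 2 0 + g') \<noteq> 0 \<longrightarrow>
        T (Suc i * \<sigma> 2 0 + g) \<noteq> 0))"

lemma row_moves_not_allowed:
  "row_moves \<sigma> i S T \<Longrightarrow> \<not> allowed \<sigma> k r i \<Longrightarrow> row_moves \<sigma> i (S \<union> {..<m} \<times> {k} \<times> {r}) T"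
  unfolding row_moves_def by fast

text \<open>The old and the new row are disjoint parts of the table, because the old total is less
  than the row length; so a new entry does not disturb the conditions on the old row. A total beyond
  the row length is not written, and \<open>row_moves\<close> claims nothing about it.\<close>

lemma row_moves_add:
  assumes "row_moves \<sigma> i S T" "allowed \<sigma> k r i" "g' < \<sigma> 2 0"
  shows "row_moves \<sigma> i (insert (g', k, r) S)
    (if T (i * \<sigma> 2 0 + g') \<noteq> 0 \<and> g' + weight \<sigma> k r i < \<sigma> 2 0
     then T(Suc i * \<sigma> 2 0 + (g' + weight \<sigma> k r i) := code k r) else T)"
proof (cases "T (i * \<sigma> 2 0 + g') \<noteq> 0 \<and> g' + weight \<sigma> k r i < \<sigma> 2 0")
  case True
  let ?V = "\<sigma> 2 0" and ?z = "weight \<sigma> k r i"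
  have [simp]: "0 < code k r" by (simp add: code_def)
  have ne: "i * ?V + x \<noteq> Suc i * ?V + y" if "x < ?V" for x y using that by simp
  let ?T = "T(Suc i * ?V + (g' + ?z) := code k r)"
  have old: "?T (i * ?V + x) = T (i * ?V + x)" if "x < ?V" for x using ne[OF that] by simp
  show ?thesis unfolding if_P[OF True] row_moves_def
  proof (intro allI impI conjI ballI)
    fix g assume g: "g < ?V"
    show "\<exists>(g'', k', r')\<in>insert (g', k, r) S. ?T (Suc i * ?V + g) = code k' r' \<and>
       allowed \<sigma> k' r' i \<and> g = g'' + weight \<sigma> k' r' i \<and> ?T (i * ?V + g'') \<noteq> 0"
      if "?T (Suc i * ?V + g) \<noteq> 0"
    proof (cases "g = g' + ?z")
      case True
      then show ?thesis using \<open>T _ \<noteq> 0 \<and> _\<close> assms(2,3) old by auto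
    next
      case False
      then have "T (Suc i * ?V + g) \<noteq> 0" using that by simp
      then obtain g'' k' r' where "(g'', k', r') \<in> S" "T (Suc i * ?V + g) = code k' r'"
        "allowed \<sigma> k' r' i" "g = g'' + weight \<sigma> k' r' i" "T (i * ?V + g'') \<noteq> 0"
        using assms(1) g unfolding row_moves_def by fast
      then show ?thesis using False old[of g''] g
        by (intro bexI[of _ "(g'', k', r')"]) auto
    qed
    fix q assume q: "q \<in> insert (g', k, r) S"
    obtain g'' k' r' where q': "q = (g'', k', r')" by (cases q)
    have "?T (Suc i * ?V + g) \<noteq> 0"
      if *: "allowed \<sigma> k' r' i" "g = g'' + weight \<sigma> k' r' i" "?T (i * ?V + g'') \<noteq> 0"
    proof (cases "(g'', k', r') \<in> S")
      case True
      have "T (i * ?V + g'') \<noteq> 0" using *(2,3) g old[of g''] by auto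
      with True *(1,2) have "T (Suc i * ?V + g) \<noteq> 0"
        using assms(1) g unfolding row_moves_def by fast
      then show ?thesis by simp
    next
      case False
      with q q' *(2) show ?thesis by simp
    qed
    then show "case q of (g'', k', r') \<Rightarrow> allowed \<sigma> k' r' i \<and> g = g'' + weight \<sigma> k' r' i \<and>
       ?T (i * ?V + g'') \<noteq> 0 \<longrightarrow> ?T (Suc i * ?V + g) \<noteq> 0"
      unfolding q' prod.case by blast
  qed
next
  case False
  have "row_moves \<sigma> i (insert (g', k, r) S) T"
    using assms False unfolding row_moves_def by fastforce
  then show ?thesis unfolding if_not_P[OF False] .
qed

lemma sem_fill_choice:
  assumes env: "same_on input_ids \<tau> \<sigma>" "small_items \<sigma>" "i < \<sigma> n_sc 0"
    and st: "\<tau> 0 6 = i" "\<tau> 0 3 = k" "\<tau> base_sc 0 = i * \<sigma> 2 0" "row_moves \<sigma> i S (\<tau> Tab_ar)"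
  shows "row_moves \<sigma> i (S \<union> {..<\<sigma> 2 0} \<times> {k} \<times> {r}) (sem (fill_choice r) \<tau> Tab_ar)"
    and "\<forall>x < Suc i * \<sigma> 2 0. sem (fill_choice r) \<tau> Tab_ar x = \<tau> Tab_ar x"
proof -
  let ?V = "\<sigma> 2 0" and ?z = "weight \<sigma> k r i"
  let ?body = "Test (Arr Tab_ar (Add (scalar base_sc) (counter 4)))
        (Test (Sub limit (Add (counter 4) (scalar weight_sc)))
          (Put Tab_ar (Add (Add (scalar base_sc) limit) (Add (counter 4) (scalar weight_sc)))
             (Add (Add (counter 3) (counter 3)) (Num (if r then 2 else 1))))
          Nop)
        Nop"
  define \<tau>1 where "\<tau>1 = sem (calc r (counter 6) (counter 3)) \<tau>"
  note eqs = same_on_inputs[OF env(1)]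
  have c: "\<tau>1 w_sc 0 = item_w \<sigma> r i" "\<tau>1 h_sc 0 = item_h \<sigma> r i" "\<tau>1 weight_sc 0 = ?z"
    using sem_calc[of \<tau> "counter 6" i r] env st unfolding \<tau>1_def by (simp_all add: eqs)
  have o: "\<tau>1 j = \<tau> j" if "j \<notin> {33,34,35,36}" "1 < j" for j
    using that by (simp add: \<tau>1_def)
  have o': "\<tau>1 0 6 = i" "\<tau>1 0 3 = k" using st by (simp_all add: \<tau>1_def)
  have M: "\<tau>1 MaxW_ar k = \<sigma> MaxW_ar k" "\<tau>1 MaxH_ar k = \<sigma> MaxH_ar k" "\<tau>1 2 = \<sigma> 2" "\<tau>1 base_sc 0 = i * ?V"
      "\<tau>1 Tab_ar = \<tau> Tab_ar"
    using env(1) st by (simp_all add: o same_on_def)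
  have "row_moves \<sigma> i (S \<union> {..<?V} \<times> {k} \<times> {r}) (sem (fill_choice r) \<tau> Tab_ar) \<and>
    (\<forall>x < Suc i * ?V. sem (fill_choice r) \<tau> Tab_ar x = \<tau> Tab_ar x)"
  proof (cases "allowed \<sigma> k r i")
    case False
    then have "sem (fill_choice r) \<tau> = \<tau>1"
      by (auto simp: fill_choice_def \<tau>1_def[symmetric] c M o' allowed_def)
    then show ?thesis using row_moves_not_allowed[OF st(4) False] by (auto simp: M)
  next
    case True
    then have eq: "sem (fill_choice r) \<tau> = sem (For 4 limit ?body) \<tau>1"
      by (auto simp: fill_choice_def \<tau>1_def[symmetric] c M o' allowed_def)
    let ?I = "\<lambda>m \<tau>'. \<tau>' 2 = \<sigma> 2 \<and> \<tau>' base_sc 0 = i * ?V \<and> \<tau>' weight_sc 0 = ?z \<and> \<tau>' 0 3 = k \<and>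
       row_moves \<sigma> i (S \<union> {..<m} \<times> {k} \<times> {r}) (\<tau>' Tab_ar) \<and>
       (\<forall>x < Suc i * ?V. \<tau>' Tab_ar x = \<tau> Tab_ar x)"
    have "?I ?V (sem (For 4 limit ?body) \<tau>1)"
    proof (rule For_rule[where I = ?I], goal_cases)
      case (5 g \<tau>')
      let ?T = "\<tau>' Tab_ar"
      have g: "g < ?V" using 5 by simp
      have *: "sem ?body \<tau>' Tab_ar = (if ?T (i * ?V + g) \<noteq> 0 \<and> g + ?z < ?V
           then ?T(Suc i * ?V + (g + ?z) := code k r) else ?T)"
        using 5 by (auto simp: code_def add.commute add.left_commute)
      have "row_moves \<sigma> i (insert (g, k, r) (S \<union> {..<g} \<times> {k} \<times> {r})) (sem ?body \<tau>' Tab_ar)"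
        unfolding * using 5 by (intro row_moves_add[OF _ True g]) simp
      moreover have "insert (g, k, r) (S \<union> {..<g} \<times> {k} \<times> {r}) = S \<union> {..<Suc g} \<times> {k} \<times> {r}"
        by auto
      moreover have "\<forall>x < Suc i * ?V. sem ?body \<tau>' Tab_ar x = \<tau> Tab_ar x"
        unfolding * using 5 by auto
      ultimately show ?case using 5 by (simp del: sem.simps(4))
    qed (use M c o' st in auto)
    then show ?thesis unfolding eq by auto
  qed
  then show "row_moves \<sigma> i (S \<union> {..<\<sigma> 2 0} \<times> {k} \<times> {r}) (sem (fill_choice r) \<tau> Tab_ar)"
    and "\<forall>x < Suc i * \<sigma> 2 0. sem (fill_choice r) \<tau> Tab_ar x = \<tau> Tab_ar x" by blast+
qed

text \<open>Besides being correct about reachability, a remembered choice has to lead back to a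
  reachable total of the previous row. This is why tracing back never gets stuck.\<close>

definition row_ok :: "store \<Rightarrow> nat \<Rightarrow> bool set \<Rightarrow> nat \<Rightarrow> (nat \<Rightarrow> nat) \<Rightarrow> bool" where
  "row_ok \<sigma> K R i T \<longleftrightarrow> (\<forall>g < \<sigma> 2 0.
     (T (i * \<sigma> 2 0 + g) \<noteq> 0 \<longleftrightarrow> reach \<sigma> K R i g) \<and>
     (\<forall>i'. i = Suc i' \<longrightarrow> T (i * \<sigma> 2 0 + g) \<noteq> 0 \<longrightarrow> (\<exists>k<K. \<exists>r\<in>R. T (i * \<sigma> 2 0 + g) = code k r \<and>
        allowed \<sigma> k r i' \<and> weight \<sigma> k r i' \<le> g \<and> reach \<sigma> K R i' (g - weight \<sigma> k r i'))))"

lemma row_ok_Suc: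
  assumes "row_ok \<sigma> K R i T" "row_moves \<sigma> i ({..<\<sigma> 2 0} \<times> {..<K} \<times> R) T"
  shows "row_ok \<sigma> K R (Suc i) T"
proof -
  let ?V = "\<sigma> 2 0"
  have move: "\<exists>k<K. \<exists>r\<in>R. T (Suc i * ?V + g) = code k r \<and> allowed \<sigma> k r i \<and> weight \<sigma> k r i \<le> g \<and>
      reach \<sigma> K R i (g - weight \<sigma> k r i)" if g: "g < ?V" "T (Suc i * ?V + g) \<noteq> 0" for g
  proof -
    from assms(2) g obtain g' k r where "k < K" "r \<in> R" "T (Suc i * ?V + g) = code k r"
      "allowed \<sigma> k r i" "g = g' + weight \<sigma> k r i" "T (i * ?V + g') \<noteq> 0" "g' < ?V"
      unfolding row_moves_def by fast
    moreover have "reach \<sigma> K R i g'" using assms(1) calculation unfolding row_ok_def by auto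
    ultimately show ?thesis by (metis add_diff_cancel_right' le_add2)
  qed
  have "T (Suc i * ?V + g) \<noteq> 0" if g: "g < ?V" "reach \<sigma> K R (Suc i) g" for g
  proof -
    from g obtain k r where *: "k < K" "r \<in> R" "allowed \<sigma> k r i" "weight \<sigma> k r i \<le> g"
      "reach \<sigma> K R i (g - weight \<sigma> k r i)" by auto
    have "g - weight \<sigma> k r i < ?V" using g by simp
    then have "T (i * ?V + (g - weight \<sigma> k r i)) \<noteq> 0"
      using assms(1) *(5) unfolding row_ok_def by blast
    moreover have "(g - weight \<sigma> k r i, k, r) \<in> {..<?V} \<times> {..<K} \<times> R" using * g by auto
    moreover have "\<forall>(g', k, r) \<in> {..<?V} \<times> {..<K} \<times> R. allowed \<sigma> k r i \<and> g = g' + weight \<sigma> k r i \<and>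
        T (i * ?V + g') \<noteq> 0 \<longrightarrow> T (Suc i * ?V + g) \<noteq> 0"
      using assms(2) g(1) unfolding row_moves_def by blast
    ultimately have "allowed \<sigma> k r i \<and> g = (g - weight \<sigma> k r i) + weight \<sigma> k r i \<longrightarrow>
        T (Suc i * ?V + g) \<noteq> 0" by blast
    then show ?thesis using *(3,4) by simp
  qed
  moreover have "reach \<sigma> K R (Suc i) g" if "g < ?V" "T (Suc i * ?V + g) \<noteq> 0" for g
    using move[OF that] by auto
  ultimately show ?thesis using move unfolding row_ok_def by blast
qed

lemma row_ok_cong:
  assumes "row_ok \<sigma> K R i T" "\<forall>x < Suc i * \<sigma> 2 0. T' x = T x"
  shows "row_ok \<sigma> K R i T'"
  using assms by (simp add: row_ok_def)

lemma sem_fill_table: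
  assumes "small_items \<sigma>" "\<sigma> n_sc 0 \<le> \<sigma> 2 0" "K \<le> \<sigma> 2 0"
  shows "\<forall>i \<le> \<sigma> n_sc 0. row_ok \<sigma> K (rotations rot) i (sem (fill_table K rot) \<sigma> Tab_ar)"
    and "sem (fill_table K rot) \<sigma> base_sc 0 = \<sigma> n_sc 0 * \<sigma> 2 0"
proof -
  let ?V = "\<sigma> 2 0" and ?n = "\<sigma> n_sc 0" and ?R = "rotations rot"
  let ?init = "assign base_sc (Num 0) ;; For 2 limit (Put Tab_ar (counter 2) (Num 0)) ;; Put Tab_ar (Num 0) (Num 1)"
  let ?clear = "For 2 limit (Put Tab_ar (Add (Add (scalar base_sc) limit) (counter 2)) (Num 0))"
  let ?choose = "fill_choice False ;; (if rot then fill_choice True else Nop)"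
  let ?body = "?clear ;; For 3 (Num K) ?choose ;; assign base_sc (Add (scalar base_sc) limit)"
  define \<tau>0 where "\<tau>0 = sem ?init \<sigma>"
  have eq: "sem (fill_table K rot) \<sigma> = sem (For 6 (scalar n_sc) ?body) \<tau>0"
    by (simp add: fill_table_def \<tau>0_def)
  have o0: "\<tau>0 j = \<sigma> j" if "j \<notin> {13, 31}" "1 < j" for j
    using that by (auto simp: \<tau>0_def simp del: sem.simps(5))
  have b0: "\<tau>0 base_sc 0 = 0" by (simp add: \<tau>0_def del: sem.simps(5))
  have "row_ok \<sigma> K ?R 0 (\<tau>0 Tab_ar)"
  proof -
    let ?I = "\<lambda>m \<tau>. \<forall>g<m. \<tau> Tab_ar g = 0"
    have "?I ?V (sem (For 2 limit (Put Tab_ar (counter 2) (Num 0))) (sem (assign base_sc (Num 0)) \<sigma>))"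
      by (rule For_rule[where I = ?I]) (auto simp: less_Suc_eq)
    then have "\<forall>g<?V. \<tau>0 Tab_ar g = (if g = 0 then 1 else 0)"
      by (auto simp: \<tau>0_def simp del: sem.simps(5))
    then show ?thesis by (simp add: row_ok_def)
  qed
  let ?I = "\<lambda>i \<tau>. same_on input_ids \<tau> \<sigma> \<and> \<tau> base_sc 0 = i * ?V \<and> (\<forall>i' \<le> i. row_ok \<sigma> K ?R i' (\<tau> Tab_ar))"
  have "?I ?n (sem (For 6 (scalar n_sc) ?body) \<tau>0)"
  proof (rule For_rule[where I = ?I], goal_cases)
    case 1
    then show ?case using \<open>row_ok \<sigma> K ?R 0 (\<tau>0 Tab_ar)\<close> by (auto simp: same_on_def o0 b0)
  next
    case 2
    then show ?case using assms by (simp add: o0)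
  next
    case (5 i \<tau>)
    then have i: "i < ?n" and \<tau>: "same_on input_ids \<tau> \<sigma>" "\<tau> base_sc 0 = i * ?V" "\<tau> 0 6 = i"
      and rows: "\<And>i'. i' \<le> i \<Longrightarrow> row_ok \<sigma> K ?R i' (\<tau> Tab_ar)" by auto
    define \<tau>1 where "\<tau>1 = sem ?clear \<tau>"
    let ?J = "\<lambda>m \<tau>'. \<tau>' 2 = \<sigma> 2 \<and> \<tau>' base_sc 0 = i * ?V \<and> (\<forall>x<Suc i * ?V. \<tau>' Tab_ar x = \<tau> Tab_ar x) \<and>
      (\<forall>g<m. \<tau>' Tab_ar (Suc i * ?V + g) = 0)"
    have "?J ?V \<tau>1"
      unfolding \<tau>1_def
      by (rule For_rule[where I = ?J]) (use \<tau> in \<open>auto simp: less_Suc_eq same_on_def\<close>)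
    then have \<tau>1: "\<forall>x<Suc i * ?V. \<tau>1 Tab_ar x = \<tau> Tab_ar x" "row_moves \<sigma> i {} (\<tau>1 Tab_ar)"
        "\<tau>1 base_sc 0 = i * ?V"
      by (auto simp: row_moves_def)
    have env1: "same_on input_ids \<tau>1 \<sigma>" "\<tau>1 0 6 = i"
      using \<tau> by (auto simp: \<tau>1_def intro!: same_on_sem simp del: sem.simps)
    define \<tau>2 where "\<tau>2 = sem (For 3 (Num K) ?choose) \<tau>1"
    let ?L = "\<lambda>k \<tau>'. same_on input_ids \<tau>' \<sigma> \<and> \<tau>' 0 6 = i \<and> \<tau>' base_sc 0 = i * ?V \<and>
       row_moves \<sigma> i ({..<?V} \<times> {..<k} \<times> ?R) (\<tau>' Tab_ar) \<and>
       (\<forall>x<Suc i * ?V. \<tau>' Tab_ar x = \<tau> Tab_ar x)"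
    have "?L K \<tau>2"
      unfolding \<tau>2_def
    proof (rule For_rule[where I = ?L], goal_cases)
      case 2
      then show ?case using assms env1 by (simp add: same_on_def)
    next
      case (5 k \<tau>')
      let ?S = "{..<?V} \<times> {..<k} \<times> ?R"
      define \<tau>3 where "\<tau>3 = sem (fill_choice False) \<tau>'"
      have 3: "row_moves \<sigma> i (?S \<union> {..<?V} \<times> {k} \<times> {False}) (\<tau>3 Tab_ar)"
          "\<forall>x<Suc i * ?V. \<tau>3 Tab_ar x = \<tau> Tab_ar x"
        using sem_fill_choice[of \<tau>' \<sigma> i k ?S False] 5 assms(1) i unfolding \<tau>3_def by auto
      have env3: "same_on input_ids \<tau>3 \<sigma>" "\<tau>3 0 6 = i" "\<tau>3 0 3 = k" "\<tau>3 base_sc 0 = i * ?V"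
        using 5 by (auto simp: \<tau>3_def intro!: same_on_sem)
      show ?case
      proof (cases rot)
        case False
        have "?S \<union> {..<?V} \<times> {k} \<times> {False} = {..<?V} \<times> {..<Suc k} \<times> ?R"
          using False by (auto simp: rotations_def)
        with False 3 env3 show ?thesis by (simp add: \<tau>3_def)
      next
        case True
        define \<tau>4 where "\<tau>4 = sem (fill_choice True) \<tau>3"
        have 4: "row_moves \<sigma> i (?S \<union> {..<?V} \<times> {k} \<times> {False} \<union> {..<?V} \<times> {k} \<times> {True}) (\<tau>4 Tab_ar)"
            "\<forall>x<Suc i * ?V. \<tau>4 Tab_ar x = \<tau> Tab_ar x"
          using sem_fill_choice[of \<tau>3 \<sigma> i k _ True] 3 env3 assms(1) i unfolding \<tau>4_def by auto
        have env4: "same_on input_ids \<tau>4 \<sigma>" "\<tau>4 0 6 = i" "\<tau>4 base_sc 0 = i * ?V"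
          using env3 by (auto simp: \<tau>4_def intro!: same_on_sem)
        have "?S \<union> {..<?V} \<times> {k} \<times> {False} \<union> {..<?V} \<times> {k} \<times> {True} = {..<?V} \<times> {..<Suc k} \<times> ?R"
          using True by (auto simp: rotations_def)
        with True 4 env4 show ?thesis by (simp add: \<tau>3_def \<tau>4_def)
      qed
    qed (use env1 \<tau>1 in auto)
    then have 2: "same_on input_ids \<tau>2 \<sigma>" "\<tau>2 base_sc 0 = i * ?V"
        "row_moves \<sigma> i ({..<?V} \<times> {..<K} \<times> ?R) (\<tau>2 Tab_ar)" "\<forall>x<Suc i * ?V. \<tau>2 Tab_ar x = \<tau> Tab_ar x"
      by auto
    have "row_ok \<sigma> K ?R i' (\<tau>2 Tab_ar)" if "i' \<le> i" for i'
    proof (rule row_ok_cong[OF rows[OF that]])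
      have "Suc i' * ?V \<le> Suc i * ?V" using that by (intro mult_le_mono1) simp
      then show "\<forall>x<Suc i' * ?V. \<tau>2 Tab_ar x = \<tau> Tab_ar x"
        using 2(4) less_le_trans by blast
    qed
    then have "row_ok \<sigma> K ?R i' (\<tau>2 Tab_ar)" if "i' \<le> Suc i" for i'
      using that row_ok_Suc[OF _ 2(3)] by (cases "i' = Suc i") auto
    moreover have "\<tau>2 2 = \<sigma> 2" using 2(1) by (simp add: same_on_def)
    ultimately show ?case
      using 2 by (simp add: \<tau>1_def[symmetric] \<tau>2_def[symmetric] del: sem.simps(5))
  qed auto
  then show "\<forall>i \<le> \<sigma> n_sc 0. row_ok \<sigma> K (rotations rot) i (sem (fill_table K rot) \<sigma> Tab_ar)"
    and "sem (fill_table K rot) \<sigma> base_sc 0 = \<sigma> n_sc 0 * \<sigma> 2 0"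
    unfolding eq by auto
qed

declare sem.simps(5) [simp del]

lemma reach_sum:
  assumes "\<And>i'. i' < i \<Longrightarrow> k i' < K \<and> r i' \<in> R \<and> allowed \<sigma> (k i') (r i') i'"
  shows "reach \<sigma> K R i (\<Sum>i'<i. weight \<sigma> (k i') (r i') i')"
  using assms
proof (induction i)
  case (Suc i)
  then have "reach \<sigma> K R i (\<Sum>i'<i. weight \<sigma> (k i') (r i') i')" by simp
  with Suc.prems[of i] show ?case by (auto intro!: exI[of _ "k i"] bexI[of _ "r i"])
qed simp

section \<open>Tracing back an assignment with the target total\<close>

definition neq :: "ex \<Rightarrow> ex \<Rightarrow> ex" where "neq e f = Add (Sub e f) (Sub f e)"

lemma ev_neq [simp]: "ev (neq e f) \<sigma> = 0 \<longleftrightarrow> ev e \<sigma> = ev f \<sigma>"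
  and wf_neq [simp]: "wf_ex (neq e f) \<longleftrightarrow> wf_ex e \<and> wf_ex f"
  by (auto simp: neq_def)

definition back_index :: ex where "back_index = Sub (scalar n_sc) (Add (counter 6) (Num 1))"

lemma ev_back_index [simp]: "ev back_index \<sigma> = \<sigma> n_sc 0 - Suc (\<sigma> 0 6)"
  and wf_back_index [simp]: "wf_ex back_index"
  by (auto simp: back_index_def)

text \<open>There is no division, so a code is decoded by comparing it with the codes of all pairs
  of box and orientation. It is read once per rectangle, before the loop over the boxes; hence
  exactly one pair matches although \<open>rest_sc\<close> changes on the way.\<close>

definition trace_choice :: "bool \<Rightarrow> cm" where
  "trace_choice r =
     Test (neq (scalar code_sc) (Add (Add (counter 3) (counter 3)) (Num (if r then 2 else 1)))) Nop
      (Put Box_ar back_index (counter 3) ;;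
       Put Rot_ar back_index (Num (if r then 1 else 0)) ;;
       calc r back_index (counter 3) ;;
       assign rest_sc (Sub (scalar rest_sc) (scalar weight_sc)))"

definition trace :: "nat \<Rightarrow> bool \<Rightarrow> cm" where
  "trace K rot =
     assign rest_sc (scalar target_sc) ;;
     For 6 (scalar n_sc)
      (assign code_sc (Arr Tab_ar (Add (scalar base_sc) (scalar rest_sc))) ;;
       For 3 (Num K) (trace_choice False ;; (if rot then trace_choice True else Nop)) ;;
       assign base_sc (Sub (scalar base_sc) limit))"

lemma mods_trace_choice [simp]: "mods (trace_choice r) = {7, 8, 32, 33, 34, 35, 36}"
  and slots_trace_choice [simp]: "slots (trace_choice r) = {5}"
  and wf_trace_choice [simp]: "wf_cm (trace_choice r)"
  by (auto simp: trace_choice_def)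

lemma mods_trace [simp]: "mods (trace K rot) = {7, 8, 31, 32, 33, 34, 35, 36, 37}"
  and slots_trace [simp]: "slots (trace K rot) = {3, 5, 6}"
  and wf_trace [simp]: "wf_cm (trace K rot)"
  by (auto simp: trace_def)

lemma sem_trace_choice:
  assumes env: "same_on input_ids \<tau> \<sigma>" "small_items \<sigma>" "\<tau> 0 6 < \<sigma> n_sc 0"
  shows "\<tau> code_sc 0 \<noteq> code (\<tau> 0 3) r \<Longrightarrow> sem (trace_choice r) \<tau> = \<tau>"
    and "\<tau> code_sc 0 = code (\<tau> 0 3) r \<Longrightarrow>
      sem (trace_choice r) \<tau> Box_ar = (\<tau> Box_ar)(\<sigma> n_sc 0 - Suc (\<tau> 0 6) := \<tau> 0 3) \<and>
      sem (trace_choice r) \<tau> Rot_ar = (\<tau> Rot_ar)(\<sigma> n_sc 0 - Suc (\<tau> 0 6) := (if r then 1 else 0)) \<and>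
      sem (trace_choice r) \<tau> rest_sc 0
        = \<tau> rest_sc 0 - weight \<sigma> (\<tau> 0 3) r (\<sigma> n_sc 0 - Suc (\<tau> 0 6))"
proof -
  show "sem (trace_choice r) \<tau> = \<tau>" if "\<tau> code_sc 0 \<noteq> code (\<tau> 0 3) r"
    using that by (auto simp: trace_choice_def code_def)
  let ?i = "\<sigma> n_sc 0 - Suc (\<tau> 0 6)"
  have n: "\<tau> n_sc = \<sigma> n_sc" using env(1) by (simp add: same_on_def)
  define \<tau>1 where "\<tau>1 = upd (upd \<tau> Box_ar ?i (\<tau> 0 3)) Rot_ar ?i (if r then 1 else 0)"
  have env1: "same_on input_ids \<tau>1 \<sigma>" using env(1) by (simp add: \<tau>1_def)
  have si: "small_items \<tau>1" "\<tau>1 n_sc = \<sigma> n_sc" "\<tau>1 0 6 = \<tau> 0 6"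
    using env(2) by (simp_all add: same_on_inputs[OF env1]) (simp add: \<tau>1_def)
  have "sem (calc r back_index (counter 3)) \<tau>1 weight_sc 0 = weight \<tau>1 (\<tau>1 0 3) r ?i"
    by (rule sem_calc(3)) (use env(3) si in auto)
  also have "\<dots> = weight \<sigma> (\<tau> 0 3) r ?i"
    unfolding same_on_inputs(1)[OF env1] by (simp add: \<tau>1_def)
  finally have w: "sem (calc r back_index (counter 3)) \<tau>1 weight_sc 0 = weight \<sigma> (\<tau> 0 3) r ?i" .
  assume "\<tau> code_sc 0 = code (\<tau> 0 3) r"
  then have eq: "sem (trace_choice r) \<tau>
      = sem (assign rest_sc (Sub (scalar rest_sc) (scalar weight_sc))) (sem (calc r back_index (counter 3)) \<tau>1)"
    by (auto simp: trace_choice_def code_def \<tau>1_def n)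
  show "sem (trace_choice r) \<tau> Box_ar = (\<tau> Box_ar)(?i := \<tau> 0 3) \<and>
      sem (trace_choice r) \<tau> Rot_ar = (\<tau> Rot_ar)(?i := (if r then 1 else 0)) \<and>
      sem (trace_choice r) \<tau> rest_sc 0 = \<tau> rest_sc 0 - weight \<sigma> (\<tau> 0 3) r ?i"
    unfolding eq using w by (auto simp: \<tau>1_def fun_eq_iff)
qed

text \<open>The assignment found need not be the one from which the target was computed. What it
  shares with it is the total weight, and that every choice is \<open>allowed\<close>.\<close>

lemma sem_trace:
  assumes env: "small_items \<sigma>" "\<sigma> n_sc 0 \<le> \<sigma> 2 0" "K \<le> \<sigma> 2 0"
    and rows: "\<forall>i \<le> \<sigma> n_sc 0. row_ok \<sigma> K (rotations rot) i (\<sigma> Tab_ar)"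
    and base: "\<sigma> base_sc 0 = \<sigma> n_sc 0 * \<sigma> 2 0"
    and target: "\<sigma> target_sc 0 < \<sigma> 2 0" "reach \<sigma> K (rotations rot) (\<sigma> n_sc 0) (\<sigma> target_sc 0)"
    and \<tau>: "\<tau> = sem (trace K rot) \<sigma>"
  shows "\<forall>i < \<sigma> n_sc 0. \<tau> Box_ar i < K \<and> (\<tau> Rot_ar i \<noteq> 0) \<in> rotations rot \<and>
      allowed \<sigma> (\<tau> Box_ar i) (\<tau> Rot_ar i \<noteq> 0) i"
    and "(\<Sum>i < \<sigma> n_sc 0. weight \<sigma> (\<tau> Box_ar i) (\<tau> Rot_ar i \<noteq> 0) i) = \<sigma> target_sc 0"
proof -
  let ?V = "\<sigma> 2 0" and ?n = "\<sigma> n_sc 0" and ?R = "rotations rot" and ?G = "\<sigma> target_sc 0"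
  let ?choose = "trace_choice False ;; (if rot then trace_choice True else Nop)"
  let ?body = "assign code_sc (Arr Tab_ar (Add (scalar base_sc) (scalar rest_sc))) ;;
       For 3 (Num K) ?choose ;; assign base_sc (Sub (scalar base_sc) limit)"
  \<comment> \<open>After \<open>x\<close> rounds the last \<open>x\<close> rectangles are settled,
    and the rest of the target is reachable with the others.\<close>
  let ?done = "\<lambda>x \<tau>. (\<forall>i. ?n - x \<le> i \<and> i < ?n \<longrightarrow> \<tau> Box_ar i < K \<and> (\<tau> Rot_ar i \<noteq> 0) \<in> ?R \<and>
      allowed \<sigma> (\<tau> Box_ar i) (\<tau> Rot_ar i \<noteq> 0) i) \<and>
      ?G = \<tau> rest_sc 0 + (\<Sum>i \<in> {?n - x..<?n}. weight \<sigma> (\<tau> Box_ar i) (\<tau> Rot_ar i \<noteq> 0) i) \<and>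
      \<tau> rest_sc 0 < ?V \<and> reach \<sigma> K ?R (?n - x) (\<tau> rest_sc 0)"
  let ?I = "\<lambda>x \<tau>. same_on input_ids \<tau> \<sigma> \<and> \<tau> Tab_ar = \<sigma> Tab_ar \<and> \<tau> base_sc 0 = (?n - x) * ?V \<and> ?done x \<tau>"
  have "?I ?n (sem (For 6 (scalar n_sc) ?body) (sem (assign rest_sc (scalar target_sc)) \<sigma>))"
  proof (rule For_rule[where I = ?I], goal_cases)
    case 1
    then show ?case using base target by (auto simp: same_on_def)
  next
    case 2
    then show ?case using env(2) by simp
  next
    case (5 x \<tau>)
    then have x: "x < ?n" and \<tau>: "same_on input_ids \<tau> \<sigma>" "\<tau> Tab_ar = \<sigma> Tab_ar"
      "\<tau> base_sc 0 = (?n - x) * ?V" "?done x \<tau>" "\<tau> 0 6 = x" by auto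
    let ?i = "?n - Suc x"
    have Si: "?n - x = Suc ?i" using x by simp
    let ?g = "\<tau> rest_sc 0"
    have g: "?g < ?V" "reach \<sigma> K ?R (Suc ?i) ?g" using \<tau>(4) Si by auto
    have row: "row_ok \<sigma> K ?R (Suc ?i) (\<sigma> Tab_ar)" using rows Si by (metis diff_le_self)
    then have nz: "\<sigma> Tab_ar (Suc ?i * ?V + ?g) \<noteq> 0" using g unfolding row_ok_def by blast
    then obtain k0 r0 where kr: "k0 < K" "r0 \<in> ?R" "\<sigma> Tab_ar (Suc ?i * ?V + ?g) = code k0 r0"
        "allowed \<sigma> k0 r0 ?i" "weight \<sigma> k0 r0 ?i \<le> ?g" "reach \<sigma> K ?R ?i (?g - weight \<sigma> k0 r0 ?i)"
      using row g(1) unfolding row_ok_def by blast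
    define \<tau>1 where "\<tau>1 = sem (assign code_sc (Arr Tab_ar (Add (scalar base_sc) (scalar rest_sc)))) \<tau>"
    have code1: "\<tau>1 code_sc 0 = code k0 r0"
      using kr(3) \<tau>(2,3) Si by (simp add: \<tau>1_def)
    have env1: "same_on input_ids \<tau>1 \<sigma>" "\<tau>1 0 6 = x" using \<tau> by (auto simp: \<tau>1_def)
    define \<tau>2 where "\<tau>2 = sem (For 3 (Num K) ?choose) \<tau>1"
    let ?pre = "\<lambda>\<tau>'. \<tau>' Box_ar = \<tau> Box_ar \<and> \<tau>' Rot_ar = \<tau> Rot_ar \<and> \<tau>' rest_sc 0 = ?g"
    let ?post = "\<lambda>\<tau>'. \<tau>' Box_ar = (\<tau> Box_ar)(?i := k0) \<and> \<tau>' Rot_ar = (\<tau> Rot_ar)(?i := (if r0 then 1 else 0)) \<and>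
      \<tau>' rest_sc 0 = ?g - weight \<sigma> k0 r0 ?i"
    \<comment> \<open>Nothing has happened before the loop over the boxes has passed
      \<open>k0\<close>; from then on the choice is recorded.\<close>
    let ?J = "\<lambda>k \<tau>'. same_on input_ids \<tau>' \<sigma> \<and> \<tau>' 0 6 = x \<and> \<tau>' code_sc 0 = code k0 r0 \<and>
      (if k0 < k then ?post \<tau>' else ?pre \<tau>')"
    have step: "same_on input_ids (sem (trace_choice r) \<tau>') \<sigma> \<and> sem (trace_choice r) \<tau>' 0 6 = x \<and>
       sem (trace_choice r) \<tau>' 0 3 = k \<and>
       sem (trace_choice r) \<tau>' code_sc 0 = code k0 r0 \<and>
       (if k0 = k \<and> r0 = r then ?post (sem (trace_choice r) \<tau>') else sem (trace_choice r) \<tau>' = \<tau>')"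
      if t: "same_on input_ids \<tau>' \<sigma>" "\<tau>' 0 6 = x" "\<tau>' 0 3 = k" "\<tau>' code_sc 0 = code k0 r0"
        "k0 = k \<and> r0 = r \<Longrightarrow> ?pre \<tau>'" for \<tau>' k r
    proof (cases "k0 = k \<and> r0 = r")
      case True
      have pre: "?pre \<tau>'" by (rule t(5)[OF True])
      have "\<tau>' 0 6 < ?n" "\<tau>' code_sc 0 = code (\<tau>' 0 3) r" using t(2,3,4) x True by simp_all
      from sem_trace_choice(2)[OF t(1) env(1) this] pre True t(2,3)
      have "?post (sem (trace_choice r) \<tau>')" by simp
      moreover have "same_on input_ids (sem (trace_choice r) \<tau>') \<sigma>"
        by (rule same_on_sem[OF t(1)]) auto
      ultimately show ?thesis using True t by simp
    next
      case False
      then have "\<tau>' 0 6 < ?n" "\<tau>' code_sc 0 \<noteq> code (\<tau>' 0 3) r" using t(2,3,4) x by (simp_all add: code_inj)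
      from sem_trace_choice(1)[OF t(1) env(1) this] have "sem (trace_choice r) \<tau>' = \<tau>'" .
      with False t(1,2,3,4) show ?thesis by auto
    qed
    have "?J K \<tau>2"
      unfolding \<tau>2_def
    proof (rule For_rule[where I = ?J], goal_cases)
      case 1
      then show ?case using env1 code1 by (auto simp: \<tau>1_def)
    next
      case 2
      then show ?case using env(3) env1 by (simp add: same_on_def)
    next
      case (5 k \<tau>')
      define \<tau>3 where "\<tau>3 = sem (trace_choice False) \<tau>'"
      have 3: "same_on input_ids \<tau>3 \<sigma>" "\<tau>3 0 6 = x" "\<tau>3 0 3 = k" "\<tau>3 code_sc 0 = code k0 r0"
         "if k0 = k \<and> \<not> r0 then ?post \<tau>3 else \<tau>3 = \<tau>'"
        using step[of \<tau>' k False] 5 unfolding \<tau>3_def by auto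
      show ?case
      proof (cases rot)
        case False
        then have "\<not> r0" using kr(2) by (simp add: rotations_def)
        with 3 5 False show ?thesis by (auto simp: \<tau>3_def split: if_splits)
      next
        case True
        define \<tau>4 where "\<tau>4 = sem (trace_choice True) \<tau>3"
        have 4: "same_on input_ids \<tau>4 \<sigma>" "\<tau>4 0 6 = x" "\<tau>4 0 3 = k" "\<tau>4 code_sc 0 = code k0 r0"
         "if k0 = k \<and> r0 then ?post \<tau>4 else \<tau>4 = \<tau>3"
          using step[of \<tau>3 k True] 3 5 unfolding \<tau>4_def by (auto split: if_splits)
        have "sem ?choose \<tau>' = \<tau>4" using True by (simp add: \<tau>3_def \<tau>4_def)
        moreover have "if k0 < Suc k then ?post \<tau>4 else ?pre \<tau>4"
          using 3 4 5 by (cases r0) (auto split: if_splits)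
        ultimately show ?thesis using 4 by metis
      qed
    qed auto
    then have 2: "same_on input_ids \<tau>2 \<sigma>" "\<tau>2 Box_ar = (\<tau> Box_ar)(?i := k0)"
       "\<tau>2 Rot_ar = (\<tau> Rot_ar)(?i := (if r0 then 1 else 0))" "\<tau>2 rest_sc 0 = ?g - weight \<sigma> k0 r0 ?i"
      using kr(1) by auto
    have o2: "\<tau>2 base_sc 0 = (?n - x) * ?V" "\<tau>2 Tab_ar = \<sigma> Tab_ar" "\<tau>2 2 = \<sigma> 2"
      using \<tau> 2(1) by (simp_all add: \<tau>2_def \<tau>1_def same_on_def)
    have range: "{?n - Suc x..<?n} = insert ?i {?n - x..<?n}" "?i \<notin> {?n - x..<?n}"
      using x by auto
    have sum: "(\<Sum>i \<in> {?n - x..<?n}. weight \<sigma> (((\<tau> Box_ar)(?i := k0)) i)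
        (((\<tau> Rot_ar)(?i := (if r0 then 1 else 0))) i \<noteq> 0) i) =
        (\<Sum>i \<in> {?n - x..<?n}. weight \<sigma> (\<tau> Box_ar i) (\<tau> Rot_ar i \<noteq> 0) i)"
      using x by (intro sum.cong) auto
    have don: "?done (Suc x) \<tau>2"
    proof (intro conjI allI impI)
      fix i assume i: "?n - Suc x \<le> i \<and> i < ?n"
      have "i = ?i \<or> ?n - x \<le> i" using i by linarith
      then show "\<tau>2 Box_ar i < K" "(\<tau>2 Rot_ar i \<noteq> 0) \<in> ?R"
          "allowed \<sigma> (\<tau>2 Box_ar i) (\<tau>2 Rot_ar i \<noteq> 0) i"
        using kr \<tau>(4) i x unfolding 2 by (auto split: if_splits)
    next
      show "?G = \<tau>2 rest_sc 0 + (\<Sum>i \<in> {?n - Suc x..<?n}. weight \<sigma> (\<tau>2 Box_ar i) (\<tau>2 Rot_ar i \<noteq> 0) i)"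
        unfolding range(1) 2 using \<tau>(4) kr(5) range(2) by (subst sum.insert) (simp_all only: sum, auto)
    qed (use 2 g kr in auto)
    have "sem ?body \<tau> = upd \<tau>2 base_sc 0 (\<tau>2 base_sc 0 - \<tau>2 2 0)"
      by (simp add: \<tau>1_def \<tau>2_def)
    then show ?case using don by (simp add: 2(1) o2 Si)
  qed auto
  then have fin: "?done ?n \<tau>" unfolding \<tau> trace_def by simp
  then show "\<forall>i < ?n. \<tau> Box_ar i < K \<and> (\<tau> Rot_ar i \<noteq> 0) \<in> ?R \<and>
      allowed \<sigma> (\<tau> Box_ar i) (\<tau> Rot_ar i \<noteq> 0) i" by auto
  show "(\<Sum>i < ?n. weight \<sigma> (\<tau> Box_ar i) (\<tau> Rot_ar i \<noteq> 0) i) = ?G"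
    using fin by (simp add: lessThan_atLeast0)
qed

text \<open>Without rotations the flags are cleared rather than trusted: for a wrong guess the trace
  may leave arbitrary values in \<open>Rot_ar\<close>, and the result has to be sound for every
  guess.\<close>

definition orient :: "bool \<Rightarrow> cm" where
  "orient rot = For 6 (scalar n_sc)
    ((if rot then Nop else Put Rot_ar (counter 6) (Num 0)) ;;
     Test (Arr Rot_ar (counter 6))
      (Put Pw_ar (counter 6) (Arr H_ar (counter 6)) ;; Put Ph_ar (counter 6) (Arr W_ar (counter 6)))
      (Put Pw_ar (counter 6) (Arr W_ar (counter 6)) ;; Put Ph_ar (counter 6) (Arr H_ar (counter 6))))"

lemma mods_orient: "mods (orient rot) \<subseteq> {8, 9, 10}"
  and slots_orient [simp]: "slots (orient rot) = {6}"
  and wf_orient [simp]: "wf_cm (orient rot)"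
  by (auto simp: orient_def)

lemma sem_orient_other [simp]: "j \<notin> {8, 9, 10} \<Longrightarrow> 1 < j \<Longrightarrow> sem (orient rot) \<sigma> j = \<sigma> j"
  using mods_orient by (intro sem_unmodified) auto

lemma sem_orient:
  assumes "\<sigma> n_sc 0 \<le> \<sigma> 2 0" and \<tau>: "\<tau> = sem (orient rot) \<sigma>" and i: "i < \<sigma> n_sc 0"
  shows "\<tau> Rot_ar i = (if rot then \<sigma> Rot_ar i else 0)"
    and "\<tau> Pw_ar i = item_w \<sigma> (\<tau> Rot_ar i \<noteq> 0) i" and "\<tau> Ph_ar i = item_h \<sigma> (\<tau> Rot_ar i \<noteq> 0) i"
proof -
  let ?n = "\<sigma> n_sc 0"
  let ?I = "\<lambda>m \<tau>. \<tau> W_ar = \<sigma> W_ar \<and> \<tau> H_ar = \<sigma> H_ar \<and>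
     (\<forall>i. \<tau> Rot_ar i = (if rot \<or> i \<ge> m then \<sigma> Rot_ar i else 0)) \<and>
     (\<forall>i<m. \<tau> Pw_ar i = item_w \<sigma> (\<tau> Rot_ar i \<noteq> 0) i \<and> \<tau> Ph_ar i = item_h \<sigma> (\<tau> Rot_ar i \<noteq> 0) i)"
  have "?I ?n \<tau>" unfolding \<tau> orient_def
    by (rule For_rule[where I = ?I])
      (use assms(1) in \<open>auto simp: item_w_def item_h_def less_Suc_eq\<close>)
  then show "\<tau> Rot_ar i = (if rot then \<sigma> Rot_ar i else 0)"
    and "\<tau> Pw_ar i = item_w \<sigma> (\<tau> Rot_ar i \<noteq> 0) i" and "\<tau> Ph_ar i = item_h \<sigma> (\<tau> Rot_ar i \<noteq> 0) i"
    using i by auto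
qed

section \<open>Placing the rectangles inside the boxes\<close>

record layout =
  sky :: "nat \<Rightarrow> nat"
  level :: nat
  side :: nat
  posx :: "nat \<Rightarrow> nat"
  posy :: "nat \<Rightarrow> nat"

text \<open>The first \<open>side\<close> rectangles stand side by side on the bottom of the box; the others are put in
  rows, which are stacked from the top of the box downwards. \<open>sky\<close> gives for every level the length that
  is used up from the left.\<close>

definition place :: "nat \<Rightarrow> nat \<Rightarrow> nat \<Rightarrow> (nat \<Rightarrow> nat) \<Rightarrow> (nat \<Rightarrow> nat) \<Rightarrow> nat \<Rightarrow> layout \<Rightarrow> layout" where
  "place X Y W pw ph i s =
     (let ro = (if side s = 0 \<and> W < sky s (level s) + pw i then level s - ph i else level s);
          y = (if side s = 0 then ro else 0)
      in \<lparr>sky = (\<lambda>l. if y \<le> l \<and> l < y + ph i then sky s y + pw i else sky s l), level = ro,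
          side = side s - 1, posx = (posx s)(i := X + sky s y), posy = (posy s)(i := Y + y)\<rparr>)"

definition layout_of :: "store \<Rightarrow> layout" where
  "layout_of \<tau> = \<lparr>sky = \<tau> Sky_ar, level = \<tau> row_sc 0, side = \<tau> side_sc 0, posx = \<tau> Px_ar, posy = \<tau> Py_ar\<rparr>"

definition place_item :: cm where
  "place_item =
     Test (scalar side_sc)
      (assign y_sc (Num 0) ;; assign side_sc (Sub (scalar side_sc) (Num 1)))
      (Test (Sub (Add (Arr Sky_ar (scalar row_sc)) (Arr Pw_ar (counter 6))) (Arr BoxW_ar (counter 3)))
        (assign row_sc (Sub (scalar row_sc) (Arr Ph_ar (counter 6)))) Nop ;;
       assign y_sc (scalar row_sc)) ;;
     Put Px_ar (counter 6) (Add (Arr BoxX_ar (counter 3)) (Arr Sky_ar (scalar y_sc))) ;;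
     Put Py_ar (counter 6) (Add (Arr BoxY_ar (counter 3)) (scalar y_sc)) ;;
     assign x_sc (Add (Arr Sky_ar (scalar y_sc)) (Arr Pw_ar (counter 6))) ;;
     For 5 (Arr Ph_ar (counter 6)) (Put Sky_ar (Add (scalar y_sc) (counter 5)) (scalar x_sc))"

lemma mods_place_item [simp]: "mods place_item = {11, 12, 14, 38, 39, 40, 41}"
  and slots_place_item [simp]: "slots place_item = {5}"
  and wf_place_item [simp]: "wf_cm place_item"
  by (auto simp: place_item_def)

lemma sem_place_item:
  assumes "\<tau> Ph_ar (\<tau> 0 6) \<le> \<tau> 2 0"
  shows "layout_of (sem place_item \<tau>) = place (\<tau> BoxX_ar (\<tau> 0 3)) (\<tau> BoxY_ar (\<tau> 0 3)) (\<tau> BoxW_ar (\<tau> 0 3))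
    (\<tau> Pw_ar) (\<tau> Ph_ar) (\<tau> 0 6) (layout_of \<tau>)"
proof -
  let ?c1 = "Test (scalar side_sc)
      (assign y_sc (Num 0) ;; assign side_sc (Sub (scalar side_sc) (Num 1)))
      (Test (Sub (Add (Arr Sky_ar (scalar row_sc)) (Arr Pw_ar (counter 6))) (Arr BoxW_ar (counter 3)))
        (assign row_sc (Sub (scalar row_sc) (Arr Ph_ar (counter 6)))) Nop ;;
       assign y_sc (scalar row_sc))"
  let ?c2 = "Put Px_ar (counter 6) (Add (Arr BoxX_ar (counter 3)) (Arr Sky_ar (scalar y_sc))) ;;
     Put Py_ar (counter 6) (Add (Arr BoxY_ar (counter 3)) (scalar y_sc)) ;;
     assign x_sc (Add (Arr Sky_ar (scalar y_sc)) (Arr Pw_ar (counter 6)))"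
  let ?c3 = "For 5 (Arr Ph_ar (counter 6)) (Put Sky_ar (Add (scalar y_sc) (counter 5)) (scalar x_sc))"
  let ?i = "\<tau> 0 6" and ?k = "\<tau> 0 3"
  define ro where "ro = (if \<tau> side_sc 0 = 0 \<and> \<tau> BoxW_ar ?k < \<tau> Sky_ar (\<tau> row_sc 0) + \<tau> Pw_ar ?i
    then \<tau> row_sc 0 - \<tau> Ph_ar ?i else \<tau> row_sc 0)"
  define y where "y = (if \<tau> side_sc 0 = 0 then ro else 0)"
  define \<tau>1 where "\<tau>1 = sem ?c1 \<tau>"
  have 1: "\<tau>1 row_sc 0 = ro" "\<tau>1 y_sc 0 = y" "\<tau>1 side_sc 0 = \<tau> side_sc 0 - 1"
    by (auto simp: \<tau>1_def ro_def y_def)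
  have o1: "\<tau>1 j = \<tau> j" if "j \<notin> {38, 39, 41}" for j
    using that by (auto simp: \<tau>1_def)
  define \<tau>2 where "\<tau>2 = sem ?c2 \<tau>1"
  have 2: "\<tau>2 Px_ar = (\<tau> Px_ar)(?i := \<tau> BoxX_ar ?k + \<tau> Sky_ar y)" "\<tau>2 Py_ar = (\<tau> Py_ar)(?i := \<tau> BoxY_ar ?k + y)"
      "\<tau>2 x_sc 0 = \<tau> Sky_ar y + \<tau> Pw_ar ?i" "\<tau>2 row_sc 0 = ro" "\<tau>2 y_sc 0 = y" "\<tau>2 side_sc 0 = \<tau> side_sc 0 - 1"
      "\<tau>2 Sky_ar = \<tau> Sky_ar" "\<tau>2 Ph_ar = \<tau> Ph_ar" "\<tau>2 0 = \<tau> 0" "\<tau>2 2 = \<tau> 2"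
    by (auto simp: \<tau>2_def 1 o1 fun_eq_iff)
  define \<tau>3 where "\<tau>3 = sem ?c3 \<tau>2"
  let ?I = "\<lambda>m \<tau>'. \<tau>' y_sc 0 = y \<and> \<tau>' x_sc 0 = \<tau> Sky_ar y + \<tau> Pw_ar ?i \<and>
    \<tau>' Sky_ar = (\<lambda>l. if y \<le> l \<and> l < y + m then \<tau> Sky_ar y + \<tau> Pw_ar ?i else \<tau> Sky_ar l)"
  have "?I (\<tau> Ph_ar ?i) \<tau>3"
    unfolding \<tau>3_def
    by (rule For_rule[where I = ?I]) (use assms 2 in \<open>auto simp: fun_eq_iff\<close>)
  moreover have "\<tau>3 Px_ar = \<tau>2 Px_ar" "\<tau>3 Py_ar = \<tau>2 Py_ar" "\<tau>3 row_sc = \<tau>2 row_sc" "\<tau>3 side_sc = \<tau>2 side_sc"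
    by (simp_all add: \<tau>3_def)
  moreover have "sem place_item \<tau> = \<tau>3" by (simp add: place_item_def \<tau>1_def \<tau>2_def \<tau>3_def)
  moreover have "place (\<tau> BoxX_ar ?k) (\<tau> BoxY_ar ?k) (\<tau> BoxW_ar ?k) (\<tau> Pw_ar) (\<tau> Ph_ar) ?i (layout_of \<tau>) =
    \<lparr>sky = (\<lambda>l. if y \<le> l \<and> l < y + \<tau> Ph_ar ?i then \<tau> Sky_ar y + \<tau> Pw_ar ?i else \<tau> Sky_ar l), level = ro,
     side = \<tau> side_sc 0 - 1, posx = (\<tau> Px_ar)(?i := \<tau> BoxX_ar ?k + \<tau> Sky_ar y),
     posy = (\<tau> Py_ar)(?i := \<tau> BoxY_ar ?k + y)\<rparr>"
    by (simp only: place_def layout_of_def Let_def layout.select_convs ro_def y_def)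
  ultimately show ?thesis using 2 by (simp add: layout_of_def)
qed

text \<open>Bucket sort: pass \<open>v\<close> collects the rectangles of height
  \<open>V - v\<close>, so the heights decrease along the list.\<close>

definition fill_order :: "nat \<Rightarrow> nat \<Rightarrow> (nat \<Rightarrow> bool) \<Rightarrow> (nat \<Rightarrow> nat) \<Rightarrow> nat \<Rightarrow> nat list" where
  "fill_order n V P h m = concat (map (\<lambda>v. filter (\<lambda>i. P i \<and> h i = V - v) [0..<n]) [0..<m])"

lemma fill_order_Suc:
  "fill_order n V P h (Suc m) = fill_order n V P h m @ filter (\<lambda>i. P i \<and> h i = V - m) [0..<n]"
  by (simp add: fill_order_def)

lemma set_fill_order:
  assumes "\<And>i. i < n \<Longrightarrow> P i \<Longrightarrow> 0 < h i \<and> h i \<le> V"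
  shows "set (fill_order n V P h V) = {i. i < n \<and> P i}"
proof -
  have "\<exists>v<V. h i = V - v" if "i < n" "P i" for i
    using assms[OF that] by (intro exI[of _ "V - h i"]) auto
  then show ?thesis by (force simp: fill_order_def)
qed

lemma fill_order_sorted:
  "m \<le> V \<Longrightarrow> distinct (fill_order n V P h m) \<and> sorted_wrt (\<lambda>i j. h j \<le> h i) (fill_order n V P h m) \<and>
    (\<forall>i \<in> set (fill_order n V P h m). V < h i + m)"
proof (induction m)
  case 0
  then show ?case by (simp add: fill_order_def)
next
  case (Suc m)
  let ?xs = "fill_order n V P h m" and ?ys = "filter (\<lambda>i. P i \<and> h i = V - m) [0..<n]"
  have ys: "h j + m = V" if "j \<in> set ?ys" for j using that Suc.prems by auto
  have xs: "distinct ?xs" "sorted_wrt (\<lambda>i j. h j \<le> h i) ?xs" "\<And>i. i \<in> set ?xs \<Longrightarrow> V < h i + m"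
    using Suc.IH[OF Suc_leD[OF Suc.prems]] by blast+
  have "sorted_wrt (\<lambda>i j. h j \<le> h i) ?ys"
  proof (rule sorted_wrt_mono_rel)
    show "sorted_wrt (<) ?ys" by (simp add: sorted_wrt_filter)
    show "h j \<le> h i" if "i \<in> set ?ys" "j \<in> set ?ys" for i j using that by simp
  qed
  moreover have "h j \<le> h i" if "i \<in> set ?xs" "j \<in> set ?ys" for i j
    using xs(3)[OF that(1)] ys[OF that(2)] by linarith
  ultimately have 1: "sorted_wrt (\<lambda>i j. h j \<le> h i) (?xs @ ?ys)"
    unfolding sorted_wrt_append using xs(2) by blast
  have "set ?xs \<inter> set ?ys = {}"
  proof (intro equals0I)
    fix i assume "i \<in> set ?xs \<inter> set ?ys"
    then have "i \<in> set ?xs" "i \<in> set ?ys" by blast+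
    then show False using xs(3)[of i] ys[of i] by linarith
  qed
  then have 2: "distinct (?xs @ ?ys)" unfolding distinct_append
    using xs(1) distinct_filter[OF distinct_upt] by (intro conjI)
  have "V < h i + Suc m" if "i \<in> set (?xs @ ?ys)" for i
  proof -
    have "i \<in> set ?xs \<or> i \<in> set ?ys" using that by (simp only: set_append Un_iff)
    then show ?thesis using xs(3)[of i] ys[of i] by linarith
  qed
  then show ?case unfolding fill_order_Suc using 1 2 by (intro conjI ballI)
qed

text \<open>At the top level the skyline is set to the full width of the box, as if a full row ended
  there. The first rectangle after the staircase then opens a row by the same rule as any later
  one.\<close>

definition fill_box :: cm where
  "fill_box =
     For 2 limit (Put Sky_ar (counter 2) (Num 0)) ;;
     assign row_sc (Arr BoxH_ar (counter 3)) ;;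
     Put Sky_ar (scalar row_sc) (Arr BoxW_ar (counter 3)) ;;
     assign side_sc (Arr Side_ar (counter 3)) ;;
     For 4 limit
      (For 6 (scalar n_sc)
        (Test (neq (Arr Box_ar (counter 6)) (counter 3)) Nop
        (Test (neq (Arr Ph_ar (counter 6)) (Sub limit (counter 4))) Nop
         place_item)))"

lemma mods_fill_box [simp]: "mods fill_box = {11, 12, 14, 38, 39, 40, 41}"
  and slots_fill_box [simp]: "slots fill_box = {2, 4, 5, 6}"
  and wf_fill_box [simp]: "wf_cm fill_box"
  by (auto simp: fill_box_def)

abbreviation layout_ids :: "nat set" where
  "layout_ids \<equiv> {2, 7, 9, 10, 15, 16, 17, 18, 22, 26}"

text \<open>The start layout \<open>s\<close> is described up to the top level of the box, since
  this is all that the locale \<open>filling\<close> assumes about it.\<close>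

lemma sem_fill_box:
  assumes n: "\<sigma> n_sc 0 \<le> \<sigma> 2 0" and h: "\<sigma> BoxH_ar k < \<sigma> 2 0" and k: "\<sigma> 0 3 = k"
    and ph: "\<And>i. i < \<sigma> n_sc 0 \<Longrightarrow> \<sigma> Ph_ar i \<le> \<sigma> 2 0"
  shows "\<exists>s. level s = \<sigma> BoxH_ar k \<and> side s = \<sigma> Side_ar k \<and> (\<forall>l < \<sigma> BoxH_ar k. sky s l = 0) \<and>
    sky s (\<sigma> BoxH_ar k) = \<sigma> BoxW_ar k \<and> posx s = \<sigma> Px_ar \<and> posy s = \<sigma> Py_ar \<and>
    layout_of (sem fill_box \<sigma>) =
      fold (place (\<sigma> BoxX_ar k) (\<sigma> BoxY_ar k) (\<sigma> BoxW_ar k) (\<sigma> Pw_ar) (\<sigma> Ph_ar))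
       (fill_order (\<sigma> n_sc 0) (\<sigma> 2 0) (\<lambda>i. \<sigma> Box_ar i = k) (\<sigma> Ph_ar) (\<sigma> 2 0)) s"
proof -
  let ?n = "\<sigma> n_sc 0" and ?V = "\<sigma> 2 0"
  let ?place = "place (\<sigma> BoxX_ar k) (\<sigma> BoxY_ar k) (\<sigma> BoxW_ar k) (\<sigma> Pw_ar) (\<sigma> Ph_ar)"
  let ?order = "fill_order ?n ?V (\<lambda>i. \<sigma> Box_ar i = k) (\<sigma> Ph_ar)"
  let ?c1 = "For 2 limit (Put Sky_ar (counter 2) (Num 0))"
  let ?c2 = "assign row_sc (Arr BoxH_ar (counter 3)) ;;
     Put Sky_ar (scalar row_sc) (Arr BoxW_ar (counter 3)) ;;
     assign side_sc (Arr Side_ar (counter 3))"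
  let ?b = "Test (neq (Arr Box_ar (counter 6)) (counter 3)) Nop
        (Test (neq (Arr Ph_ar (counter 6)) (Sub limit (counter 4))) Nop
         place_item)"
  let ?c3 = "For 4 limit (For 6 (scalar n_sc) ?b)"
  define \<tau>1 where "\<tau>1 = sem ?c1 \<sigma>"
  let ?I = "\<lambda>m \<tau>. \<forall>l<m. \<tau> Sky_ar l = 0"
  have "?I ?V \<tau>1" unfolding \<tau>1_def
    by (rule For_rule[where I = ?I]) (auto simp: less_Suc_eq)
  note sky1 = this
  have o1: "\<tau>1 j = \<sigma> j" if "j \<noteq> 14" "1 < j" for j using that by (simp add: \<tau>1_def)
  have c1: "\<tau>1 0 3 = k" by (simp add: \<tau>1_def k)
  define \<tau>2 where "\<tau>2 = sem ?c2 \<tau>1"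
  have 2: "level (layout_of \<tau>2) = \<sigma> BoxH_ar k" "side (layout_of \<tau>2) = \<sigma> Side_ar k"
     "\<forall>l < \<sigma> BoxH_ar k. sky (layout_of \<tau>2) l = 0" "sky (layout_of \<tau>2) (\<sigma> BoxH_ar k) = \<sigma> BoxW_ar k"
     "posx (layout_of \<tau>2) = \<sigma> Px_ar" "posy (layout_of \<tau>2) = \<sigma> Py_ar"
    using sky1 h by (auto simp: \<tau>2_def layout_of_def c1 o1)
  have env2: "same_on layout_ids \<tau>2 \<sigma>" "\<tau>2 0 3 = k" by (auto simp: \<tau>2_def same_on_def o1 c1)
  define s where "s = layout_of \<tau>2"
  have upd: "layout_of (upd \<tau> j s' v) = layout_of \<tau>" if "j < 2" for \<tau> j s' v
    using that by (simp add: layout_of_def)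
  let ?J = "\<lambda>v \<tau>. same_on layout_ids \<tau> \<sigma> \<and> \<tau> 0 3 = k \<and> layout_of \<tau> = fold ?place (?order v) s"
  have "?J ?V (sem ?c3 \<tau>2)"
  proof (rule For_rule[where I = ?J], goal_cases)
    case 1
    then show ?case using env2 by (simp add: s_def fill_order_def)
  next
    case 2
    then show ?case using env2 by (simp add: same_on_def)
  next
    case (5 v \<tau>)
    let ?L = "\<lambda>i \<tau>. same_on layout_ids \<tau> \<sigma> \<and> \<tau> 0 3 = k \<and> \<tau> 0 4 = v \<and>
      layout_of \<tau> = fold ?place (?order v @ filter (\<lambda>i. \<sigma> Box_ar i = k \<and> \<sigma> Ph_ar i = ?V - v) [0..<i]) s"
    have "?L ?n (sem (For 6 (scalar n_sc) ?b) \<tau>)"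
    proof (rule For_rule[where I = ?L], goal_cases)
      case 1
      then show ?case using 5 by simp
    next
      case 2
      then show ?case using 5 n by (simp add: same_on_def)
    next
      case (5 i \<tau>)
      then have eqs: "\<tau> Box_ar = \<sigma> Box_ar" "\<tau> Ph_ar = \<sigma> Ph_ar" "\<tau> 2 = \<sigma> 2" "\<tau> 0 6 = i" "\<tau> 0 3 = k" "\<tau> 0 4 = v"
         "\<tau> BoxX_ar = \<sigma> BoxX_ar" "\<tau> BoxY_ar = \<sigma> BoxY_ar" "\<tau> BoxW_ar = \<sigma> BoxW_ar" "\<tau> Pw_ar = \<sigma> Pw_ar"
        by (auto simp: same_on_def)
      have i: "i < ?n" using 5 by simp
      show ?case
      proof (cases "\<sigma> Box_ar i = k \<and> \<sigma> Ph_ar i = ?V - v")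
        case False
        then have "sem ?b \<tau> = \<tau>" by (auto simp: eqs)
        then show ?thesis using False 5 by (simp only:) auto
      next
        case True
        then have "sem ?b \<tau> = sem place_item \<tau>" by (auto simp: eqs)
        moreover have "layout_of (sem place_item \<tau>) = ?place i (layout_of \<tau>)"
          using sem_place_item[of \<tau>] ph[OF i] by (simp add: eqs)
        moreover have "same_on layout_ids (sem place_item \<tau>) \<sigma>"
          using 5 by (intro same_on_sem) auto
        ultimately show ?thesis using True 5 by simp
      qed
    qed (auto simp: upd)
    then show ?case by (simp add: fill_order_Suc)
  qed (auto simp: upd)
  moreover have "sem fill_box \<sigma> = sem ?c3 \<tau>2" by (simp add: fill_box_def \<tau>1_def \<tau>2_def)
  ultimately show ?thesis using 2 unfolding s_def by (intro exI[of _ "layout_of \<tau>2"]) simp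
qed

lemma place_other:
  "i \<noteq> x \<Longrightarrow> posx (place X Y W pw ph x s) i = posx s i \<and> posy (place X Y W pw ph x s) i = posy s i"
  by (simp add: place_def Let_def)

text \<open>Different boxes get different rectangles, so filling one box keeps the positions in the
  others.\<close>

lemma fold_place_other:
  "i \<notin> set xs \<Longrightarrow> posx (fold (place X Y W pw ph) xs s) i = posx s i \<and>
    posy (fold (place X Y W pw ph) xs s) i = posy s i"
  by (induction xs arbitrary: s) (simp_all add: place_other)

definition fill_boxes :: "nat \<Rightarrow> cm" where "fill_boxes K = For 3 (Num K) fill_box"

lemma mods_fill_boxes [simp]: "mods (fill_boxes K) = {11, 12, 14, 38, 39, 40, 41}"
  and slots_fill_boxes [simp]: "slots (fill_boxes K) = {2, 3, 4, 5, 6}"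
  and wf_fill_boxes [simp]: "wf_cm (fill_boxes K)"
  by (auto simp: fill_boxes_def)

lemma sem_fill_boxes:
  assumes n: "\<sigma> n_sc 0 \<le> \<sigma> 2 0" "K \<le> \<sigma> 2 0" and h: "\<And>k. k < K \<Longrightarrow> \<sigma> BoxH_ar k < \<sigma> 2 0"
    and ph: "\<And>i. i < \<sigma> n_sc 0 \<Longrightarrow> 0 < \<sigma> Ph_ar i \<and> \<sigma> Ph_ar i \<le> \<sigma> 2 0" and "k < K"
  shows "\<exists>s. level s = \<sigma> BoxH_ar k \<and> side s = \<sigma> Side_ar k \<and> (\<forall>l < \<sigma> BoxH_ar k. sky s l = 0) \<and>
    sky s (\<sigma> BoxH_ar k) = \<sigma> BoxW_ar k \<and> (\<forall>i < \<sigma> n_sc 0. \<sigma> Box_ar i = k \<longrightarrow>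
    (let s' = fold (place (\<sigma> BoxX_ar k) (\<sigma> BoxY_ar k) (\<sigma> BoxW_ar k) (\<sigma> Pw_ar) (\<sigma> Ph_ar))
       (fill_order (\<sigma> n_sc 0) (\<sigma> 2 0) (\<lambda>i. \<sigma> Box_ar i = k) (\<sigma> Ph_ar) (\<sigma> 2 0)) s
     in sem (fill_boxes K) \<sigma> Px_ar i = posx s' i \<and> sem (fill_boxes K) \<sigma> Py_ar i = posy s' i))"
proof -
  let ?n = "\<sigma> n_sc 0" and ?V = "\<sigma> 2 0"
  let ?order = "\<lambda>k. fill_order ?n ?V (\<lambda>i. \<sigma> Box_ar i = k) (\<sigma> Ph_ar) ?V"
  let ?fold = "\<lambda>k s. fold (place (\<sigma> BoxX_ar k) (\<sigma> BoxY_ar k) (\<sigma> BoxW_ar k) (\<sigma> Pw_ar) (\<sigma> Ph_ar)) (?order k) s"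
  let ?P = "\<lambda>k \<tau>. \<exists>s. level s = \<sigma> BoxH_ar k \<and> side s = \<sigma> Side_ar k \<and> (\<forall>l < \<sigma> BoxH_ar k. sky s l = 0) \<and>
    sky s (\<sigma> BoxH_ar k) = \<sigma> BoxW_ar k \<and> (\<forall>i < ?n. \<sigma> Box_ar i = k \<longrightarrow>
      \<tau> Px_ar i = posx (?fold k s) i \<and> \<tau> Py_ar i = posy (?fold k s) i)"
  have order: "set (?order k) = {i. i < ?n \<and> \<sigma> Box_ar i = k}" for k
    using ph by (intro set_fill_order) auto
  let ?I = "\<lambda>m \<tau>. same_on layout_ids \<tau> \<sigma> \<and> (\<forall>k<m. ?P k \<tau>)"
  have "?I K (sem (fill_boxes K) \<sigma>)"
    unfolding fill_boxes_def
  proof (rule For_rule[where I = ?I], goal_cases)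
    case (5 m \<tau>)
    then have eqs: "\<tau> n_sc = \<sigma> n_sc" "\<tau> Box_ar = \<sigma> Box_ar" "\<tau> Ph_ar = \<sigma> Ph_ar" "\<tau> Pw_ar = \<sigma> Pw_ar" "\<tau> 2 = \<sigma> 2"
       "\<tau> BoxX_ar = \<sigma> BoxX_ar" "\<tau> BoxY_ar = \<sigma> BoxY_ar" "\<tau> BoxW_ar = \<sigma> BoxW_ar" "\<tau> BoxH_ar = \<sigma> BoxH_ar"
       "\<tau> Side_ar = \<sigma> Side_ar" by (auto simp: same_on_def)
    have "m < K" "\<tau> 0 3 = m" using 5 by simp_all
    from sem_fill_box[of \<tau> m, unfolded eqs, OF n(1) h[OF \<open>m < K\<close>] \<open>\<tau> 0 3 = m\<close> conjunct2[OF ph]]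
    obtain s where s: "level s = \<sigma> BoxH_ar m" "side s = \<sigma> Side_ar m" "\<forall>l < \<sigma> BoxH_ar m. sky s l = 0"
      "sky s (\<sigma> BoxH_ar m) = \<sigma> BoxW_ar m" "posx s = \<tau> Px_ar" "posy s = \<tau> Py_ar"
      "layout_of (sem fill_box \<tau>) = ?fold m s"
      by blast
    have px: "sem fill_box \<tau> Px_ar = posx (?fold m s)" "sem fill_box \<tau> Py_ar = posy (?fold m s)"
      unfolding s(7)[symmetric] layout_of_def layout.select_convs by (rule refl)+
    have old: "sem fill_box \<tau> Px_ar i = \<tau> Px_ar i" "sem fill_box \<tau> Py_ar i = \<tau> Py_ar i"
      if "\<sigma> Box_ar i \<noteq> m" for i
    proof -
      have "i \<notin> set (?order m)" unfolding order using that by blast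
      from fold_place_other[OF this] show "sem fill_box \<tau> Px_ar i = \<tau> Px_ar i"
          "sem fill_box \<tau> Py_ar i = \<tau> Py_ar i"
        unfolding px s(5,6)[symmetric] by (rule conjunct1, rule conjunct2)
    qed
    have "?P k (sem fill_box \<tau>)" if "k < Suc m" for k
    proof (cases "k = m")
      case True
      show ?thesis unfolding True px by (intro exI[of _ s] conjI allI impI s(1-4) refl)
    next
      case False
      then have "k < m" using that by simp
      then have "?P k \<tau>" using 5(2) by blast
      then obtain s' where s': "level s' = \<sigma> BoxH_ar k" "side s' = \<sigma> Side_ar k" "\<forall>l < \<sigma> BoxH_ar k. sky s' l = 0"
        "sky s' (\<sigma> BoxH_ar k) = \<sigma> BoxW_ar k"
        "\<And>i. i < ?n \<Longrightarrow> \<sigma> Box_ar i = k \<Longrightarrow> \<tau> Px_ar i = posx (?fold k s') i \<and> \<tau> Py_ar i = posy (?fold k s') i"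
        by blast
      have "sem fill_box \<tau> Px_ar i = posx (?fold k s') i \<and> sem fill_box \<tau> Py_ar i = posy (?fold k s') i"
        if "i < ?n" "\<sigma> Box_ar i = k" for i
        using s'(5)[OF that] old[of i] that(2) False by simp
      then show ?thesis by (intro exI[of _ s'] conjI allI impI s'(1-4)) blast+
    qed
    moreover have "same_on layout_ids (sem fill_box \<tau>) \<sigma>"
      by (rule same_on_sem[OF conjunct1[OF 5(2)]]) auto
    ultimately show ?case by blast
  qed (use n in \<open>auto simp: same_on_def\<close>)
  then show ?thesis using \<open>k < K\<close> unfolding Let_def by blast
qed

section \<open>Checking a layout\<close>

definition check :: cm where
  "check =
     assign ok_sc (Num 1) ;;
     For 6 (scalar n_sc)
      (Test (Sub (Add (Arr Px_ar (counter 6)) (Arr Pw_ar (counter 6))) (scalar width_sc)) (assign ok_sc (Num 0)) Nop ;;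
       Test (Sub (Add (Arr Py_ar (counter 6)) (Arr Ph_ar (counter 6))) (scalar height_sc)) (assign ok_sc (Num 0)) Nop ;;
       For 2 (scalar n_sc)
        (Test (neq (counter 6) (counter 2))
          (Test (Sub (Add (Arr Px_ar (counter 6)) (Arr Pw_ar (counter 6))) (Arr Px_ar (counter 2)))
            (Test (Sub (Add (Arr Px_ar (counter 2)) (Arr Pw_ar (counter 2))) (Arr Px_ar (counter 6)))
              (Test (Sub (Add (Arr Py_ar (counter 6)) (Arr Ph_ar (counter 6))) (Arr Py_ar (counter 2)))
                (Test (Sub (Add (Arr Py_ar (counter 2)) (Arr Ph_ar (counter 2))) (Arr Py_ar (counter 6)))
                  (assign ok_sc (Num 0)) Nop) Nop) Nop) Nop) Nop))"

lemma mods_check [simp]: "mods check = {42}"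
  and slots_check [simp]: "slots check = {2, 6}"
  and wf_check [simp]: "wf_cm check"
  by (auto simp: check_def)

definition int_packing :: "nat \<Rightarrow> nat \<Rightarrow> nat \<Rightarrow> (nat \<Rightarrow> nat) \<Rightarrow> (nat \<Rightarrow> nat) \<Rightarrow> (nat \<Rightarrow> nat) \<Rightarrow> (nat \<Rightarrow> nat) \<Rightarrow> bool" where
  "int_packing n A B x y w h \<longleftrightarrow>
    (\<forall>i<n. x i + w i \<le> A \<and> y i + h i \<le> B \<and> (\<forall>j<n. i \<noteq> j \<longrightarrow>
      x i + w i \<le> x j \<or> x j + w j \<le> x i \<or> y i + h i \<le> y j \<or> y j + h j \<le> y i))"

lemma sem_check:
  assumes n: "\<sigma> n_sc 0 \<le> \<sigma> 2 0"
  shows "sem check \<sigma> ok_sc 0 \<noteq> 0 \<longleftrightarrow>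
    int_packing (\<sigma> n_sc 0) (\<sigma> width_sc 0) (\<sigma> height_sc 0) (\<sigma> Px_ar) (\<sigma> Py_ar) (\<sigma> Pw_ar) (\<sigma> Ph_ar)"
proof -
  let ?n = "\<sigma> n_sc 0"
  let ?ids = "{2, 9, 10, 11, 12, 26, 27, 28}"
  let ?sep = "\<lambda>i j. i \<noteq> j \<longrightarrow> \<sigma> Px_ar i + \<sigma> Pw_ar i \<le> \<sigma> Px_ar j \<or> \<sigma> Px_ar j + \<sigma> Pw_ar j \<le> \<sigma> Px_ar i \<or>
      \<sigma> Py_ar i + \<sigma> Ph_ar i \<le> \<sigma> Py_ar j \<or> \<sigma> Py_ar j + \<sigma> Ph_ar j \<le> \<sigma> Py_ar i"
  let ?in = "\<lambda>i. \<sigma> Px_ar i + \<sigma> Pw_ar i \<le> \<sigma> width_sc 0 \<and> \<sigma> Py_ar i + \<sigma> Ph_ar i \<le> \<sigma> height_sc 0"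
  let ?b = "Test (neq (counter 6) (counter 2))
          (Test (Sub (Add (Arr Px_ar (counter 6)) (Arr Pw_ar (counter 6))) (Arr Px_ar (counter 2)))
            (Test (Sub (Add (Arr Px_ar (counter 2)) (Arr Pw_ar (counter 2))) (Arr Px_ar (counter 6)))
              (Test (Sub (Add (Arr Py_ar (counter 6)) (Arr Ph_ar (counter 6))) (Arr Py_ar (counter 2)))
                (Test (Sub (Add (Arr Py_ar (counter 2)) (Arr Ph_ar (counter 2))) (Arr Py_ar (counter 6)))
                  (assign ok_sc (Num 0)) Nop) Nop) Nop) Nop) Nop"
  define good where "good i \<longleftrightarrow> ?in i \<and> (\<forall>j<?n. ?sep i j)" for i
  let ?I = "\<lambda>m \<tau>. same_on ?ids \<tau> \<sigma> \<and> (\<tau> ok_sc 0 \<noteq> 0 \<longleftrightarrow> (\<forall>i<m. good i))"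
  have "?I ?n (sem check \<sigma>)"
    unfolding check_def sem.simps(3)
  proof (rule For_rule[where I = ?I], goal_cases)
    case (5 i \<tau>)
    define \<tau>1 where "\<tau>1 = sem (Test (Sub (Add (Arr Px_ar (counter 6)) (Arr Pw_ar (counter 6))) (scalar width_sc)) (assign ok_sc (Num 0)) Nop ;;
       Test (Sub (Add (Arr Py_ar (counter 6)) (Arr Ph_ar (counter 6))) (scalar height_sc)) (assign ok_sc (Num 0)) Nop) \<tau>"
    have 1: "same_on ?ids \<tau>1 \<sigma>" "\<tau>1 0 6 = i" "\<tau>1 ok_sc 0 \<noteq> 0 \<longleftrightarrow> \<tau> ok_sc 0 \<noteq> 0 \<and> ?in i"
      using 5 by (auto simp: \<tau>1_def same_on_def)
    let ?J = "\<lambda>m \<tau>'. same_on ?ids \<tau>' \<sigma> \<and> \<tau>' 0 6 = i \<and> (\<tau>' ok_sc 0 \<noteq> 0 \<longleftrightarrow> \<tau>1 ok_sc 0 \<noteq> 0 \<and> (\<forall>j<m. ?sep i j))"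
    have "?J ?n (sem (For 2 (scalar n_sc) ?b) \<tau>1)"
    proof (rule For_rule[where I = ?J], goal_cases)
      case 1
      then show ?case using \<open>same_on ?ids \<tau>1 \<sigma>\<close> \<open>\<tau>1 0 6 = i\<close> by simp
    next
      case 2
      then show ?case using 1 n by (simp add: same_on_def)
    next
      case (5 j \<tau>')
      then have eqs: "\<tau>' Px_ar = \<sigma> Px_ar" "\<tau>' Py_ar = \<sigma> Py_ar" "\<tau>' Pw_ar = \<sigma> Pw_ar" "\<tau>' Ph_ar = \<sigma> Ph_ar" "\<tau>' 0 6 = i" "\<tau>' 0 2 = j"
        by (auto simp: same_on_def)
      have "sem ?b \<tau>' = (if ?sep i j then \<tau>' else upd \<tau>' ok_sc 0 0)"
        by (auto simp: eqs)
      then show ?case using 5 by (auto simp: less_Suc_eq)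
    qed auto
    then have J: "same_on ?ids (sem (For 2 (scalar n_sc) ?b) \<tau>1) \<sigma>"
        "sem (For 2 (scalar n_sc) ?b) \<tau>1 ok_sc 0 \<noteq> 0 \<longleftrightarrow> \<tau>1 ok_sc 0 \<noteq> 0 \<and> (\<forall>j<?n. ?sep i j)"
      by blast+
    have old: "\<tau> ok_sc 0 \<noteq> 0 \<longleftrightarrow> (\<forall>i'<i. good i')" using 5(2) by (rule conjunct2)
    have "sem (For 2 (scalar n_sc) ?b) \<tau>1 ok_sc 0 \<noteq> 0 \<longleftrightarrow> (\<forall>i'<i. good i') \<and> good i"
      unfolding J(2) 1(3) old good_def[of i] by (rule conj_assoc)
    then have "sem (For 2 (scalar n_sc) ?b) \<tau>1 ok_sc 0 \<noteq> 0 \<longleftrightarrow> (\<forall>i'<Suc i. good i')"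
      by (simp only: All_less_Suc conj_commute)
    with J(1) show ?case unfolding \<tau>1_def sem.simps(3) by (rule conjI)
  qed (use n in \<open>auto simp: same_on_def\<close>)
  then have "sem check \<sigma> ok_sc 0 \<noteq> 0 \<longleftrightarrow> (\<forall>i<?n. good i)" by (rule conjunct2)
  then show ?thesis by (simp only: int_packing_def good_def conj_assoc)
qed

section \<open>Geometry of the layout in one box\<close>

locale filling =
  fixes X Y W H :: nat and w h :: "nat \<Rightarrow> nat" and xs :: "nat list" and q :: nat and s0 :: layout
  assumes distinct: "distinct xs"
    and sorted: "\<And>t u. t \<le> u \<Longrightarrow> u < length xs \<Longrightarrow> h (xs ! u) \<le> h (xs ! t)"
    and w_pos: "\<And>t. t < length xs \<Longrightarrow> 0 < w (xs ! t)"
    and h_pos: "\<And>t. t < length xs \<Longrightarrow> 0 < h (xs ! t)"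
    and h_le: "\<And>t. t < length xs \<Longrightarrow> h (xs ! t) \<le> H"
    and q_le: "q \<le> length xs"
    and init: "level s0 = H" "side s0 = q" "\<And>l. l < H \<Longrightarrow> sky s0 l = 0" "sky s0 H = W"
    and side_le: "(\<Sum>t<q. w (xs ! t)) \<le> W"
begin

definition wt :: "nat \<Rightarrow> nat" where "wt t = w (xs ! t)"
definition ht :: "nat \<Rightarrow> nat" where "ht t = h (xs ! t)"
definition st :: "nat \<Rightarrow> layout" where "st j = fold (place X Y W w h) (take j xs) s0"
text \<open>The skyline of the complete staircase: heights decrease from left to right, so level
  \<open>l\<close> is used from the left up to this length.\<close>

definition stairs :: "nat \<Rightarrow> nat" where "stairs l = (\<Sum>t<q. if l < ht t then wt t else 0)"

abbreviation px :: "nat \<Rightarrow> nat \<Rightarrow> nat" where "px j t \<equiv> posx (st j) (xs ! t)"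
abbreviation py :: "nat \<Rightarrow> nat \<Rightarrow> nat" where "py j t \<equiv> posy (st j) (xs ! t)"

text \<open>The bound by the skyline carries the induction: a rectangle that lies to the right of
  the skyline on all of its levels cannot overlap an older one.\<close>

definition valid :: "nat \<Rightarrow> bool" where
  "valid j \<longleftrightarrow> (\<forall>t<j. X \<le> px j t \<and> Y \<le> py j t \<and> px j t + wt t \<le> X + W \<and> py j t + ht t \<le> Y + H \<and>
     (\<forall>l. py j t \<le> Y + l \<and> Y + l < py j t + ht t \<longrightarrow> px j t + wt t \<le> X + sky (st j) l) \<and>
     (\<forall>u<j. t \<noteq> u \<longrightarrow> px j t + wt t \<le> px j u \<or> px j u + wt u \<le> px j t \<or>
        py j t + ht t \<le> py j u \<or> py j u + ht u \<le> py j t))"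

lemma st_0: "st 0 = s0"
  by (simp add: st_def)

lemma st_Suc: "j < length xs \<Longrightarrow> st (Suc j) = place X Y W w h (xs ! j) (st j)"
  by (simp add: st_def take_Suc_conv_app_nth)

lemma wt_pos: "t < length xs \<Longrightarrow> 0 < wt t" and ht_pos: "t < length xs \<Longrightarrow> 0 < ht t"
  and ht_le: "t < length xs \<Longrightarrow> ht t \<le> H"
  using w_pos h_pos h_le by (auto simp: wt_def ht_def)

lemma ht_antimono: "t \<le> u \<Longrightarrow> u < length xs \<Longrightarrow> ht u \<le> ht t"
  using sorted by (simp add: ht_def)

lemma stairs_antimono: "l \<le> l' \<Longrightarrow> stairs l' \<le> stairs l"
  unfolding stairs_def by (intro sum_mono) auto

lemma stairs_le: "stairs l \<le> (\<Sum>t<q. wt t)"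
  unfolding stairs_def by (intro sum_mono) auto

text \<open>The new rectangle starts at the skyline of its lowest level. If the skyline is nowhere
  longer on the levels that it covers, then it is clear of everything placed before.\<close>

lemma valid_step:
  assumes v: "valid j" and j: "j < length xs"
    and y: "sky (st (Suc j)) = (\<lambda>l. if y \<le> l \<and> l < y + ht j then sky (st j) y + wt j else sky (st j) l)"
      "posx (st (Suc j)) = (posx (st j))(xs ! j := X + sky (st j) y)"
      "posy (st (Suc j)) = (posy (st j))(xs ! j := Y + y)"
    and le: "\<And>l. y \<le> l \<Longrightarrow> l < y + ht j \<Longrightarrow> sky (st j) l \<le> sky (st j) y"
    and fits: "sky (st j) y + wt j \<le> W" "y + ht j \<le> H"
  shows "valid (Suc j)"
proof -
  have ne: "xs ! t \<noteq> xs ! j" if "t < j" for t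
    using distinct j that by (simp add: nth_eq_iff_index_eq)
  have old: "px (Suc j) t = px j t" "py (Suc j) t = py j t" if "t < j" for t
    using ne[OF that] by (simp_all add: y)
  have new: "px (Suc j) j = X + sky (st j) y" "py (Suc j) j = Y + y" by (simp_all add: y)
  have mono: "sky (st j) l \<le> sky (st (Suc j)) l" for l
    unfolding y using le[of l] by (simp add: trans_le_add1)
  have vt: "X \<le> px j t" "Y \<le> py j t" "px j t + wt t \<le> X + W" "py j t + ht t \<le> Y + H"
     "\<And>l. py j t \<le> Y + l \<Longrightarrow> Y + l < py j t + ht t \<Longrightarrow> px j t + wt t \<le> X + sky (st j) l"
     "\<And>u. u < j \<Longrightarrow> t \<noteq> u \<Longrightarrow> px j t + wt t \<le> px j u \<or> px j u + wt u \<le> px j t \<or>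
        py j t + ht t \<le> py j u \<or> py j u + ht u \<le> py j t" if "t < j" for t
    using v that unfolding valid_def by blast+
  have sep: "px j t + wt t \<le> X + sky (st j) y \<or> py j t + ht t \<le> Y + y \<or> Y + y + ht j \<le> py j t"
    if t: "t < j" for t
  proof (rule ccontr)
    assume neg: "\<not> ?thesis"
    \<comment> \<open>Two rectangles whose vertical extents overlap have an integral level in
      common, the larger of their bottoms. The skyline bound is applied there.\<close>
    define l where "l = max y (py j t - Y)"
    have "y \<le> l" "l < y + ht j" "py j t \<le> Y + l" "Y + l < py j t + ht t"
      using neg ht_pos[of t] ht_pos[OF j] t j vt(2)[OF t] unfolding l_def by linarith+
    then have "px j t + wt t \<le> X + sky (st j) y" using vt(5)[OF t, of l] le[of l] by linarith
    with neg show False by blast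
  qed
  show ?thesis
    unfolding valid_def
  proof (intro allI impI conjI)
    fix t assume t: "t < Suc j"
    show "X \<le> px (Suc j) t" "Y \<le> py (Suc j) t" "px (Suc j) t + wt t \<le> X + W" "py (Suc j) t + ht t \<le> Y + H"
    proof -
      consider "t = j" | "t < j" using t by linarith
      then have "X \<le> px (Suc j) t \<and> Y \<le> py (Suc j) t \<and> px (Suc j) t + wt t \<le> X + W \<and>
        py (Suc j) t + ht t \<le> Y + H"
      proof cases
        case 1
        then show ?thesis using new fits by simp
      next
        case 2
        then show ?thesis unfolding old[OF 2] using vt(1-4)[OF 2] by blast
      qed
      then show "X \<le> px (Suc j) t" "Y \<le> py (Suc j) t" "px (Suc j) t + wt t \<le> X + W" "py (Suc j) t + ht t \<le> Y + H"
        by blast+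
    qed
    show "px (Suc j) t + wt t \<le> X + sky (st (Suc j)) l"
      if l: "py (Suc j) t \<le> Y + l \<and> Y + l < py (Suc j) t + ht t" for l
    proof (cases "t = j")
      case True
      then show ?thesis using l new by (simp add: y)
    next
      case False
      then have t: "t < j" using t by simp
      have "px j t + wt t \<le> X + sky (st j) l" using vt(5)[OF t, of l] l old(2)[OF t] by simp
      also have "\<dots> \<le> X + sky (st (Suc j)) l" using mono by simp
      finally show ?thesis unfolding old(1)[OF t] .
    qed
    fix u assume u: "u < Suc j" "t \<noteq> u"
    consider "t < j" "u < j" | "t = j" "u < j" | "t < j" "u = j" using t u by linarith
    then show "px (Suc j) t + wt t \<le> px (Suc j) u \<or> px (Suc j) u + wt u \<le> px (Suc j) t \<or>
        py (Suc j) t + ht t \<le> py (Suc j) u \<or> py (Suc j) u + ht u \<le> py (Suc j) t"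
    proof cases
      case 1
      then show ?thesis unfolding old[OF 1(1)] old[OF 1(2)] using vt(6)[OF 1] u(2) by blast
    next
      case 2
      then show ?thesis unfolding 2(1) new old[OF 2(2)] using sep[OF 2(2)] by blast
    next
      case 3
      then show ?thesis unfolding 3(2) new old[OF 3(1)] using sep[OF 3(1)] by blast
    qed
  qed
qed

text \<open>By the decreasing heights, all earlier rectangles are present on the levels of the next
  one. The skyline is flat there, and the rectangles stand side by side.\<close>

lemma side_phase:
  "j \<le> q \<Longrightarrow> valid j \<and> side (st j) = q - j \<and> level (st j) = H \<and> sky (st j) H = W \<and>
    (\<forall>l<H. sky (st j) l = (\<Sum>t<j. if l < ht t then wt t else 0))"
proof (induction j)
  case 0
  then show ?case using init by (simp add: st_0 valid_def)
next
  case (Suc j)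
  have IH: "valid j" "side (st j) = q - j" "level (st j) = H" "sky (st j) H = W"
      "\<And>l. l < H \<Longrightarrow> sky (st j) l = (\<Sum>t<j. if l < ht t then wt t else 0)" and "j < q"
    using Suc.IH[OF Suc_leD[OF Suc.prems]] Suc.prems by (blast, blast, blast, blast, blast, linarith)
  then have j: "j < length xs" using q_le by simp
  have st: "sky (st (Suc j)) = (\<lambda>l. if 0 \<le> l \<and> l < 0 + ht j then sky (st j) 0 + wt j else sky (st j) l)"
     "posx (st (Suc j)) = (posx (st j))(xs ! j := X + sky (st j) 0)"
     "posy (st (Suc j)) = (posy (st j))(xs ! j := Y + 0)"
     "side (st (Suc j)) = q - Suc j" "level (st (Suc j)) = H"
    using IH(2,3) \<open>j < q\<close> unfolding st_Suc[OF j] place_def wt_def ht_def by (simp_all add: Let_def)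
  have all: "sky (st j) l = (\<Sum>t<j. wt t)" if "l < ht j" for l
  proof -
    have "l < H" using that ht_le[OF j] by simp
    moreover have "l < ht t" if "t < j" for t
      using that \<open>l < ht j\<close> ht_antimono[of t j] j by simp
    ultimately have "(\<Sum>t<j. if l < ht t then wt t else 0) = (\<Sum>t<j. wt t)"
      by (intro sum.cong) auto
    then show ?thesis using IH(5)[OF \<open>l < H\<close>] by (rule trans[rotated])
  qed
  have 0: "sky (st j) 0 = (\<Sum>t<j. wt t)" by (rule all) (rule ht_pos[OF j])
  have "(\<Sum>t<Suc j. wt t) \<le> (\<Sum>t<q. wt t)" using \<open>j < q\<close> by (intro sum_mono2) auto
  then have fit: "(\<Sum>t<j. wt t) + wt j \<le> W" using side_le by (simp add: wt_def)
  have "valid (Suc j)"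
  proof (rule valid_step[OF IH(1) j st(1,2,3)])
    show "sky (st j) l \<le> sky (st j) 0" if "l < 0 + ht j" for l using all[of l] 0 that by simp
    show "sky (st j) 0 + wt j \<le> W" using 0 fit by simp
    show "0 + ht j \<le> H" using ht_le[OF j] by simp
  qed
  moreover have "sky (st (Suc j)) H = W" using IH(4) ht_le[OF j] by (simp add: st(1))
  moreover have "sky (st (Suc j)) l = (\<Sum>t<Suc j. if l < ht t then wt t else 0)" if "l < H" for l
  proof (cases "l < ht j")
    case True
    have "sky (st (Suc j)) l = sky (st j) l + wt j" using True all[of l] 0 by (simp add: st(1))
    then show ?thesis using True IH(5)[OF that] by simp
  next
    case False
    then show ?thesis using IH(5)[OF that] by (simp add: st(1))
  qed
  ultimately show ?case using st(4,5) by blast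
qed

text \<open>Either the current row counts as full, as at the start, or a strip of height
  \<open>d\<close> above its bottom can take every remaining rectangle: it ends within the box, and
  nowhere on it is the skyline longer than at the bottom of the row.\<close>

definition row_state :: "nat \<Rightarrow> bool" where
  "row_state j \<longleftrightarrow> valid j \<and> side (st j) = 0 \<and> level (st j) \<le> H \<and>
     (\<forall>l < level (st j). sky (st j) l = stairs l) \<and>
     (sky (st j) (level (st j)) = W \<or> (\<exists>d. level (st j) + d \<le> H \<and> (\<forall>t. j \<le> t \<and> t < length xs \<longrightarrow> ht t \<le> d) \<and>
       (\<forall>l. level (st j) \<le> l \<and> l < level (st j) + d \<longrightarrow> sky (st j) l \<le> sky (st j) (level (st j)))))"

lemma row_state_start: "row_state q" and level_start: "level (st q) = H" "sky (st q) H = W"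
  using side_phase[of q] by (simp_all add: row_state_def stairs_def)

text \<open>A new row reaches from the bottom of the old one down by the height of its first
  rectangle. Only the staircase has been placed below the old bottom, and its skyline does not get
  longer upwards, so \<open>valid_step\<close> applies with the length at the new bottom.\<close>

lemma row_state_step:
  assumes r: "row_state j" and j: "j < length xs"
    and new: "W < sky (st j) (level (st j)) + wt j \<Longrightarrow>
      ht j \<le> level (st j) \<and> stairs (level (st j) - ht j) + wt j \<le> W"
  shows "row_state (Suc j)"
    and "level (st (Suc j)) = (if W < sky (st j) (level (st j)) + wt j then level (st j) - ht j else level (st j))"
    and "sky (st (Suc j)) (level (st (Suc j))) = (if W < sky (st j) (level (st j)) + wt j
      then stairs (level (st j) - ht j) + wt j else sky (st j) (level (st j)) + wt j)"
proof -
  let ?s = "st j" and ?v = "level (st j)"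
  define y where "y = (if W < sky ?s ?v + wt j then ?v - ht j else ?v)"
  have R: "valid j" "side ?s = 0" "?v \<le> H" "\<And>l. l < ?v \<Longrightarrow> sky ?s l = stairs l"
    using r unfolding row_state_def by blast+
  have st: "sky (st (Suc j)) = (\<lambda>l. if y \<le> l \<and> l < y + ht j then sky ?s y + wt j else sky ?s l)"
     "posx (st (Suc j)) = (posx ?s)(xs ! j := X + sky ?s y)"
     "posy (st (Suc j)) = (posy ?s)(xs ! j := Y + y)"
     "side (st (Suc j)) = 0" "level (st (Suc j)) = y"
    using R(2) unfolding st_Suc[OF j] place_def y_def wt_def ht_def by (simp_all add: Let_def)
  show lev: "level (st (Suc j)) = (if W < sky ?s ?v + wt j then ?v - ht j else ?v)"
    using st(5) y_def by simp
  have top: "sky (st (Suc j)) y = sky ?s y + wt j" using ht_pos[OF j] by (simp add: st(1))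
  have "valid (Suc j) \<and> y \<le> H \<and> (\<forall>l<y. sky (st (Suc j)) l = stairs l) \<and>
    (\<exists>d. y + d \<le> H \<and> (\<forall>t. Suc j \<le> t \<and> t < length xs \<longrightarrow> ht t \<le> d) \<and>
       (\<forall>l. y \<le> l \<and> l < y + d \<longrightarrow> sky (st (Suc j)) l \<le> sky (st (Suc j)) y)) \<and>
    sky ?s y = (if W < sky ?s ?v + wt j then stairs (?v - ht j) else sky ?s ?v)"
  proof (cases "W < sky ?s ?v + wt j")
    case True
    have *: "ht j \<le> ?v" "stairs (?v - ht j) + wt j \<le> W" using new[OF True] by auto
    have y: "y = ?v - ht j" "y < ?v" "y + ht j = ?v" using True * ht_pos[OF j] by (auto simp: y_def)
    have sk: "sky ?s l = stairs l" if "l < y + ht j" for l using R(4) y that by simp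
    have sky: "sky ?s y = stairs y" using sk ht_pos[OF j] by simp
    have skl: "sky ?s l \<le> sky ?s y" if "y \<le> l" "l < y + ht j" for l
      using sk[OF that(2)] sky stairs_antimono[OF that(1)] by simp
    have "valid (Suc j)"
    proof (rule valid_step[OF R(1) j st(1,2,3) skl])
      show "sky ?s y + wt j \<le> W" using sky * y(1) by simp
      show "y + ht j \<le> H" using y(3) R(3) by simp
    qed
    moreover have "\<forall>l<y. sky (st (Suc j)) l = stairs l" using sk y(2,3) by (simp add: st(1))
    moreover have "sky (st (Suc j)) l \<le> sky (st (Suc j)) y" if "y \<le> l" "l < y + ht j" for l
      using that by (simp add: st(1))
    then have "\<exists>d. y + d \<le> H \<and> (\<forall>t. Suc j \<le> t \<and> t < length xs \<longrightarrow> ht t \<le> d) \<and>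
       (\<forall>l. y \<le> l \<and> l < y + d \<longrightarrow> sky (st (Suc j)) l \<le> sky (st (Suc j)) y)"
      using y(3) R(3) ht_antimono[of j] by (intro exI[of _ "ht j"]) auto
    ultimately show ?thesis using True y R(3) sky by simp
  next
    case False
    then have y: "y = ?v" by (simp add: y_def)
    have "sky ?s ?v \<noteq> W" using False wt_pos[OF j] by auto
    then obtain d where d: "?v + d \<le> H" "\<And>t. j \<le> t \<Longrightarrow> t < length xs \<Longrightarrow> ht t \<le> d"
      "\<And>l. ?v \<le> l \<Longrightarrow> l < ?v + d \<Longrightarrow> sky ?s l \<le> sky ?s ?v"
      using r unfolding row_state_def by blast
    have dj: "ht j \<le> d" using d(2)[of j] j by simp
    have "valid (Suc j)"
    proof (rule valid_step[OF R(1) j st(1,2,3)])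
      show "sky ?s l \<le> sky ?s y" if "y \<le> l" "l < y + ht j" for l
        using d(3)[of l] dj that y by simp
      show "sky ?s y + wt j \<le> W" using False y by simp
      show "y + ht j \<le> H" using d(1) dj y by simp
    qed
    moreover have "\<forall>l<y. sky (st (Suc j)) l = stairs l" using R(4) y by (simp add: st(1))
    moreover have "sky (st (Suc j)) l \<le> sky (st (Suc j)) y" if "y \<le> l" "l < y + d" for l
      using that d(3)[of l] y ht_pos[OF j] by (simp add: st(1))
    then have "\<exists>d. y + d \<le> H \<and> (\<forall>t. Suc j \<le> t \<and> t < length xs \<longrightarrow> ht t \<le> d) \<and>
       (\<forall>l. y \<le> l \<and> l < y + d \<longrightarrow> sky (st (Suc j)) l \<le> sky (st (Suc j)) y)"
      using d(1,2) y by (intro exI[of _ d]) auto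
    ultimately show ?thesis using False y R(3) by simp
  qed
  then show "row_state (Suc j)" "sky (st (Suc j)) (level (st (Suc j))) = (if W < sky ?s ?v + wt j
      then stairs (?v - ht j) + wt j else sky ?s ?v + wt j)"
    unfolding row_state_def st(4,5) using top by (blast, simp)
qed

lemma valid_all_side: "q = length xs \<Longrightarrow> valid (length xs)"
  using side_phase[of q] by simp

text \<open>Even if every rectangle opens a row of its own, the level drops by no more than the
  total height.\<close>

lemma valid_stack:
  assumes "q = 0" "\<And>t. t < length xs \<Longrightarrow> wt t \<le> W" "(\<Sum>t<length xs. ht t) \<le> H"
  shows "valid (length xs)"
proof -
  have [simp]: "stairs l = 0" for l unfolding stairs_def using assms(1) by simp
  have "row_state j \<and> H \<le> level (st j) + (\<Sum>t<j. ht t)" if "j \<le> length xs" for j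
    using that
  proof (induction j)
    case 0
    then show ?case using row_state_start level_start by (simp add: assms(1))
  next
    case (Suc j)
    then have IH: "row_state j" "H \<le> level (st j) + (\<Sum>t<j. ht t)" and j: "j < length xs" by auto
    have "(\<Sum>t<Suc j. ht t) \<le> (\<Sum>t<length xs. ht t)" using j by (intro sum_mono2) auto
    then have le: "ht j \<le> level (st j)" using IH(2) assms(3) by simp
    have "row_state (Suc j)" by (rule row_state_step(1)[OF IH(1) j]) (use le assms(2)[OF j] in simp)
    moreover have "level (st (Suc j)) = (if W < sky (st j) (level (st j)) + wt j then level (st j) - ht j else level (st j))"
      by (rule row_state_step(2)[OF IH(1) j]) (use le assms(2)[OF j] in simp)
    ultimately show ?case using IH(2) le by simp
  qed
  then show ?thesis by (simp add: row_state_def)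
qed

end

section \<open>The area argument\<close>

context filling
begin

text \<open>The area of the part of the staircase above level \<open>y\<close>.\<close>

definition above :: "real \<Rightarrow> real" where
  "above y = (\<Sum>t<q. real (wt t) * max 0 (real (ht t) - y))"

lemma above_nonneg: "0 \<le> above y"
  unfolding above_def by (intro sum_nonneg) auto

lemma above_0: "above 0 = (\<Sum>t<q. real (wt t) * real (ht t))"
  unfolding above_def by (intro sum.cong) auto

text \<open>Between \<open>y'\<close> and \<open>y\<close> the staircase is at least as long as on
  level \<open>l\<close>, because it only gets longer downwards.\<close>

lemma above_diff:
  assumes "real l \<le> y" "y < real l + 1" "y' \<le> y"
  shows "real (stairs l) * (y - y') \<le> above y' - above y"
proof -
  have "real (stairs l) * (y - y') = (\<Sum>t<q. real (if l < ht t then wt t else 0) * (y - y'))"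
    unfolding stairs_def by (simp add: sum_distrib_right)
  also have "\<dots> \<le> (\<Sum>t<q. real (wt t) * max 0 (real (ht t) - y') - real (wt t) * max 0 (real (ht t) - y))"
  proof (intro sum_mono)
    fix t
    show "real (if l < ht t then wt t else 0) * (y - y')
        \<le> real (wt t) * max 0 (real (ht t) - y') - real (wt t) * max 0 (real (ht t) - y)"
    proof (cases "l < ht t")
      case True
      then have "y < real (ht t)" using assms by linarith
      then have "max 0 (real (ht t) - y') - max 0 (real (ht t) - y) = y - y'" using assms by simp
      then show ?thesis using True by (simp add: right_diff_distrib[symmetric])
    next
      case False
      have "max 0 (real (ht t) - y) \<le> max 0 (real (ht t) - y')" using assms by simp
      then show ?thesis using False by (simp add: mult_left_mono)
    qed
  qed
  also have "\<dots> = above y' - above y" by (simp add: above_def sum_subtractf)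
  finally show ?thesis .
qed

text \<open>\<open>Wr\<close> and \<open>hc\<close> are the real width and height available, and the
  box keeps their integral parts. A row is closed only when the next rectangle would make it longer
  than \<open>Wr\<close>, and its rectangles are at least as high as that rectangle. Adding this up
  over all rows, a row that no longer fits would make the total area exceed the bound in
  \<open>large\<close>, where \<open>r\<close> is the first rectangle of the second row.\<close>

lemma valid_rows:
  fixes Wr hc m :: real
  assumes W: "Wr < real W + 1" and H: "real H \<le> hc" "hc < real H + 1"
    and m: "\<And>t. t < length xs \<Longrightarrow> real (wt t) \<le> m"
    and room: "real (\<Sum>t<q. wt t) + m \<le> Wr"
    and large: "\<And>r. q < r \<Longrightarrow> r < length xs \<Longrightarrow> Wr < (\<Sum>t<Suc r. real (wt t)) \<Longrightarrow>
      (\<Sum>t<length xs. real (wt t) * real (ht t)) \<le>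
        (\<Sum>t=q..<r. (real (ht t) - real (ht r)) * real (wt t)) + real (ht r) * Wr +
        (Wr - m) * (hc - real (ht q) - real (ht r))"
  shows "valid (length xs)"
proof (cases "q = length xs")
  case True
  then show ?thesis by (rule valid_all_side)
next
  case False
  then have qN: "q < length xs" using q_le by simp
  let ?N = "length xs"
  \<comment> \<open>The part of the height lost by rounding. Levels shifted by it measure heights in
    the real container: level \<open>H\<close> becomes \<open>hc\<close>.\<close>
  define \<phi> where "\<phi> = hc - real H"
  have \<phi>: "0 \<le> \<phi>" "\<phi> < 1" using H by (auto simp: \<phi>_def)
  define R where "R f j = (\<Sum>t=f..<j. real (wt t))" for f j
  define Ar where "Ar f j = (\<Sum>t=f..<j. real (wt t) * real (ht t))" for f j
  have R_Suc: "R f (Suc j) = R f j + real (wt j)" if "f \<le> j" for f j using that by (simp add: R_def)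
  have Ar_Suc: "Ar f (Suc j) = Ar f j + real (wt j) * real (ht j)" if "f \<le> j" for f j
    using that by (simp add: Ar_def)
  have Wm: "real (stairs l) \<le> Wr - m" for l
    using stairs_le[of l] room by linarith
  have fit: "stairs l + wt j \<le> W" if "j < ?N" for l j
  proof -
    have "real (stairs l + wt j) < real (W + 1)" using Wm[of l] m[OF that] W by simp
    then show ?thesis by linarith
  qed
  have overfull: "Wr < real x" if "W < x" for x
  proof -
    have "real W + 1 \<le> real x" using that by linarith
    then show ?thesis using W by linarith
  qed
  define lv where "lv j = level (st j)" for j
  define used where "used j = sky (st j) (lv j)" for j
  define yr where "yr j = real (lv j) + \<phi>" for j
  \<comment> \<open>The shifted level of the bottom of the second row, if \<open>r\<close> is the
    first rectangle in it.\<close>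
  define y2 where "y2 r = hc - real (ht q) - real (ht r)" for r
  define first_row where "first_row j \<longleftrightarrow> lv j = H - ht q \<and> real (used j) = real (stairs (lv j)) + R q j" for j
  \<comment> \<open>Rectangle \<open>r\<close> is too wide for what is left of the first
    row.\<close>
  define closed where "closed r \<longleftrightarrow> q < r \<and> r < ?N \<and> Wr < real (stairs (H - ht q)) + R q r + real (wt r)" for r
  define base where "base r = Ar q r + real (wt r) * real (ht r)" for r
  \<comment> \<open>Here \<open>f\<close> is the first rectangle of the current row. The area in the
    rows so far is at least the sum of four parts: the first row and \<open>r\<close>; a strip of
    width \<open>Wr - m\<close> from the bottom of the second row down to that of the current row;
    minus the staircase inside this strip; and what the current row contains after \<open>f\<close>,
    counted with the height of its last rectangle.\<close>
  define later_row where "later_row j \<longleftrightarrow> (\<exists>r f. closed r \<and> ht q + ht r \<le> H \<and> r \<le> f \<and> f < j \<and>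
     yr j \<le> y2 r \<and> real (used j) = real (stairs (lv j)) + R f j \<and>
     base r + (Wr - m) * (y2 r - yr j) + above (y2 r) - above (yr j) + (R f j - real (wt f)) * real (ht (j - 1))
       \<le> Ar q j)" for j
  have Rw: "real (wt f) \<le> R f j" if "f < j" for f j
    unfolding R_def using that by (intro member_le_sum) auto
  have hq: "ht q \<le> H" using ht_le[OF qN] .
  \<comment> \<open>Cut off at height \<open>ht r\<close>, the first row together with
    \<open>r\<close> is longer than the space beside the staircase. The sum is what has been cut
    off.\<close>
  have base_bound: "(\<Sum>t=q..<r. (real (ht t) - real (ht r)) * real (wt t)) + real (ht r) * (Wr - real (stairs (H - ht q)))
      < base r" if "closed r" for r
  proof -
    have "0 < real (ht r)" using that ht_pos[of r] by (simp add: closed_def)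
    moreover have "Wr - real (stairs (H - ht q)) < R q r + real (wt r)" using that by (simp add: closed_def)
    ultimately have "real (ht r) * (Wr - real (stairs (H - ht q))) < real (ht r) * (R q r + real (wt r))"
      by simp
    moreover have "Ar q r = (\<Sum>t=q..<r. (real (ht t) - real (ht r)) * real (wt t)) + real (ht r) * R q r"
      unfolding Ar_def R_def sum_distrib_left sum.distrib[symmetric] by (intro sum.cong) (auto simp: algebra_simps)
    ultimately show ?thesis by (simp add: base_def algebra_simps)
  qed
  have total: "(\<Sum>t<?N. real (wt t) * real (ht t)) \<ge> above 0 + Ar q j" if "j \<le> ?N" "q \<le> j" for j
  proof -
    have "above 0 + Ar q j = (\<Sum>t<j. real (wt t) * real (ht t))"
      unfolding above_0 Ar_def lessThan_atLeast0 using that(2) by (simp add: sum.atLeastLessThan_concat)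
    also have "\<dots> \<le> (\<Sum>t<?N. real (wt t) * real (ht t))" using that(1) by (intro sum_mono2) auto
    finally show ?thesis .
  qed
  have closed_sum: "Wr < (\<Sum>t<Suc r. real (wt t))" if "closed r" for r
  proof -
    have "real (stairs (H - ht q)) \<le> (\<Sum>t=0..<q. real (wt t))"
      using stairs_le[of "H - ht q"] by (simp add: lessThan_atLeast0 flip: of_nat_sum)
    moreover have "(\<Sum>t=0..<q. real (wt t)) + R q r = (\<Sum>t=0..<r. real (wt t))"
      using that by (simp add: R_def closed_def sum.atLeastLessThan_concat)
    ultimately show ?thesis using that by (simp add: closed_def lessThan_atLeast0)
  qed
  \<comment> \<open>The staircase has area \<open>above 0\<close> and the rows have area
    \<open>Ar q j\<close>; together they would exceed the total that \<open>large\<close>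
    permits.\<close>
  have contra: False
    if r: "closed r" and j: "j \<le> ?N" "q \<le> j"
      and ar: "(\<Sum>t=q..<r. (real (ht t) - real (ht r)) * real (wt t)) + real (ht r) * Wr + (Wr - m) * y2 r - above 0 < Ar q j"
    for r j
  proof -
    have "(\<Sum>t<?N. real (wt t) * real (ht t)) \<le>
        (\<Sum>t=q..<r. (real (ht t) - real (ht r)) * real (wt t)) + real (ht r) * Wr + (Wr - m) * y2 r"
      using large[of r] r closed_sum[OF r] unfolding closed_def y2_def by blast
    then show False using total[OF j] ar by linarith
  qed
  have "row_state j \<and> (j = q \<or> first_row j \<or> later_row j)" if "q \<le> j" "j \<le> ?N" for j
    using that
  proof (induction j rule: dec_induct)
    case base
    then show ?case using row_state_start by simp
  next
    case (step j)
    then have j: "j < ?N" "q \<le> j" and IH: "row_state j" "j = q \<or> first_row j \<or> later_row j" by auto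
    have lvH: "lv j \<le> H" using IH(1) by (simp add: row_state_def lv_def)
    let ?new = "W < used j + wt j"
    have st: "row_state (Suc j) \<and> lv (Suc j) = (if ?new then lv j - ht j else lv j) \<and>
      used (Suc j) = (if ?new then stairs (lv j - ht j) + wt j else used j + wt j)" if "?new \<Longrightarrow> ht j \<le> lv j"
      using row_state_step[OF IH(1) j(1)] that fit[OF j(1)] unfolding used_def lv_def by blast
    have hj: "0 < real (ht j)" using ht_pos[OF j(1)] by simp
    consider (start) "j = q" | (first) "first_row j" "q < j" | (later) "later_row j" using IH(2) j by fastforce
    then show ?case
    proof cases
      case start
      have "lv j = H" "used j = W" using level_start by (simp_all add: lv_def used_def start)
      moreover have new: "?new" using \<open>used j = W\<close> wt_pos[OF j(1)] by simp
      ultimately have s: "row_state (Suc j)" "lv (Suc j) = H - ht q" "used (Suc j) = stairs (H - ht q) + wt q"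
        using st hq start by auto
      have "first_row (Suc j)" unfolding first_row_def s R_Suc[OF j(2)] using start by (simp add: R_def)
      with s show ?thesis by blast
    next
      case first
      have lv: "lv j = H - ht q" and us: "real (used j) = real (stairs (H - ht q)) + R q j"
        using first by (simp_all add: first_row_def)
      show ?thesis
      proof (cases ?new)
        case False
        then have s: "row_state (Suc j)" "lv (Suc j) = lv j" "used (Suc j) = used j + wt j" using st by auto
        have "first_row (Suc j)" unfolding first_row_def s R_Suc[OF j(2)] using us lv by simp
        with s show ?thesis by blast
      next
        case True
        have cl: "closed j"
          using overfull[OF True] us first(2) j by (simp add: closed_def)
        have y1: "real (H - ht q) \<le> y2 j + real (ht j)" "y2 j + real (ht j) < real (H - ht q) + 1"
          using \<phi> hq by (simp_all add: y2_def \<phi>_def of_nat_diff)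
        let ?S = "real (stairs (H - ht q))"
        have bb: "(\<Sum>t=q..<j. (real (ht t) - real (ht j)) * real (wt t)) + real (ht j) * Wr - real (ht j) * ?S < base j"
          using base_bound[OF cl] by (simp add: algebra_simps)
        show ?thesis
        proof (cases "ht j \<le> lv j")
          case True
          note le = this
          have s: "row_state (Suc j)" "lv (Suc j) = lv j - ht j" "used (Suc j) = stairs (lv (Suc j)) + wt j"
            using st le \<open>?new\<close> by auto
          have yr: "yr (Suc j) = y2 j"
            unfolding yr_def s(2) lv y2_def \<phi>_def using le lv hq by (simp add: of_nat_diff)
          have "later_row (Suc j)" unfolding later_row_def
          proof (intro exI[of _ j] conjI)
            show "ht q + ht j \<le> H" using le lv hq by simp
            show "base j + (Wr - m) * (y2 j - yr (Suc j)) + above (y2 j) - above (yr (Suc j)) +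
              (R j (Suc j) - real (wt j)) * real (ht (Suc j - 1)) \<le> Ar q (Suc j)"
              unfolding yr using Ar_Suc[OF j(2)] by (simp add: R_def base_def)
          qed (use cl yr s in \<open>auto simp: R_def\<close>)
          with s show ?thesis by blast
        next
          case False
          \<comment> \<open>The shifted bottom level of the first row, below which the staircase is
            at least \<open>?S\<close> long. If the second row does not fit, this piece of the
            staircase pays for the missing height.\<close>
          let ?y = "y2 j + real (ht j)"
          have y0: "0 \<le> ?y" using y1 by linarith
          have neg: "y2 j \<le> 0" using False y1 lv by linarith
          have "?S * ?y \<le> above 0 - above ?y"
            using above_diff[OF y1 y0] by simp
          then have "?S * ?y \<le> above 0" using above_nonneg[of ?y] by linarith
          moreover have "?S * (- y2 j) \<le> (Wr - m) * (- y2 j)"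
            using Wm neg by (intro mult_right_mono) auto
          ultimately have "real (ht j) * ?S \<le> above 0 - (Wr - m) * y2 j" by (simp add: algebra_simps)
          then have "(\<Sum>t=q..<j. (real (ht t) - real (ht j)) * real (wt t)) + real (ht j) * Wr + (Wr - m) * y2 j - above 0
              < base j" using bb by linarith
          also have "base j = Ar q (Suc j)" using Ar_Suc[OF j(2)] by (simp add: base_def)
          finally have False using contra[OF cl, of "Suc j"] j by simp
          then show ?thesis ..
        qed
      qed
    next
      case later
      then obtain r f where rf: "closed r" "ht q + ht r \<le> H" "r \<le> f" "f < j" "yr j \<le> y2 r"
        "real (used j) = real (stairs (lv j)) + R f j"
        "base r + (Wr - m) * (y2 r - yr j) + above (y2 r) - above (yr j) + (R f j - real (wt f)) * real (ht (j - 1))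
          \<le> Ar q j"
        unfolding later_row_def by blast
      have yl: "real (lv j) \<le> yr j" "yr j < real (lv j) + 1" using \<phi> by (auto simp: yr_def)
      have hj': "real (ht j) \<le> real (ht (j - 1))" using ht_antimono[of "j - 1" j] j by simp
      have step: "(R f j - real (wt f)) * real (ht j) \<le> (R f j - real (wt f)) * real (ht (j - 1))"
        using hj' Rw[OF rf(4)] by (intro mult_left_mono) auto
      show ?thesis
      proof (cases ?new)
        case False
        then have s: "row_state (Suc j)" "lv (Suc j) = lv j" "used (Suc j) = used j + wt j" using st by auto
        have yr: "yr (Suc j) = yr j" by (simp add: yr_def s)
        have RS: "R f (Suc j) = R f j + real (wt j)" using R_Suc rf(4) by simp
        have "later_row (Suc j)" unfolding later_row_def
        proof (rule exI[of _ r], rule exI[of _ f], intro conjI)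
          show "base r + (Wr - m) * (y2 r - yr (Suc j)) + above (y2 r) - above (yr (Suc j)) +
            (R f (Suc j) - real (wt f)) * real (ht (Suc j - 1)) \<le> Ar q (Suc j)"
            unfolding yr RS Ar_Suc[OF j(2)] using rf(7) step by (simp add: algebra_simps)
        qed (use rf yr s RS in auto)
        with s show ?thesis by blast
      next
        case True
        let ?S = "real (stairs (lv j))"
        \<comment> \<open>The first rectangle \<open>f\<close> of this row has been charged to the
          row above; in exchange the next rectangle \<open>j\<close> is charged to this row. So a
          closed row lacks at most \<open>m\<close> of the space beside the staircase.\<close>
        have full: "Wr < ?S + R f j + real (wt j)" using overfull[OF True] rf(6) by simp
        have "real (wt f) \<le> m" using m[of f] rf(4) j by simp
        then have "(Wr - ?S - m) < R f j - real (wt f) + real (wt j)" using full by linarith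
        then have gain: "(Wr - ?S - m) * real (ht j) < (R f j - real (wt f) + real (wt j)) * real (ht j)"
          using hj by simp
        have ar: "base r + (Wr - m) * (y2 r - yr j) + above (y2 r) - above (yr j) + (Wr - ?S - m) * real (ht j)
            < Ar q (Suc j)"
          unfolding Ar_Suc[OF j(2)] using rf(7) step gain by (simp add: algebra_simps)
        show ?thesis
        proof (cases "ht j \<le> lv j")
          case True
          have s: "row_state (Suc j)" "lv (Suc j) = lv j - ht j" "used (Suc j) = stairs (lv (Suc j)) + wt j"
            using st True \<open>?new\<close> by auto
          have yr: "yr (Suc j) = yr j - real (ht j)" unfolding yr_def s(2) using True by (simp add: of_nat_diff)
          have "?S * real (ht j) \<le> above (yr (Suc j)) - above (yr j)"
            using above_diff[OF yl, of "yr (Suc j)"] yr hj by simp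
          then have fin: "base r + (Wr - m) * (y2 r - yr (Suc j)) + above (y2 r) - above (yr (Suc j)) \<le> Ar q (Suc j)"
            unfolding yr using ar by (simp add: algebra_simps)
          have "later_row (Suc j)" unfolding later_row_def
            by (rule exI[of _ r], rule exI[of _ j], intro conjI) (use rf yr s hj fin in \<open>auto simp: R_def\<close>)
          with s show ?thesis by blast
        next
          case False
          have "yr j \<le> real (ht j)" using False yl by linarith
          then have "(Wr - ?S - m) * yr j \<le> (Wr - ?S - m) * real (ht j)"
            using Wm[of "lv j"] by (intro mult_left_mono) auto
          moreover have "?S * yr j \<le> above 0 - above (yr j)"
            using above_diff[OF yl, of 0] yl by simp
          ultimately have "base r + (Wr - m) * y2 r + above (y2 r) - above 0 < Ar q (Suc j)"
            using ar by (simp add: algebra_simps)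
          \<comment> \<open>The staircase between \<open>y2 r\<close> and the bottom of the first
            row makes up for the length that \<open>base_bound\<close> has to subtract.\<close>
          moreover have "(\<Sum>t=q..<r. (real (ht t) - real (ht r)) * real (wt t)) + real (ht r) * Wr - above (y2 r) < base r"
          proof -
            have "real (H - ht q) \<le> y2 r + real (ht r)" "y2 r + real (ht r) < real (H - ht q) + 1"
              using \<phi> hq by (simp_all add: y2_def \<phi>_def of_nat_diff)
            from above_diff[OF this, of "y2 r"] have "real (stairs (H - ht q)) * real (ht r) \<le> above (y2 r)"
              using above_nonneg[of "y2 r + real (ht r)"] by simp
            then show ?thesis using base_bound[OF rf(1)] by (simp add: algebra_simps)
          qed
          ultimately have False using contra[OF rf(1), of "Suc j"] j by simp
          then show ?thesis ..
        qed
      qed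
    qed
  qed
  from this[of ?N] show ?thesis using q_le by (simp add: row_state_def)
qed

end

section \<open>How many rectangles to put side by side\<close>

lemma threshold_index:
  fixes h :: "nat \<Rightarrow> real"
  assumes "\<And>t u. t \<le> u \<Longrightarrow> u < N \<Longrightarrow> h u \<le> h t"
  shows "\<exists>q\<le>N. (\<forall>t<q. \<theta> < h t) \<and> (\<forall>t. q \<le> t \<and> t < N \<longrightarrow> h t \<le> \<theta>)"
proof (cases "\<exists>t<N. h t \<le> \<theta>")
  case True
  define q where "q = (LEAST t. t < N \<and> h t \<le> \<theta>)"
  have q: "q < N" "h q \<le> \<theta>" using LeastI_ex[OF True] by (auto simp: q_def)
  have "\<theta> < h t" if "t < q" for t using not_less_Least[of t] that q(1) unfolding q_def by fastforce
  then show ?thesis using q assms by (intro exI[of _ q]) (auto intro: order_trans)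
next
  case False
  then show ?thesis by (intro exI[of _ N]) (auto simp: not_le)
qed

locale granular =
  fixes \<epsilon> :: real and N :: nat and w h :: "nat \<Rightarrow> real"
  assumes eps: "0 < \<epsilon>" "\<epsilon> \<le> 1"
    and sorted: "\<And>t u. t \<le> u \<Longrightarrow> u < N \<Longrightarrow> h u \<le> h t"
    and w: "\<And>t. t < N \<Longrightarrow> 0 < w t" "\<And>t. t < N \<Longrightarrow> w t \<le> \<epsilon>"
    and h: "\<And>t. t < N \<Longrightarrow> 0 < h t" "\<And>t. t < N \<Longrightarrow> h t \<le> \<epsilon>"
    and area: "(\<Sum>t<N. w t * h t) \<le> 1"
    and tall: "(\<Sum>t | t < N \<and> 1 / 2 < h t. w t) \<le> 1"
begin

definition c :: "nat \<Rightarrow> real" where "c j = (\<Sum>t<j. w t)"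

text \<open>The area that the first row contains above the height of the first rectangle of the
  second row. The estimate of a row by the height of the next one ignores this part, and it is the
  gain exploited below.\<close>

definition excess :: "nat \<Rightarrow> nat \<Rightarrow> real" where "excess q r = (\<Sum>t=q..<r. (h t - h r) * w t)"

text \<open>What follows if the layout with \<open>q\<close> rectangles side by side does not fit, where \<open>r\<close> is the first
  rectangle of the second row and the container has been scaled to the unit square.\<close>

definition overflow :: "nat \<Rightarrow> nat \<Rightarrow> bool" where
  "overflow q r \<longleftrightarrow> q < r \<and> r < N \<and> 1 + 2 * \<epsilon> < c (Suc r) \<and>
     excess q r + h r * (1 + 2 * \<epsilon>) + (1 + \<epsilon>) * (1 - h q - h r) < (\<Sum>t<N. w t * h t)"

lemma c_mono: "i \<le> j \<Longrightarrow> j \<le> N \<Longrightarrow> c i \<le> c j"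
  unfolding c_def using w(1) by (intro sum_mono2) (auto intro: less_imp_le)

lemma c_diff: "i \<le> j \<Longrightarrow> c j - c i = (\<Sum>t=i..<j. w t)"
  unfolding c_def lessThan_atLeast0 by (simp add: sum_diff_nat_ivl)

lemma excess_term: "t < r \<Longrightarrow> r < N \<Longrightarrow> 0 \<le> (h t - h r) * w t"
  using sorted[of t r] w(1)[of t] by (intro mult_nonneg_nonneg) auto

lemma excess_nonneg: "r < N \<Longrightarrow> 0 \<le> excess q r"
  unfolding excess_def by (intro sum_nonneg excess_term) auto

lemma excess_ge:
  assumes "q \<le> i" "i \<le> j" "j \<le> r" "r < N" "\<And>t. t < i \<Longrightarrow> \<theta> \<le> h t" "\<And>t. t < j \<Longrightarrow> \<theta>' \<le> h t"
  shows "(\<theta> - h r) * (c i - c q) + (\<theta>' - h r) * (c j - c i) \<le> excess q r"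
proof -
  have "excess q r = (\<Sum>t=q..<i. (h t - h r) * w t) + (\<Sum>t=i..<j. (h t - h r) * w t) + (\<Sum>t=j..<r. (h t - h r) * w t)"
    unfolding excess_def using assms by (simp add: sum.atLeastLessThan_concat)
  moreover have "0 \<le> (\<Sum>t=j..<r. (h t - h r) * w t)" using assms(4) by (intro sum_nonneg excess_term) auto
  moreover have "(\<theta> - h r) * (c i - c q) \<le> (\<Sum>t=q..<i. (h t - h r) * w t)"
    unfolding c_diff[OF assms(1)] sum_distrib_left
    using assms w(1) by (intro sum_mono mult_right_mono) (auto intro: less_imp_le)
  moreover have "(\<theta>' - h r) * (c j - c i) \<le> (\<Sum>t=i..<j. (h t - h r) * w t)"
    unfolding c_diff[OF assms(2)] sum_distrib_left
    using assms w(1) by (intro sum_mono mult_right_mono) (auto intro: less_imp_le)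
  ultimately show ?thesis by simp
qed

text \<open>Inserting the area bound 1 leaves a condition on \<open>h q\<close>. In particular, an
  overflow forces \<open>h q\<close> to be larger than
  \<open>\<epsilon> / (1 + \<epsilon>)\<close>.\<close>

lemma overflow_bound:
  assumes "overflow q r"
  shows "excess q r + \<epsilon> * h r + \<epsilon> < (1 + \<epsilon>) * h q"
  using assms area unfolding overflow_def by (simp add: algebra_simps)

lemma overflow_c: "overflow q r \<Longrightarrow> 1 + \<epsilon> < c r"
  using w(2)[of r] unfolding overflow_def c_def by simp

text \<open>The candidates are all rectangles higher than \<open>\<theta>\<close> and all those
  higher than \<open>1 / 2\<close>. The former cannot overflow by the choice of
  \<open>\<theta>\<close>. If they are too wide, then those of height between
  \<open>\<theta>\<close> and \<open>1 / 2\<close> have total width more than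
  \<open>\<epsilon>\<close>; left to the rows, they produce enough \<open>excess\<close> to rule out
  an overflow of the latter.\<close>

lemma good_side_large_eps:
  assumes "1 \<le> 3 * \<epsilon>\<^sup>2"
  shows "\<exists>q\<le>N. c q \<le> 1 + \<epsilon> \<and> (\<forall>r. \<not> overflow q r)"
proof -
  define \<theta> where "\<theta> = \<epsilon> / (1 + \<epsilon>)"
  have \<theta>: "\<theta> \<le> 1 / 2" "(1 + \<epsilon>) * \<theta> = \<epsilon>" using eps by (auto simp: \<theta>_def field_simps)
  \<comment> \<open>The origin of the constant 3: cleared of denominators, the claim is
    \<open>1 - \<epsilon>\<^sup>2 \<le> 2 * \<epsilon>\<^sup>2\<close>.\<close>
  have eps_\<theta>: "(1 - \<epsilon>) / 2 \<le> \<epsilon> * \<theta>"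
  proof -
    have "(1 - \<epsilon>) * (1 + \<epsilon>) \<le> 2 * \<epsilon>\<^sup>2" using assms by (simp add: algebra_simps power2_eq_square)
    then have "(1 - \<epsilon>) / 2 \<le> \<epsilon>\<^sup>2 / (1 + \<epsilon>)" using eps by (simp add: field_simps)
    then show ?thesis by (simp add: \<theta>_def power2_eq_square)
  qed
  obtain q1 where q1: "q1 \<le> N" "\<And>t. t < q1 \<Longrightarrow> 1 / 2 < h t" "\<And>t. q1 \<le> t \<Longrightarrow> t < N \<Longrightarrow> h t \<le> 1 / 2"
    using threshold_index[of N h "1 / 2"] sorted by blast
  obtain q2 where q2: "q2 \<le> N" "\<And>t. t < q2 \<Longrightarrow> \<theta> < h t" "\<And>t. q2 \<le> t \<Longrightarrow> t < N \<Longrightarrow> h t \<le> \<theta>"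
    using threshold_index[of N h \<theta>] sorted by blast
  have "q1 \<le> q2"
  proof (rule ccontr)
    assume "\<not> q1 \<le> q2"
    then show False using q1(2)[of q2] q2(3)[of q2] q1(1) \<theta>(1) by simp
  qed
  have "{t. t < N \<and> 1 / 2 < h t} = {..<q1}"
    using q1 by (auto simp: not_less[symmetric])
  then have c1: "c q1 \<le> 1" using tall by (simp add: c_def)
  show ?thesis
  proof (cases "c q2 \<le> 1 + \<epsilon>")
    case True
    have "\<not> overflow q2 r" for r
    proof
      assume o: "overflow q2 r"
      then have r: "q2 < r" "r < N" by (auto simp: overflow_def)
      then have "(1 + \<epsilon>) * h q2 \<le> (1 + \<epsilon>) * \<theta>" using q2(3)[of q2] eps by (intro mult_left_mono) auto
      moreover have "0 < \<epsilon> * h r" using eps h(1)[OF r(2)] by simp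
      ultimately show False using overflow_bound[OF o] excess_nonneg[OF r(2), of q2] \<theta>(2) by linarith
    qed
    with True q2(1) show ?thesis by blast
  next
    case False
    have "\<not> overflow q1 r" for r
    proof
      assume o: "overflow q1 r"
      then have r: "q1 < r" "r < N" by (auto simp: overflow_def)
      have "(1 + \<epsilon>) * h q1 \<le> (1 + \<epsilon>) * (1 / 2)" using q1(3)[of q1] r eps by (intro mult_left_mono) auto
      then have b: "excess q1 r + \<epsilon> * h r < (1 - \<epsilon>) / 2" using overflow_bound[OF o] by (simp add: field_simps)
      have "\<epsilon> * h r < \<epsilon> * \<theta>" using b excess_nonneg[OF r(2), of q1] eps_\<theta> by linarith
      then have hr: "h r < \<theta>" using eps by simp
      have "q2 \<le> r" using q2(2)[of r] hr by (meson leI less_asym)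
      have "(\<theta> - h r) * \<epsilon> \<le> (\<theta> - h r) * (c q2 - c q1)"
        using hr False c1 by (intro mult_left_mono) auto
      also have "\<dots> \<le> excess q1 r"
        using excess_ge[of q1 q1 q2 r "h r" \<theta>] \<open>q1 \<le> q2\<close> \<open>q2 \<le> r\<close> r sorted q2(2) by (auto intro: less_imp_le)
      finally show False using b eps_\<theta> by (simp add: algebra_simps)
    qed
    moreover have "c q1 \<le> 1 + \<epsilon>" using c1 eps by simp
    ultimately show ?thesis using q1(1) by blast
  qed
qed

text \<open>Unless everything fits side by side, the candidates are the longest prefix of width at
  most 1 and the empty prefix. If both overflow, then the first overflow bounds \<open>h q\<close>
  from below and the second from above. Eliminating \<open>h q\<close> gives a lower bound for the
  height \<open>?x\<close> that contradicts \<open>?x \<le> \<epsilon>\<close>.\<close>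

lemma good_side_small_eps:
  assumes "3 * \<epsilon>\<^sup>2 < 1"
  shows "\<exists>q\<le>N. c q \<le> 1 + \<epsilon> \<and> (\<forall>r. \<not> overflow q r)"
proof (cases "c N \<le> 1 + \<epsilon>")
  case True
  then show ?thesis by (intro exI[of _ N]) (auto simp: overflow_def)
next
  case False
  define q where "q = (LEAST j. 1 < c (Suc j))"
  have exN: "1 < c (Suc (N - 1))" "0 < N" using False eps by (cases N; simp add: c_def)+
  have q: "1 < c (Suc q)" unfolding q_def by (rule LeastI[of "\<lambda>j. 1 < c (Suc j)", OF exN(1)])
  have qN: "q < N" using Least_le[of "\<lambda>j. 1 < c (Suc j)", OF exN(1)] exN(2) unfolding q_def by linarith
  have cq: "c q \<le> 1"
  proof (cases q)
    case 0
    then show ?thesis by (simp add: c_def)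
  next
    case (Suc j)
    then show ?thesis using not_less_Least[of j "\<lambda>j. 1 < c (Suc j)"] unfolding q_def by fastforce
  qed
  show ?thesis
  proof (rule ccontr)
    assume neg: "\<not> ?thesis"
    have "c q \<le> 1 + \<epsilon>" "c 0 \<le> 1 + \<epsilon>" using cq eps by (auto simp: c_def)
    then obtain r r0 where o: "overflow q r" "overflow 0 r0" using neg qN by (meson less_imp_le zero_le)
    have r: "q < r" "r < N" "1 + \<epsilon> < c r" "0 < r0" "r0 < N" "1 + \<epsilon> < c r0"
      using o overflow_c[OF o(1)] overflow_c[OF o(2)] by (auto simp: overflow_def)
    \<comment> \<open>The shortest prefix wider than \<open>1 + \<epsilon>\<close>. In an overflow
      the second row starts no earlier, so the prefix counts fully for both values of
      \<open>excess\<close>, and all its rectangles have height at least \<open>?x\<close>.\<close>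
    define l where "l = (LEAST j. 1 + \<epsilon> < c j)"
    have l: "1 + \<epsilon> < c l" unfolding l_def by (rule LeastI[of "\<lambda>j. 1 + \<epsilon> < c j", OF r(3)])
    have lr: "l \<le> r" "l \<le> r0" unfolding l_def by (auto intro: Least_le r(3,6))
    have ql: "Suc q \<le> l"
    proof (rule ccontr)
      assume "\<not> Suc q \<le> l"
      then have "c l \<le> c q" using c_mono[of l q] qN by simp
      then show False using l cq eps by simp
    qed
    let ?x = "h (l - 1)"
    have xle: "?x \<le> h t" if "t < l" for t using sorted[of t "l - 1"] that lr r by simp
    have x\<epsilon>: "?x \<le> \<epsilon>" using h(2)[of "l - 1"] ql lr r by simp
    have hr: "h r \<le> ?x" "h r0 \<le> ?x" "?x \<le> h q"
      using sorted[of "l - 1" r] sorted[of "l - 1" r0] sorted[of q "l - 1"] ql lr r by auto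
    have hq: "h q \<le> h t" if "t < Suc q" for t using sorted[of t q] that qN by simp
    have "(?x - h r) * \<epsilon> \<le> (?x - h r) * (c l - c q)" using hr l cq by (intro mult_left_mono) auto
    also have "\<dots> \<le> excess q r" using excess_ge[of q q l r "h r" ?x] ql lr r xle sorted by auto
    finally have 1: "\<epsilon> * ?x + \<epsilon> < (1 + \<epsilon>) * h q" using overflow_bound[OF o(1)] by (simp add: algebra_simps)
    have "(h q - h r0) * (c (Suc q) - c 0) + (?x - h r0) * (c l - c (Suc q)) \<le> excess 0 r0"
      using excess_ge[of 0 "Suc q" l r0 "h q" ?x] ql lr r xle hq by auto
    moreover have "c 0 = 0" by (simp add: c_def)
    moreover have "(h q - ?x) * 1 \<le> (h q - ?x) * c (Suc q)" using hr q by (intro mult_left_mono) auto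
    moreover have "(?x - h r0) * (1 + \<epsilon>) \<le> (?x - h r0) * c l" using hr l by (intro mult_left_mono) auto
    ultimately have "(h q - ?x) + (?x - h r0) * (1 + \<epsilon>) \<le> excess 0 r0" by (simp add: algebra_simps)
    moreover have "(1 + \<epsilon>) * h 0 \<le> (1 + \<epsilon>) * \<epsilon>" using h(2)[of 0] r eps by (intro mult_left_mono) auto
    ultimately have "(h q - ?x) + (?x - h r0) * (1 + \<epsilon>) + \<epsilon> * h r0 + \<epsilon> < (1 + \<epsilon>) * \<epsilon>"
      using overflow_bound[OF o(2)] by linarith
    then have 2: "h q + \<epsilon> * ?x - h r0 < \<epsilon>\<^sup>2" by (simp add: algebra_simps power2_eq_square)
    have "h q + \<epsilon> * ?x - ?x < \<epsilon>\<^sup>2" using 2 hr by linarith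
    \<comment> \<open>Scaling by \<open>1 + \<epsilon>\<close> prepares the elimination of
      \<open>h q\<close> with the help of 1.\<close>
    then have "(1 + \<epsilon>) * (h q + \<epsilon> * ?x - ?x) \<le> (1 + \<epsilon>) * \<epsilon>\<^sup>2" using eps by (intro mult_left_mono) auto
    then have "\<epsilon> * ?x + \<epsilon> + (1 + \<epsilon>) * (\<epsilon> * ?x - ?x) < (1 + \<epsilon>) * \<epsilon>\<^sup>2" using 1 by (simp add: algebra_simps)
    then have 3: "\<epsilon> - \<epsilon>\<^sup>2 - \<epsilon>^3 < (1 - \<epsilon> - \<epsilon>\<^sup>2) * ?x" by (simp add: algebra_simps power2_eq_square power3_eq_cube)
    \<comment> \<open>This makes the factor of \<open>?x\<close> in 3 nonnegative. Otherwise
      \<open>\<epsilon>\<close> would exceed \<open>2 / 3\<close>, against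
      \<open>3 * \<epsilon>\<^sup>2 < 1\<close>.\<close>
    have "\<epsilon> + \<epsilon>\<^sup>2 \<le> 1"
    proof (rule ccontr)
      assume "\<not> ?thesis"
      then have "2 / 3 < \<epsilon>" using assms by linarith
      then have "(2 / 3) * (2 / 3) < \<epsilon> * \<epsilon>" by (intro mult_strict_mono) auto
      then show False using assms by (simp add: power2_eq_square)
    qed
    then have "(1 - \<epsilon> - \<epsilon>\<^sup>2) * ?x \<le> (1 - \<epsilon> - \<epsilon>\<^sup>2) * \<epsilon>" using x\<epsilon> by (intro mult_left_mono) auto
    then show False using 3 by (simp add: algebra_simps power2_eq_square power3_eq_cube)
  qed
qed

theorem good_side: "\<exists>q\<le>N. c q \<le> 1 + \<epsilon> \<and> (\<forall>r. \<not> overflow q r)"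
  using good_side_large_eps good_side_small_eps not_less by metis

end

section \<open>Which sets of rectangles the layout can put into a box\<close>

definition packed_inside :: "nat \<Rightarrow> nat \<Rightarrow> nat \<Rightarrow> nat \<Rightarrow> nat set \<Rightarrow> (nat \<Rightarrow> nat) \<Rightarrow> (nat \<Rightarrow> nat) \<Rightarrow>
    (nat \<Rightarrow> nat) \<Rightarrow> (nat \<Rightarrow> nat) \<Rightarrow> bool" where
  "packed_inside X Y W H D x y w h \<longleftrightarrow>
    (\<forall>i\<in>D. X \<le> x i \<and> Y \<le> y i \<and> x i + w i \<le> X + W \<and> y i + h i \<le> Y + H \<and> (\<forall>j\<in>D. i \<noteq> j \<longrightarrow>
      x i + w i \<le> x j \<or> x j + w j \<le> x i \<or> y i + h i \<le> y j \<or> y j + h j \<le> y i))"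

text \<open>The alternatives belong to vertical, horizontal and area containers, in this order. In
  the last one, \<open>cw\<close> and \<open>ch\<close> are the sizes of the container before
  stretching and rounding.\<close>

definition fillable :: "nat \<Rightarrow> nat \<Rightarrow> nat set \<Rightarrow> (nat \<Rightarrow> nat) \<Rightarrow> (nat \<Rightarrow> nat) \<Rightarrow> bool" where
  "fillable W H D w h \<longleftrightarrow>
    ((\<Sum>i\<in>D. w i) \<le> W \<and> (\<forall>i\<in>D. h i \<le> H)) \<or>
    ((\<Sum>i\<in>D. h i) \<le> H \<and> (\<forall>i\<in>D. w i \<le> W)) \<or>
    (\<exists>\<epsilon> cw ch :: real. 0 < \<epsilon> \<and> \<epsilon> \<le> 1 \<and> 0 < cw \<and> 0 < ch \<and> (1 + 2 * \<epsilon>) * cw < real W + 1 \<and>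
      real H \<le> ch \<and> ch < real H + 1 \<and> (\<forall>i\<in>D. real (w i) \<le> \<epsilon> * cw \<and> real (h i) \<le> \<epsilon> * ch) \<and>
      (\<Sum>i\<in>D. real (w i) * real (h i)) \<le> cw * ch \<and> (\<Sum>i | i \<in> D \<and> ch / 2 < real (h i). real (w i)) \<le> cw)"

lemma (in filling) valid_imp_packed:
  assumes "valid (length xs)"
  shows "packed_inside X Y W H (set xs) (posx (st (length xs))) (posy (st (length xs))) w h"
  unfolding packed_inside_def
proof (intro ballI conjI impI)
  fix i assume "i \<in> set xs"
  then obtain t where t: "t < length xs" "i = xs ! t" by (metis in_set_conv_nth)
  show "X \<le> posx (st (length xs)) i" "Y \<le> posy (st (length xs)) i"
    "posx (st (length xs)) i + w i \<le> X + W" "posy (st (length xs)) i + h i \<le> Y + H"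
    using assms t unfolding valid_def wt_def ht_def by blast+
  fix j assume "j \<in> set xs" "i \<noteq> j"
  then obtain u where u: "u < length xs" "j = xs ! u" "t \<noteq> u" using t by (metis in_set_conv_nth)
  show "posx (st (length xs)) i + w i \<le> posx (st (length xs)) j \<or> posx (st (length xs)) j + w j \<le> posx (st (length xs)) i \<or>
    posy (st (length xs)) i + h i \<le> posy (st (length xs)) j \<or> posy (st (length xs)) j + h j \<le> posy (st (length xs)) i"
    using assms t u unfolding valid_def wt_def ht_def by blast
qed

lemma sum_nth_eq:
  assumes "distinct xs"
  shows "(\<Sum>t<length xs. f (xs ! t)) = (\<Sum>i\<in>set xs. f i)"
  using sum.reindex_bij_betw[OF bij_betw_nth[OF assms refl refl]] by (simp add: lessThan_def)

text \<open>All rectangles go side by side, or none, or as many as \<open>good_side\<close> yields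
  for the container scaled to the unit square. The number \<open>q\<close> is chosen before the
  corner of the box and the start layout, so it can be guessed without knowing them.\<close>

theorem fillable_imp_packed:
  assumes dist: "distinct xs" and sorted: "sorted_wrt (\<lambda>i j. h j \<le> h i) xs"
    and pos: "\<And>i. i \<in> set xs \<Longrightarrow> 0 < w i \<and> 0 < h i" and fill: "fillable W H (set xs) w h"
  shows "\<exists>q \<le> length xs. \<forall>X Y s. level s = H \<and> side s = q \<and> (\<forall>l<H. sky s l = 0) \<and> sky s H = W \<longrightarrow>
    packed_inside X Y W H (set xs) (posx (fold (place X Y W w h) xs s)) (posy (fold (place X Y W w h) xs s)) w h"
proof -
  let ?N = "length xs"
  have srt: "h (xs ! u) \<le> h (xs ! t)" if "t \<le> u" "u < ?N" for t u
    using sorted that unfolding sorted_wrt_iff_nth_less by (cases "t = u") auto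
  have fin: "packed_inside X Y W H (set xs) (posx (fold (place X Y W w h) xs s)) (posy (fold (place X Y W w h) xs s)) w h"
    if "filling W H w h xs q s" "filling.valid X Y W H w h xs s ?N" for X Y s q
    using filling.valid_imp_packed[OF that] filling.st_def[OF that(1), of X Y ?N] by simp
  have mk: "filling W H w h xs q s"
    if "level s = H \<and> side s = q \<and> (\<forall>l<H. sky s l = 0) \<and> sky s H = W" "q \<le> ?N"
       "(\<Sum>t<q. w (xs ! t)) \<le> W" "\<And>i. i \<in> set xs \<Longrightarrow> h i \<le> H" for q s
    using that dist srt pos by unfold_locales auto
  from fill consider
    (V) "(\<Sum>i\<in>set xs. w i) \<le> W" "\<forall>i\<in>set xs. h i \<le> H" |
    (H) "(\<Sum>i\<in>set xs. h i) \<le> H" "\<forall>i\<in>set xs. w i \<le> W" |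
    (A) \<epsilon> cw ch :: real where "0 < \<epsilon>" "\<epsilon> \<le> 1" "0 < cw" "0 < ch" "(1 + 2 * \<epsilon>) * cw < real W + 1"
      "real H \<le> ch" "ch < real H + 1" "\<forall>i\<in>set xs. real (w i) \<le> \<epsilon> * cw \<and> real (h i) \<le> \<epsilon> * ch"
      "(\<Sum>i\<in>set xs. real (w i) * real (h i)) \<le> cw * ch" "(\<Sum>i | i \<in> set xs \<and> ch / 2 < real (h i). real (w i)) \<le> cw"
    unfolding fillable_def by blast
  then show ?thesis
  proof cases
    case V
    have "packed_inside X Y W H (set xs) (posx (fold (place X Y W w h) xs s)) (posy (fold (place X Y W w h) xs s)) w h"
      if s: "level s = H \<and> side s = ?N \<and> (\<forall>l<H. sky s l = 0) \<and> sky s H = W" for X Y s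
    proof -
      have f: "filling W H w h xs ?N s" using mk[OF s] V by (simp add: sum_nth_eq[OF dist])
      show ?thesis using fin[OF f] filling.valid_all_side[OF f] by blast
    qed
    then show ?thesis by blast
  next
    case H
    have hH: "h i \<le> H" if "i \<in> set xs" for i
      using H(1) member_le_sum[OF that, of h] by simp
    have "packed_inside X Y W H (set xs) (posx (fold (place X Y W w h) xs s)) (posy (fold (place X Y W w h) xs s)) w h"
      if s: "level s = H \<and> side s = 0 \<and> (\<forall>l<H. sky s l = 0) \<and> sky s H = W" for X Y s
    proof -
      have f: "filling W H w h xs 0 s" using mk[OF s] hH by simp
      have "filling.valid X Y W H w h xs s ?N"
        using H by (intro filling.valid_stack[OF f])
          (auto simp: filling.wt_def[OF f] filling.ht_def[OF f] sum_nth_eq[OF dist])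
      then show ?thesis using fin[OF f] by blast
    qed
    then show ?thesis by blast
  next
    case (A \<epsilon> cw ch)
    define wr where "wr t = real (w (xs ! t)) / cw" for t
    define hr where "hr t = real (h (xs ! t)) / ch" for t
    have tall: "(\<Sum>t | t < ?N \<and> 1 / 2 < hr t. wr t) \<le> 1"
    proof -
      have "bij_betw ((!) xs) {t. t < ?N \<and> 1 / 2 < hr t} {i \<in> set xs. ch / 2 < real (h i)}"
        using dist A(4) by (auto simp: bij_betw_def inj_on_def nth_eq_iff_index_eq hr_def in_set_conv_nth field_simps)
      from sum.reindex_bij_betw[OF this, of "\<lambda>i. real (w i) / cw"]
      have "(\<Sum>t | t < ?N \<and> 1 / 2 < hr t. wr t) = (\<Sum>i | i \<in> set xs \<and> ch / 2 < real (h i). real (w i)) / cw"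
        by (simp add: wr_def sum_divide_distrib)
      then show ?thesis using A(3,10) by simp
    qed
    have area: "(\<Sum>t<?N. wr t * hr t) = (\<Sum>i\<in>set xs. real (w i) * real (h i)) / (cw * ch)"
      using sum_nth_eq[OF dist, of "\<lambda>i. real (w i) * real (h i) / (cw * ch)"]
      by (simp add: wr_def hr_def sum_divide_distrib)
    interpret granular \<epsilon> ?N wr hr
    proof
      show "(\<Sum>t<?N. wr t * hr t) \<le> 1" using A(3,4,9) by (simp add: area)
    qed (use A srt pos tall in \<open>auto simp: wr_def hr_def divide_simps intro: mult_pos_pos\<close>)
    obtain q where q: "q \<le> ?N" "c q \<le> 1 + \<epsilon>" "\<And>r. \<not> overflow q r" using good_side by blast
    have csum: "(\<Sum>t<j. real (w (xs ! t))) = cw * c j" for j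
      using A(3) by (simp add: c_def wr_def sum_divide_distrib[symmetric])
    have room: "(\<Sum>t<q. real (w (xs ! t))) + \<epsilon> * cw \<le> (1 + 2 * \<epsilon>) * cw"
      unfolding csum using mult_left_mono[OF q(2), of cw] A(3) by (simp add: algebra_simps)
    have hH: "h i \<le> H" if "i \<in> set xs" for i
    proof -
      have "real (h i) \<le> 1 * ch" using A(2,4,8) that by (meson mult_right_mono less_imp_le order_trans)
      then show ?thesis using A(7) by linarith
    qed
    have "packed_inside X Y W H (set xs) (posx (fold (place X Y W w h) xs s)) (posy (fold (place X Y W w h) xs s)) w h"
      if s: "level s = H \<and> side s = q \<and> (\<forall>l<H. sky s l = 0) \<and> sky s H = W" for X Y s
    proof -
      have "0 \<le> \<epsilon> * cw" using A by simp
      \<comment> \<open>Widths are integers, so a sum below \<open>W + 1\<close> fits even though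
        the real width may exceed \<open>W\<close>.\<close>
      then have "real (\<Sum>t<q. w (xs ! t)) < real (W + 1)" using room A(5) by simp
      then have "(\<Sum>t<q. w (xs ! t)) \<le> W" by linarith
      then have f: "filling W H w h xs q s" using mk[OF s q(1)] hH by blast
      note wt = filling.wt_def[OF f] and ht = filling.ht_def[OF f]
      have "filling.valid X Y W H w h xs s ?N"
      proof (rule filling.valid_rows[OF f A(5,6,7)])
        show "real (filling.wt w xs t) \<le> \<epsilon> * cw" if "t < ?N" for t using A(8) that by (simp add: wt)
        show "real (\<Sum>t<q. filling.wt w xs t) + \<epsilon> * cw \<le> (1 + 2 * \<epsilon>) * cw" using room by (simp add: wt)
        fix r assume r: "q < r" "r < ?N" "(1 + 2 * \<epsilon>) * cw < (\<Sum>t<Suc r. real (filling.wt w xs t))"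
        have "cw * (1 + 2 * \<epsilon>) < cw * c (Suc r)" using r(3) csum[of "Suc r"] by (simp add: wt algebra_simps)
        then have "1 + 2 * \<epsilon> < c (Suc r)" using A(3) by simp
        then have "(\<Sum>t<?N. wr t * hr t) \<le> excess q r + hr r * (1 + 2 * \<epsilon>) + (1 + \<epsilon>) * (1 - hr q - hr r)"
          using q(3)[of r] r unfolding overflow_def by simp
        then have "(cw * ch) * (\<Sum>t<?N. wr t * hr t) \<le>
            (cw * ch) * (excess q r + hr r * (1 + 2 * \<epsilon>) + (1 + \<epsilon>) * (1 - hr q - hr r))"
          using A by (intro mult_left_mono) auto
        moreover have "(cw * ch) * (\<Sum>t<?N. wr t * hr t) = (\<Sum>t<?N. real (w (xs ! t)) * real (h (xs ! t)))"
          unfolding sum_distrib_left using A by (intro sum.cong) (auto simp: wr_def hr_def)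
        moreover have "(cw * ch) * excess q r = (\<Sum>t=q..<r. (real (h (xs ! t)) - real (h (xs ! r))) * real (w (xs ! t)))"
          unfolding excess_def sum_distrib_left using A by (intro sum.cong) (auto simp: wr_def hr_def field_simps)
        moreover have "(cw * ch) * (hr r * (1 + 2 * \<epsilon>)) = real (h (xs ! r)) * ((1 + 2 * \<epsilon>) * cw)"
          using A by (simp add: hr_def)
        moreover have "(cw * ch) * ((1 + \<epsilon>) * (1 - hr q - hr r)) =
            ((1 + 2 * \<epsilon>) * cw - \<epsilon> * cw) * (ch - real (h (xs ! q)) - real (h (xs ! r)))"
          using A by (simp add: hr_def field_simps)
        ultimately show "(\<Sum>t<?N. real (filling.wt w xs t) * real (filling.ht h xs t)) \<le>
            (\<Sum>t=q..<r. (real (filling.ht h xs t) - real (filling.ht h xs r)) * real (filling.wt w xs t)) +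
            real (filling.ht h xs r) * ((1 + 2 * \<epsilon>) * cw) +
            ((1 + 2 * \<epsilon>) * cw - \<epsilon> * cw) * (ch - real (filling.ht h xs q) - real (filling.ht h xs r))"
          by (simp add: wt ht distrib_left)
      qed
      then show ?thesis using fin[OF f] by blast
    qed
    with q(1) show ?thesis by blast
  qed
qed

section \<open>From container packings to integral boxes\<close>

lemma sum_disjoint_boxes_le:
  fixes l u :: "nat \<Rightarrow> 'a::euclidean_space"
  assumes fin: "finite D" and disj: "\<And>i j. i \<in> D \<Longrightarrow> j \<in> D \<Longrightarrow> i \<noteq> j \<Longrightarrow> box (l i) (u i) \<inter> box (l j) (u j) = {}"
    and sub: "\<And>i. i \<in> D \<Longrightarrow> box (l i) (u i) \<subseteq> cbox a b"
  shows "(\<Sum>i\<in>D. measure lborel (box (l i) (u i))) \<le> measure lborel (cbox a b)"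
proof -
  have "(\<Sum>i\<in>D. measure lborel (box (l i) (u i))) = measure lborel (\<Union>i\<in>D. box (l i) (u i))"
    using disj by (intro measure_finite_Union[symmetric] fin)
      (auto simp: disjoint_family_on_def emeasure_lborel_box_eq)
  also have "\<dots> \<le> measure lborel (cbox a b)"
    using sub by (intro measure_mono_fmeasurable) (auto intro!: sets.finite_UN fin)
  finally show ?thesis .
qed

lemma sum_disjoint_intervals_le:
  fixes x :: "nat \<Rightarrow> real"
  assumes "finite D" "\<And>i j. i \<in> D \<Longrightarrow> j \<in> D \<Longrightarrow> i \<noteq> j \<Longrightarrow> {x i<..<x i + w i} \<inter> {x j<..<x j + w j} = {}"
    and "\<And>i. i \<in> D \<Longrightarrow> 0 \<le> w i \<and> a \<le> x i \<and> x i + w i \<le> a + L" and "0 \<le> L"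
  shows "(\<Sum>i\<in>D. w i) \<le> L"
proof -
  have "(\<Sum>i\<in>D. measure lborel (box (x i) (x i + w i))) \<le> measure lborel (cbox a (a + L))"
  proof (rule sum_disjoint_boxes_le[OF assms(1)])
    show "box (x i) (x i + w i) \<inter> box (x j) (x j + w j) = {}" if "i \<in> D" "j \<in> D" "i \<noteq> j" for i j
      using assms(2)[OF that] by (simp only: box_real)
    show "box (x i) (x i + w i) \<subseteq> cbox a (a + L)" if "i \<in> D" for i
      using assms(3)[OF that] by (auto simp: box_real)
  qed
  moreover have "measure lborel (box (x i) (x i + w i)) = w i" if "i \<in> D" for i
    using assms(3)[OF that] by (simp add: box_real)
  ultimately show ?thesis using assms(4) by (simp add: box_real)
qed

lemma mem_box_pair: "p \<in> box (a, b) (c, d) \<longleftrightarrow> a < fst p \<and> fst p < c \<and> b < snd p \<and> snd (p :: real \<times> real) < d"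
  and mem_cbox_pair: "p \<in> cbox (a, b) (c, d) \<longleftrightarrow> a \<le> fst p \<and> fst p \<le> c \<and> b \<le> snd p \<and> snd (p :: real \<times> real) \<le> d"
  by (cases p, auto simp: mem_box Basis_prod_def inner_Pair)+

lemma measure_box_pair: "a \<le> c \<Longrightarrow> b \<le> d \<Longrightarrow> measure lborel (box (a, b) (c, d :: real)) = (c - a) * (d - b :: real)"
  and measure_cbox_pair: "a \<le> c \<Longrightarrow> b \<le> d \<Longrightarrow> measure lborel (cbox (a, b) (c, d :: real)) = (c - a) * (d - b :: real)"
proof -
  show 1: "measure lborel (cbox (a, b) (c, d :: real)) = (c - a) * (d - b :: real)" if "a \<le> c" "b \<le> d"
    using that by (simp add: content_Pair box_real)
  show "measure lborel (box (a, b) (c, d :: real)) = (c - a) * (d - b :: real)" if "a \<le> c" "b \<le> d"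
    using that 1 by (simp add: measure_lborel_box_eq measure_lborel_cbox_eq)
qed

lemma disjoint_boxes_separated:
  fixes a b :: real
  assumes "box (a, b) (a + w, b + h) \<inter> box (a', b') (a' + w', b' + h') = {}" "0 < w" "0 < h" "0 < w'" "0 < h'"
  shows "a + w \<le> a' \<or> a' + w' \<le> a \<or> b + h \<le> b' \<or> b' + h' \<le> b"
proof (rule ccontr)
  assume "\<not> ?thesis"
  \<comment> \<open>The centre of the common part lies in the interior of both boxes.\<close>
  then have "((max a a' + min (a + w) (a' + w')) / 2, (max b b' + min (b + h) (b' + h')) / 2)
      \<in> box (a, b) (a + w, b + h) \<inter> box (a', b') (a' + w', b' + h')"
    using assms(2-) unfolding Int_iff mem_box_pair fst_conv snd_conv by (auto simp: max_def min_def field_simps)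
  then show False using assms(1) by blast
qed

definition rect_w :: "rect list \<Rightarrow> bool \<Rightarrow> nat \<Rightarrow> nat" where
  "rect_w rs r i = (if r then snd (rs ! i) else fst (rs ! i))"

definition rect_h :: "rect list \<Rightarrow> bool \<Rightarrow> nat \<Rightarrow> nat" where
  "rect_h rs r i = (if r then fst (rs ! i) else snd (rs ! i))"

text \<open>Because of this notion it suffices to find an assignment of rectangles to boxes that has the
  right totals, which is a subset sum problem.\<close>

definition robust_box :: "nat \<Rightarrow> nat \<Rightarrow> nat \<Rightarrow> nat \<Rightarrow> nat \<Rightarrow> nat \<Rightarrow> nat \<Rightarrow> nat \<Rightarrow> bool" where
  "robust_box W H M1 M2 t S1 S2 S3 \<longleftrightarrow> (\<forall>D w h. finite D \<and>
     (\<forall>i\<in>D. 0 < w i \<and> 0 < h i \<and> w i \<le> M1 \<and> h i \<le> M2) \<and> (\<Sum>i\<in>D. h i * w i) = S1 \<and>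
     (\<Sum>i\<in>D. if t < h i then w i else 0) = S2 \<and> (\<Sum>i\<in>D. h i) = S3 \<longrightarrow> fillable W H D w h)"

lemma nat_le_floorI: "real x \<le> c \<Longrightarrow> x \<le> nat \<lfloor>c\<rfloor>"
  by (simp add: le_nat_floor)

lemma le_nat_floorD: "x \<le> nat \<lfloor>c\<rfloor> \<Longrightarrow> 0 \<le> c \<Longrightarrow> real x \<le> c"
  using of_nat_floor[of c] by linarith

text \<open>Because rounding down is superadditive, corners and sizes can be rounded separately, and
  boxes that were separated along an axis stay so.\<close>

lemma nat_floor_add_le: "0 \<le> x \<Longrightarrow> 0 \<le> y \<Longrightarrow> x + y \<le> z \<Longrightarrow> nat \<lfloor>x\<rfloor> + nat \<lfloor>y\<rfloor> \<le> nat \<lfloor>z\<rfloor>"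
  for x y z :: real
  by (intro nat_le_floorI) (use of_nat_floor[of x] of_nat_floor[of y] in linarith)

lemma less_nat_floor_add_1: "0 \<le> c \<Longrightarrow> c < real (nat \<lfloor>c\<rfloor>) + 1"
  by linarith

text \<open>The threshold depends on the type: 0 turns the second sum into the total width, as a
  vertical container requires, and half the height selects the tall rectangles of an area container.
  A horizontal container uses the third sum. Allowing any part \<open>D\<close> of the contents
  spares an argument that the contents of different containers are disjoint.\<close>

theorem container_robust_box:
  fixes \<epsilon> :: real
  assumes C: "is_container \<epsilon> rs P C" and pack: "is_packing rot (real a) (real b) rs P"
    and eps: "0 < \<epsilon>" and valid: "valid_instance a b rs" and D: "D \<subseteq> contents C"
  defines "w \<equiv> \<lambda>i. rect_w rs (snd (P i)) i" and "h \<equiv> \<lambda>i. rect_h rs (snd (P i)) i"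
  shows "\<exists>t M1 M2. t \<le> nat \<lfloor>cheight C\<rfloor> \<and> M1 \<le> nat \<lfloor>cwidth C\<rfloor> \<and> M2 \<le> nat \<lfloor>cheight C\<rfloor> \<and>
    (\<forall>i\<in>D. w i \<le> M1 \<and> h i \<le> M2) \<and>
    robust_box (nat \<lfloor>(1 + 2 * \<epsilon>) * cwidth C\<rfloor>) (nat \<lfloor>cheight C\<rfloor>) M1 M2 t
      (\<Sum>i\<in>D. h i * w i) (\<Sum>i\<in>D. if t < h i then w i else 0) (\<Sum>i\<in>D. h i)"
proof -
  define cw ch where "cw = cwidth C" and "ch = cheight C"
  obtain cx cy where co: "corner C = (cx, cy)" by (cases "corner C")
  have c: "0 < cw" "0 < ch" "contents C \<subseteq> {..<length rs}" "\<And>i. i \<in> contents C \<Longrightarrow> region rs P i \<subseteq> cregion C"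
    "respects_kind \<epsilon> rs P C (kind C)"
    using C by (auto simp: is_container_def cw_def ch_def)
  have finD: "finite D" by (rule finite_subset[OF subset_trans[OF D c(3)]]) simp
  define x where "x i = fst (fst (P i))" for i
  define y where "y i = snd (fst (P i))" for i
  have dims: "placed_width rs P i = real (w i)" "placed_height rs P i = real (h i)" for i
    by (simp_all add: placed_width_def placed_height_def w_def h_def rect_w_def rect_h_def)
  have reg: "region rs P i = cbox (x i, y i) (x i + real (w i), y i + real (h i))" for i
    unfolding region_def dims x_def y_def by (cases "fst (P i)") simp
  have creg: "cregion C = cbox (cx, cy) (cx + cw, cy + ch)"
    by (simp add: cregion_def co cw_def ch_def)
  have pos: "0 < w i" "0 < h i" if "i \<in> D" for i
  proof -
    have "rs ! i \<in> set rs" using that D c(3) by auto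
    then show "0 < w i" "0 < h i"
      using valid by (auto simp: valid_instance_def w_def h_def rect_w_def rect_h_def)
  qed
  have ins: "cx \<le> x i" "x i + w i \<le> cx + cw" "cy \<le> y i" "y i + h i \<le> cy + ch" if "i \<in> D" for i
  proof -
    have "region rs P i \<subseteq> cregion C" using c(4) D that by blast
    then have "(x i, y i) \<in> cbox (cx, cy) (cx + cw, cy + ch)" "(x i + w i, y i + h i) \<in> cbox (cx, cy) (cx + cw, cy + ch)"
      unfolding reg creg by (rule subsetD, simp add: mem_cbox_pair)+
    then show "cx \<le> x i" "x i + w i \<le> cx + cw" "cy \<le> y i" "y i + h i \<le> cy + ch"
      by (auto simp: mem_cbox_pair)
  qed
  have int: "interior (region rs P i) = box (x i, y i) (x i + real (w i), y i + real (h i))" for i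
    unfolding reg by (simp add: interior_cbox)
  have disj: "box (x i, y i) (x i + real (w i), y i + real (h i)) \<inter> box (x j, y j) (x j + real (w j), y j + real (h j)) = {}"
    if "i \<in> D" "j \<in> D" "i \<noteq> j" for i j
  proof -
    have "i < length rs" "j < length rs" using that D c(3) by auto
    then show ?thesis using pack that(3) unfolding is_packing_def int[symmetric] by blast
  qed
  have wle: "real (w i) \<le> cw" "real (h i) \<le> ch" if "i \<in> D" for i using ins[OF that] by linarith+
  define W where "W = nat \<lfloor>(1 + 2 * \<epsilon>) * cw\<rfloor>"
  define H where "H = nat \<lfloor>ch\<rfloor>"
  have cwW: "cw \<le> (1 + 2 * \<epsilon>) * cw" using c(1) eps by simp
  have "\<exists>t M1 M2. t \<le> H \<and> M1 \<le> nat \<lfloor>cw\<rfloor> \<and> M2 \<le> H \<and> (\<forall>i\<in>D. w i \<le> M1 \<and> h i \<le> M2) \<and>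
    robust_box W H M1 M2 t (\<Sum>i\<in>D. h i * w i) (\<Sum>i\<in>D. if t < h i then w i else 0) (\<Sum>i\<in>D. h i)"
  proof (cases "kind C")
    case Horizontal
    have "(\<Sum>i\<in>D. real (h i)) \<le> ch"
    proof (rule sum_disjoint_intervals_le[OF finD])
      show "{y i<..<y i + real (h i)} \<inter> {y j<..<y j + real (h j)} = {}" if ij: "i \<in> D" "j \<in> D" "i \<noteq> j" for i j
      proof (intro equals0I)
        fix v assume v: "v \<in> {y i<..<y i + real (h i)} \<inter> {y j<..<y j + real (h j)}"
        then have "(x i + w i / 2, v) \<in> interior (region rs P i) \<inter> {p. snd p = v}"
          "(x j + w j / 2, v) \<in> interior (region rs P j) \<inter> {p. snd p = v}"
          unfolding int using pos[OF ij(1)] pos[OF ij(2)] by (auto simp: mem_box_pair)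
        moreover have "i \<in> contents C" "j \<in> contents C" using ij D by auto
        ultimately show False using c(5) ij(3) unfolding Horizontal respects_kind.simps by blast
      qed
      show "0 \<le> real (h i) \<and> cy \<le> y i \<and> y i + real (h i) \<le> cy + ch" if "i \<in> D" for i using ins[OF that] by simp
    qed (use c in simp)
    then have S: "(\<Sum>i\<in>D. h i) \<le> H" unfolding H_def by (intro nat_le_floorI) simp
    have "robust_box W H (nat \<lfloor>cw\<rfloor>) H 0 (\<Sum>i\<in>D. h i * w i) (\<Sum>i\<in>D. if 0 < h i then w i else 0) (\<Sum>i\<in>D. h i)"
      unfolding robust_box_def
    proof (intro allI impI)
      fix D' :: "nat set" and w' h' :: "nat \<Rightarrow> nat"
      assume *: "finite D' \<and> (\<forall>i\<in>D'. 0 < w' i \<and> 0 < h' i \<and> w' i \<le> nat \<lfloor>cw\<rfloor> \<and> h' i \<le> H) \<and>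
        (\<Sum>i\<in>D'. h' i * w' i) = (\<Sum>i\<in>D. h i * w i) \<and>
        (\<Sum>i\<in>D'. if 0 < h' i then w' i else 0) = (\<Sum>i\<in>D. if 0 < h i then w i else 0) \<and> (\<Sum>i\<in>D'. h' i) = (\<Sum>i\<in>D. h i)"
      then have 1: "(\<Sum>i\<in>D'. h' i) \<le> H" using S by metis
      have "nat \<lfloor>cw\<rfloor> \<le> W" unfolding W_def using cwW by (intro nat_mono floor_mono)
      then have 2: "\<forall>i\<in>D'. w' i \<le> W" using * order_trans by blast
      show "fillable W H D' w' h'"
        unfolding fillable_def by (rule disjI2[OF disjI1[OF conjI[OF 1 2]]])
    qed
    moreover have "\<forall>i\<in>D. w i \<le> nat \<lfloor>cw\<rfloor> \<and> h i \<le> H" using wle unfolding H_def by (auto intro: nat_le_floorI)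
    ultimately show ?thesis by blast
  next
    case Vertical
    have "(\<Sum>i\<in>D. real (w i)) \<le> cw"
    proof (rule sum_disjoint_intervals_le[OF finD])
      show "{x i<..<x i + real (w i)} \<inter> {x j<..<x j + real (w j)} = {}" if ij: "i \<in> D" "j \<in> D" "i \<noteq> j" for i j
      proof (intro equals0I)
        fix v assume v: "v \<in> {x i<..<x i + real (w i)} \<inter> {x j<..<x j + real (w j)}"
        then have "(v, y i + h i / 2) \<in> interior (region rs P i) \<inter> {p. fst p = v}"
          "(v, y j + h j / 2) \<in> interior (region rs P j) \<inter> {p. fst p = v}"
          unfolding int using pos[OF ij(1)] pos[OF ij(2)] by (auto simp: mem_box_pair)
        moreover have "i \<in> contents C" "j \<in> contents C" using ij D by auto
        ultimately show False using c(5) ij(3) unfolding Vertical respects_kind.simps by blast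
      qed
      show "0 \<le> real (w i) \<and> cx \<le> x i \<and> x i + real (w i) \<le> cx + cw" if "i \<in> D" for i using ins[OF that] by simp
    qed (use c in simp)
    then have "(\<Sum>i\<in>D. w i) \<le> nat \<lfloor>cw\<rfloor>" by (intro nat_le_floorI) simp
    also have "\<dots> \<le> W" unfolding W_def using cwW by (intro nat_mono floor_mono)
    finally have S: "(\<Sum>i\<in>D. w i) \<le> W" .
    have all: "(\<Sum>i\<in>D. if 0 < h i then w i else 0) = (\<Sum>i\<in>D. w i)" using pos by (intro sum.cong) auto
    have "robust_box W H (nat \<lfloor>cw\<rfloor>) H 0 (\<Sum>i\<in>D. h i * w i) (\<Sum>i\<in>D. if 0 < h i then w i else 0) (\<Sum>i\<in>D. h i)"
      unfolding robust_box_def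
    proof (intro allI impI)
      fix D' :: "nat set" and w' h' :: "nat \<Rightarrow> nat"
      assume *: "finite D' \<and> (\<forall>i\<in>D'. 0 < w' i \<and> 0 < h' i \<and> w' i \<le> nat \<lfloor>cw\<rfloor> \<and> h' i \<le> H) \<and>
        (\<Sum>i\<in>D'. h' i * w' i) = (\<Sum>i\<in>D. h i * w i) \<and>
        (\<Sum>i\<in>D'. if 0 < h' i then w' i else 0) = (\<Sum>i\<in>D. if 0 < h i then w i else 0) \<and> (\<Sum>i\<in>D'. h' i) = (\<Sum>i\<in>D. h i)"
      have "(\<Sum>i\<in>D'. w' i) = (\<Sum>i\<in>D'. if 0 < h' i then w' i else 0)" using * by (intro sum.cong) auto
      also have "\<dots> = (\<Sum>i\<in>D. w i)" using * all by metis
      finally have 1: "(\<Sum>i\<in>D'. w' i) \<le> W" using S by simp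
      have 2: "\<forall>i\<in>D'. h' i \<le> H" using * by blast
      show "fillable W H D' w' h'"
        unfolding fillable_def by (rule disjI1[OF conjI[OF 1 2]])
    qed
    moreover have "\<forall>i\<in>D. w i \<le> nat \<lfloor>cw\<rfloor> \<and> h i \<le> H" using wle unfolding H_def by (auto intro: nat_le_floorI)
    ultimately show ?thesis by blast
  next
    case Area
    \<comment> \<open>The staircase argument is for granularity at most 1. For larger values,
      containment already gives the bounds with 1.\<close>
    define e where "e = min \<epsilon> 1"
    have e: "0 < e" "e \<le> 1" "e \<le> \<epsilon>" using eps by (auto simp: e_def)
    define t where "t = nat \<lfloor>ch / 2\<rfloor>"
    define M1 where "M1 = nat \<lfloor>e * cw\<rfloor>"
    define M2 where "M2 = nat \<lfloor>e * ch\<rfloor>"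
    \<comment> \<open>Heights are integers, so the rounded threshold selects the same rectangles as
      the real one.\<close>
    have tiff: "t < z \<longleftrightarrow> ch / 2 < real z" for z :: nat
      unfolding t_def using c(2) by linarith
    have "(\<Sum>i\<in>D. measure lborel (box (x i, y i) (x i + real (w i), y i + real (h i)))) \<le>
        measure lborel (cbox (cx, cy) (cx + cw, cy + ch))"
    proof (rule sum_disjoint_boxes_le[OF finD disj])
      show "box (x i, y i) (x i + real (w i), y i + real (h i)) \<subseteq> cbox (cx, cy) (cx + cw, cy + ch)" if "i \<in> D" for i
        using ins[OF that] by (auto simp: mem_box_pair mem_cbox_pair)
    qed
    then have area: "(\<Sum>i\<in>D. real (w i) * real (h i)) \<le> cw * ch"
      using c(1,2) by (simp add: measure_box_pair measure_cbox_pair)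
    \<comment> \<open>Rectangles higher than half the container all cross its middle line, hence
      their projections to the x-axis do not overlap.\<close>
    have tall: "(\<Sum>i | i \<in> D \<and> ch / 2 < real (h i). real (w i)) \<le> cw"
    proof (rule sum_disjoint_intervals_le)
      show "{x i<..<x i + real (w i)} \<inter> {x j<..<x j + real (w j)} = {}"
        if ij: "i \<in> {i. i \<in> D \<and> ch / 2 < real (h i)}" "j \<in> {i. i \<in> D \<and> ch / 2 < real (h i)}" "i \<noteq> j" for i j
      proof (intro equals0I)
        fix v assume v: "v \<in> {x i<..<x i + real (w i)} \<inter> {x j<..<x j + real (w j)}"
        have D: "i \<in> D" "j \<in> D" using ij by auto
        have "(v, cy + ch / 2) \<in> box (x i, y i) (x i + real (w i), y i + real (h i)) \<inter>
           box (x j, y j) (x j + real (w j), y j + real (h j))"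
          using v ij ins[OF D(1)] ins[OF D(2)] by (auto simp: mem_box_pair)
        then show False using disj[OF D ij(3)] by blast
      qed
      show "0 \<le> real (w i) \<and> cx \<le> x i \<and> x i + real (w i) \<le> cx + cw" if "i \<in> {i. i \<in> D \<and> ch / 2 < real (h i)}" for i
        using ins[of i] that by simp
    qed (use c finD in auto)
    have bnd: "w i \<le> M1 \<and> h i \<le> M2" if "i \<in> D" for i
    proof -
      have "real (w i) \<le> \<epsilon> * cw" "real (h i) \<le> \<epsilon> * ch"
        using c(5) that D unfolding Area respects_kind.simps dims cw_def ch_def by blast+
      then have "real (w i) \<le> e * cw" "real (h i) \<le> e * ch" using wle[OF that] by (auto simp: e_def min_def)
      then show ?thesis unfolding M1_def M2_def by (auto intro: nat_le_floorI)
    qed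
    have "robust_box W H M1 M2 t (\<Sum>i\<in>D. h i * w i) (\<Sum>i\<in>D. if t < h i then w i else 0) (\<Sum>i\<in>D. h i)"
      unfolding robust_box_def
    proof (intro allI impI)
      fix D' :: "nat set" and w' h' :: "nat \<Rightarrow> nat"
      assume *: "finite D' \<and> (\<forall>i\<in>D'. 0 < w' i \<and> 0 < h' i \<and> w' i \<le> M1 \<and> h' i \<le> M2) \<and>
        (\<Sum>i\<in>D'. h' i * w' i) = (\<Sum>i\<in>D. h i * w i) \<and>
        (\<Sum>i\<in>D'. if t < h' i then w' i else 0) = (\<Sum>i\<in>D. if t < h i then w i else 0) \<and> (\<Sum>i\<in>D'. h' i) = (\<Sum>i\<in>D. h i)"
      have sel: "(\<Sum>i | i \<in> E \<and> ch / 2 < real (g i). real (v i)) = real (\<Sum>i\<in>E. if t < g i then v i else 0)"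
        if "finite E" for E and g v :: "nat \<Rightarrow> nat"
      proof -
        have "(\<Sum>i | i \<in> E \<and> ch / 2 < real (g i). real (v i)) = (\<Sum>i\<in>E. if ch / 2 < real (g i) then real (v i) else 0)"
          using sum.inter_filter[OF that, of "\<lambda>i. real (v i)" "\<lambda>i. ch / 2 < real (g i)"] .
        also have "\<dots> = real (\<Sum>i\<in>E. if t < g i then v i else 0)"
          unfolding of_nat_sum by (intro sum.cong) (auto simp: tiff)
        finally show ?thesis .
      qed
      have "(\<Sum>i | i \<in> D' \<and> ch / 2 < real (h' i). real (w' i)) \<le> cw"
      proof -
        have "(\<Sum>i\<in>D'. if t < h' i then w' i else 0) = (\<Sum>i\<in>D. if t < h i then w i else 0)" "finite D'"
          using * by blast+
        then show ?thesis using tall sel[OF finD] sel by metis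
      qed
      moreover have "(\<Sum>i\<in>D'. real (w' i) * real (h' i)) \<le> cw * ch"
      proof -
        have "(\<Sum>i\<in>D'. real (w' i) * real (h' i)) = real (\<Sum>i\<in>D'. h' i * w' i)" by (simp add: mult.commute)
        also have "(\<Sum>i\<in>D'. h' i * w' i) = (\<Sum>i\<in>D. h i * w i)" using * by blast
        also have "real \<dots> = (\<Sum>i\<in>D. real (w i) * real (h i))" by (simp add: mult.commute)
        finally show ?thesis using area by simp
      qed
      moreover have "real (w' i) \<le> e * cw \<and> real (h' i) \<le> e * ch" if "i \<in> D'" for i
      proof -
        have "w' i \<le> M1" "h' i \<le> M2" using * that by blast+
        then show ?thesis using e c(1,2) unfolding M1_def M2_def by (auto intro!: le_nat_floorD)
      qed
      moreover have "(1 + 2 * e) * cw < real W + 1"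
      proof -
        have "(1 + 2 * e) * cw \<le> (1 + 2 * \<epsilon>) * cw" using e c(1) by (intro mult_right_mono) auto
        also have "\<dots> < real W + 1" unfolding W_def using cwW c(1) by (intro less_nat_floor_add_1) auto
        finally show ?thesis .
      qed
      moreover have "real H \<le> ch" "ch < real H + 1" unfolding H_def using c(2) by (auto intro: less_nat_floor_add_1)
      ultimately have fits: "0 < e \<and> e \<le> 1 \<and> 0 < cw \<and> 0 < ch \<and> (1 + 2 * e) * cw < real W + 1 \<and> real H \<le> ch \<and>
        ch < real H + 1 \<and> (\<forall>i\<in>D'. real (w' i) \<le> e * cw \<and> real (h' i) \<le> e * ch) \<and>
        (\<Sum>i\<in>D'. real (w' i) * real (h' i)) \<le> cw * ch \<and>
        (\<Sum>i | i \<in> D' \<and> ch / 2 < real (h' i). real (w' i)) \<le> cw"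
        using e(1,2) c(1,2) by blast
      show "fillable W H D' w' h'" unfolding fillable_def
        by (rule disjI2, rule disjI2, rule exI[of _ e], rule exI[of _ cw], rule exI[of _ ch], rule fits)
    qed
    moreover have "t \<le> H" unfolding t_def H_def using c(2) by (intro nat_mono floor_mono) simp
    moreover have "M1 \<le> nat \<lfloor>cw\<rfloor>" "M2 \<le> H" unfolding M1_def M2_def H_def using c(1,2) e
      by (auto intro!: nat_mono floor_mono mult_left_le_one_le)
    ultimately show ?thesis using bnd by blast
  qed
  then show ?thesis unfolding W_def H_def cw_def ch_def .
qed

definition box_sums :: "(nat \<Rightarrow> nat) \<Rightarrow> (nat \<Rightarrow> nat) \<Rightarrow> nat \<Rightarrow> nat set \<Rightarrow> nat \<Rightarrow> nat" where
  "box_sums w h t D c = (if c = 0 then \<Sum>i\<in>D. h i * w i else if c = 1 then \<Sum>i\<in>D. if t < h i then w i else 0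
     else \<Sum>i\<in>D. h i)"

theorem container_packing_boxes:
  fixes \<epsilon> :: real
  assumes adm: "admits_container_packing rot \<epsilon> K (real a) (real b) rs" and eps: "0 < \<epsilon>"
    and valid: "valid_instance a b rs"
  obtains K0 bx rt BX BY BW BH BT M1 M2 where
    "K0 \<le> K"
    "\<And>i. i < length rs \<Longrightarrow> bx i < K0 \<and> (rt i \<longrightarrow> rot) \<and> rect_w rs (rt i) i \<le> M1 (bx i) \<and> rect_h rs (rt i) i \<le> M2 (bx i)"
    "\<And>k. k < K0 \<Longrightarrow> BX k + BW k \<le> nat \<lfloor>(1 + 2 * \<epsilon>) * real a\<rfloor> \<and> BY k + BH k \<le> b \<and> BT k \<le> b \<and> M1 k \<le> a \<and> M2 k \<le> b"
    "\<And>k l. k < K0 \<Longrightarrow> l < K0 \<Longrightarrow> k \<noteq> l \<Longrightarrow> BX k + BW k \<le> BX l \<or> BX l + BW l \<le> BX k \<or>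
       BY k + BH k \<le> BY l \<or> BY l + BH l \<le> BY k"
    "\<And>k. k < K0 \<Longrightarrow> robust_box (BW k) (BH k) (M1 k) (M2 k) (BT k)
       (box_sums (\<lambda>i. rect_w rs (rt i) i) (\<lambda>i. rect_h rs (rt i) i) (BT k) {i. i < length rs \<and> bx i = k} 0)
       (box_sums (\<lambda>i. rect_w rs (rt i) i) (\<lambda>i. rect_h rs (rt i) i) (BT k) {i. i < length rs \<and> bx i = k} 1)
       (box_sums (\<lambda>i. rect_w rs (rt i) i) (\<lambda>i. rect_h rs (rt i) i) (BT k) {i. i < length rs \<and> bx i = k} 2)"
proof -
  obtain P Cs where Cs: "length Cs \<le> K" "is_container_packing rot \<epsilon> (real a) (real b) rs P Cs"
    using adm unfolding admits_container_packing_def by blast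
  have pack: "is_packing rot (real a) (real b) rs P" and
    cont: "\<And>k. k < length Cs \<Longrightarrow> is_container \<epsilon> rs P (Cs ! k) \<and> cregion (Cs ! k) \<subseteq> cbox (0, 0) (real a, real b)" and
    disj: "\<And>k l. k < length Cs \<Longrightarrow> l < length Cs \<Longrightarrow> k \<noteq> l \<Longrightarrow>
      interior (cregion (Cs ! k)) \<inter> interior (cregion (Cs ! l)) = {}" and
    cover: "\<And>i. i < length rs \<Longrightarrow> \<exists>k<length Cs. i \<in> contents (Cs ! k)"
    using Cs(2) unfolding is_container_packing_def by (blast, meson nth_mem, blast, metis in_set_conv_nth)
  define bx where "bx i = (SOME k. k < length Cs \<and> i \<in> contents (Cs ! k))" for i
  have bx: "bx i < length Cs \<and> i \<in> contents (Cs ! bx i)" if "i < length rs" for i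
    unfolding bx_def by (rule someI_ex[OF cover[OF that]])
  define D where "D k = {i. i < length rs \<and> bx i = k}" for k
  define w where "w i = rect_w rs (snd (P i)) i" for i
  define h where "h i = rect_h rs (snd (P i)) i" for i
  define cx where "cx k = fst (corner (Cs ! k))" for k
  define cy where "cy k = snd (corner (Cs ! k))" for k
  define cw where "cw k = cwidth (Cs ! k)" for k
  define ch where "ch k = cheight (Cs ! k)" for k
  define Q where "Q k z \<longleftrightarrow> fst z \<le> nat \<lfloor>ch k\<rfloor> \<and> fst (snd z) \<le> nat \<lfloor>cw k\<rfloor> \<and> snd (snd z) \<le> nat \<lfloor>ch k\<rfloor> \<and>
    (\<forall>i\<in>D k. w i \<le> fst (snd z) \<and> h i \<le> snd (snd z)) \<and>
    robust_box (nat \<lfloor>(1 + 2 * \<epsilon>) * cw k\<rfloor>) (nat \<lfloor>ch k\<rfloor>) (fst (snd z)) (snd (snd z)) (fst z)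
      (\<Sum>i\<in>D k. h i * w i) (\<Sum>i\<in>D k. if fst z < h i then w i else 0) (\<Sum>i\<in>D k. h i)" for k z
  have "\<forall>k. k < length Cs \<longrightarrow> (\<exists>z. Q k z)"
  proof (intro allI impI)
    fix k assume k: "k < length Cs"
    have "D k \<subseteq> contents (Cs ! k)" using bx by (auto simp: D_def)
    from container_robust_box[OF conjunct1[OF cont[OF k]] pack eps valid this]
    obtain t M1 M2 where "t \<le> nat \<lfloor>ch k\<rfloor> \<and> M1 \<le> nat \<lfloor>cw k\<rfloor> \<and> M2 \<le> nat \<lfloor>ch k\<rfloor> \<and> (\<forall>i\<in>D k. w i \<le> M1 \<and> h i \<le> M2) \<and>
      robust_box (nat \<lfloor>(1 + 2 * \<epsilon>) * cw k\<rfloor>) (nat \<lfloor>ch k\<rfloor>) M1 M2 t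
      (\<Sum>i\<in>D k. h i * w i) (\<Sum>i\<in>D k. if t < h i then w i else 0) (\<Sum>i\<in>D k. h i)"
      unfolding cw_def ch_def w_def h_def by blast
    then have "Q k (t, M1, M2)" unfolding Q_def fst_conv snd_conv .
    then show "\<exists>z. Q k z" ..
  qed
  then obtain z where "\<And>k. k < length Cs \<Longrightarrow> Q k (z k)" by metis
  note z = this[unfolded Q_def]
  have c: "0 < cw k" "0 < ch k" "0 \<le> cx k" "0 \<le> cy k" "cx k + cw k \<le> a" "cy k + ch k \<le> b" if "k < length Cs" for k
  proof -
    show pos: "0 < cw k" "0 < ch k" using cont[OF that] by (auto simp: is_container_def cw_def ch_def)
    have "cregion (Cs ! k) = cbox (cx k, cy k) (cx k + cw k, cy k + ch k)"
      by (cases "corner (Cs ! k)") (simp add: cregion_def cx_def cy_def cw_def ch_def)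
    then have "cbox (cx k, cy k) (cx k + cw k, cy k + ch k) \<subseteq> cbox (0, 0) (real a, real b)"
      using cont[OF that] by simp
    then have "(cx k, cy k) \<in> cbox (0, 0) (real a, real b)" "(cx k + cw k, cy k + ch k) \<in> cbox (0, 0) (real a, real b)"
      by (rule subsetD, use pos in \<open>simp add: mem_cbox_pair\<close>)+
    then show "0 \<le> cx k" "0 \<le> cy k" "cx k + cw k \<le> a" "cy k + ch k \<le> b" by (auto simp: mem_cbox_pair)
  qed
  define s where "s = 1 + 2 * \<epsilon>"
  have s: "1 < s" using eps by (simp add: s_def)
  show ?thesis
  proof (rule that[of "length Cs" bx "\<lambda>i. snd (P i)" "\<lambda>k. fst (snd (z k))" "\<lambda>k. snd (snd (z k))"
      "\<lambda>k. nat \<lfloor>s * cx k\<rfloor>" "\<lambda>k. nat \<lfloor>s * cw k\<rfloor>" "\<lambda>k. nat \<lfloor>cy k\<rfloor>" "\<lambda>k. nat \<lfloor>ch k\<rfloor>" "\<lambda>k. fst (z k)"])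
    show "length Cs \<le> K" by (rule Cs(1))
    fix i assume i: "i < length rs"
    have "i \<in> D (bx i)" using i by (simp add: D_def)
    then have "w i \<le> fst (snd (z (bx i))) \<and> h i \<le> snd (snd (z (bx i)))" using z[of "bx i"] bx[OF i] by blast
    moreover have "snd (P i) \<longrightarrow> rot" using pack i unfolding is_packing_def by blast
    ultimately show "bx i < length Cs \<and> (snd (P i) \<longrightarrow> rot) \<and> rect_w rs (snd (P i)) i \<le> fst (snd (z (bx i))) \<and>
        rect_h rs (snd (P i)) i \<le> snd (snd (z (bx i)))"
      using bx[OF i] unfolding w_def h_def by blast
  next
    fix k assume k: "k < length Cs"
    have sc: "s * cx k + s * cw k \<le> s * a" using c(5)[OF k] s by (simp add: distrib_left[symmetric])
    have 1: "nat \<lfloor>s * cx k\<rfloor> + nat \<lfloor>s * cw k\<rfloor> \<le> nat \<lfloor>s * a\<rfloor>"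
      using c[OF k] s sc by (intro nat_floor_add_le) auto
    have 2: "nat \<lfloor>cy k\<rfloor> + nat \<lfloor>ch k\<rfloor> \<le> nat \<lfloor>real b\<rfloor>"
      using c[OF k] by (intro nat_floor_add_le) auto
    have 3: "nat \<lfloor>cw k\<rfloor> \<le> nat \<lfloor>real a\<rfloor>" using c[OF k] by (intro nat_mono floor_mono) simp
    show "nat \<lfloor>s * cx k\<rfloor> + nat \<lfloor>s * cw k\<rfloor> \<le> nat \<lfloor>(1 + 2 * \<epsilon>) * real a\<rfloor> \<and> nat \<lfloor>cy k\<rfloor> + nat \<lfloor>ch k\<rfloor> \<le> b \<and>
      fst (z k) \<le> b \<and> fst (snd (z k)) \<le> a \<and> snd (snd (z k)) \<le> b"
      using 1 2 3 z[OF k] unfolding s_def[symmetric] by simp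
    show "robust_box (nat \<lfloor>s * cw k\<rfloor>) (nat \<lfloor>ch k\<rfloor>) (fst (snd (z k))) (snd (snd (z k))) (fst (z k))
       (box_sums (\<lambda>i. rect_w rs (snd (P i)) i) (\<lambda>i. rect_h rs (snd (P i)) i) (fst (z k)) {i. i < length rs \<and> bx i = k} 0)
       (box_sums (\<lambda>i. rect_w rs (snd (P i)) i) (\<lambda>i. rect_h rs (snd (P i)) i) (fst (z k)) {i. i < length rs \<and> bx i = k} 1)
       (box_sums (\<lambda>i. rect_w rs (snd (P i)) i) (\<lambda>i. rect_h rs (snd (P i)) i) (fst (z k)) {i. i < length rs \<and> bx i = k} 2)"
      using z[OF k] unfolding s_def[symmetric] w_def h_def box_sums_def D_def by simp
  next
    fix k l assume kl: "k < length Cs" "l < length Cs" "k \<noteq> l"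
    have cr: "cregion (Cs ! k) = cbox (cx k, cy k) (cx k + cw k, cy k + ch k)" for k
      by (cases "corner (Cs ! k)") (simp add: cregion_def cx_def cy_def cw_def ch_def)
    have "box (cx k, cy k) (cx k + cw k, cy k + ch k) \<inter> box (cx l, cy l) (cx l + cw l, cy l + ch l) = {}"
      using disj[OF kl] unfolding cr interior_cbox .
    from disjoint_boxes_separated[OF this c(1,2)[OF kl(1)] c(1,2)[OF kl(2)]]
    have sep: "cx k + cw k \<le> cx l \<or> cx l + cw l \<le> cx k \<or> cy k + ch k \<le> cy l \<or> cy l + ch l \<le> cy k" .
    have x: "nat \<lfloor>s * cx k\<rfloor> + nat \<lfloor>s * cw k\<rfloor> \<le> nat \<lfloor>s * cx l\<rfloor>" if "cx k + cw k \<le> cx l" "k < length Cs" for k l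
      using c[OF that(2)] that(1) s by (intro nat_floor_add_le) (auto simp: distrib_left[symmetric])
    have y: "nat \<lfloor>cy k\<rfloor> + nat \<lfloor>ch k\<rfloor> \<le> nat \<lfloor>cy l\<rfloor>" if "cy k + ch k \<le> cy l" "k < length Cs" for k l
      using c[OF that(2)] that(1) by (intro nat_floor_add_le) auto
    show "nat \<lfloor>s * cx k\<rfloor> + nat \<lfloor>s * cw k\<rfloor> \<le> nat \<lfloor>s * cx l\<rfloor> \<or> nat \<lfloor>s * cx l\<rfloor> + nat \<lfloor>s * cw l\<rfloor> \<le> nat \<lfloor>s * cx k\<rfloor> \<or>
       nat \<lfloor>cy k\<rfloor> + nat \<lfloor>ch k\<rfloor> \<le> nat \<lfloor>cy l\<rfloor> \<or> nat \<lfloor>cy l\<rfloor> + nat \<lfloor>ch l\<rfloor> \<le> nat \<lfloor>cy k\<rfloor>"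
      using sep x[of k l] x[of l k] y[of k l] y[of l k] kl by blast
  qed
qed

section \<open>The search\<close>

text \<open>This is what reduces \<open>3 * K\<close> prescribed sums to a single prescribed
  total.\<close>

lemma digits_unique:
  fixes f g :: "nat \<Rightarrow> nat"
  assumes "(\<Sum>j<J. f j * B ^ j) = (\<Sum>j<J. g j * B ^ j)" "\<And>j. j < J \<Longrightarrow> f j < B \<and> g j < B" "j < J"
  shows "f j = g j"
  using assms
proof (induction J arbitrary: f g j)
  case (Suc J)
  have split: "(\<Sum>j<Suc J. f j * B ^ j) = f 0 + B * (\<Sum>j<J. f (Suc j) * B ^ j)" for f :: "nat \<Rightarrow> nat"
    unfolding sum.lessThan_Suc_shift by (simp add: sum_distrib_left mult.left_commute)
  have lt: "f 0 < B" "g 0 < B" using Suc.prems(2)[of 0] by auto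
  have eq: "f 0 + B * (\<Sum>j<J. f (Suc j) * B ^ j) = g 0 + B * (\<Sum>j<J. g (Suc j) * B ^ j)"
    using Suc.prems(1) unfolding split .
  then have "(f 0 + B * (\<Sum>j<J. f (Suc j) * B ^ j)) mod B = (g 0 + B * (\<Sum>j<J. g (Suc j) * B ^ j)) mod B" by simp
  then have 0: "f 0 = g 0" using lt by simp
  then have rest: "(\<Sum>j<J. f (Suc j) * B ^ j) = (\<Sum>j<J. g (Suc j) * B ^ j)" using eq lt by simp
  show ?case
  proof (cases j)
    case (Suc j')
    then show ?thesis using Suc.IH[OF rest, of j'] Suc.prems(2,3) by simp
  qed (simp add: 0)
qed simp

lemma digits_less:
  fixes f :: "nat \<Rightarrow> nat"
  assumes "\<And>j. j < J \<Longrightarrow> f j < B"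
  shows "(\<Sum>j<J. f j * B ^ j) < B ^ J"
  using assms
proof (induction J)
  case (Suc J)
  then have "(\<Sum>j<J. f j * B ^ j) < B ^ J" by simp
  moreover have "f J * B ^ J + B ^ J \<le> B ^ Suc J"
    using Suc.prems[of J] mult_le_mono1[of "Suc (f J)" B "B ^ J"] by simp
  ultimately show ?case by simp
qed simp

lemma sum_triple:
  fixes f :: "nat \<Rightarrow> nat"
  shows "(\<Sum>j<3 * K. f j) = (\<Sum>k<K. f (3 * k) + f (3 * k + 1) + f (3 * k + 2))"
  by (induction K) (simp_all add: numeral_3_eq_3)

section \<open>Exhaustive guessing of the contents of cells\<close>

primrec nest :: "(nat \<times> nat) list \<Rightarrow> nat \<Rightarrow> cm \<Rightarrow> cm" where
  "nest [] s c = c"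
| "nest (p # ps) s c = For s limit (Put (fst p) (Num (snd p)) (counter s) ;; nest ps (Suc s) c)"

lemma mods_nest [simp]: "mods (nest ps s c) = fst ` set ps \<union> mods c"
  by (induction ps arbitrary: s) auto

lemma slots_nest [simp]: "slots (nest ps s c) = {s..<s + length ps} \<union> slots c"
  by (induction ps arbitrary: s) auto

lemma wf_nest:
  "wf_cm c \<Longrightarrow> slots c \<inter> {s..<s + length ps} = {} \<Longrightarrow> \<forall>p\<in>set ps. 2 < fst p \<and> fst p < 64 \<Longrightarrow> wf_cm (nest ps s c)"
proof (induction ps arbitrary: s)
  case (Cons p ps)
  have "{Suc s..<Suc s + length ps} \<subseteq> {s..<s + length (p # ps)}" "s \<in> {s..<s + length (p # ps)}" by auto
  then have "slots c \<inter> {Suc s..<Suc s + length ps} = {}" "s \<notin> slots c" using Cons.prems(2) by blast+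
  with Cons.prems(1,3) show ?case by (simp add: Cons.IH)
qed simp

lemma nest_preserves:
  assumes "\<And>\<tau>. I \<tau> \<Longrightarrow> I (sem c \<tau>)"
    and "\<And>\<tau> j s v. j < 2 \<Longrightarrow> I \<tau> \<Longrightarrow> I (upd \<tau> j s v)"
    and "\<And>\<tau> p v. p \<in> set ps \<Longrightarrow> I \<tau> \<Longrightarrow> I (upd \<tau> (fst p) (snd p) v)"
    and "I \<tau>"
  shows "I (sem (nest ps s c) \<tau>)"
  using assms(3,4)
proof (induction ps arbitrary: s \<tau>)
  case (Cons p ps)
  have "(\<lambda>i. I) (min (ev limit \<tau>) (\<tau> 2 0)) (sem (nest (p # ps) s c) \<tau>)"
    unfolding nest.simps
    by (rule For_rule[where I = "\<lambda>i. I"]) (use Cons assms(2) in auto)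
  then show ?case .
qed (use assms(1) in simp)

text \<open>The right combination \<open>val\<close> is tried at some time, and success survives all
  later guesses. The invariant is generalised in the induction because it has to record the values
  chosen by the outer loops.\<close>

lemma nest_success:
  assumes "\<And>\<tau>. I \<tau> \<Longrightarrow> I (sem c \<tau>)" "\<And>\<tau>. I \<tau> \<Longrightarrow> F \<tau> \<Longrightarrow> F (sem c \<tau>)"
    and "\<And>\<tau> j s v. j < 2 \<Longrightarrow> I \<tau> \<Longrightarrow> I (upd \<tau> j s v)" "\<And>\<tau> j s v. j < 2 \<Longrightarrow> F \<tau> \<Longrightarrow> F (upd \<tau> j s v)"
    and "\<And>\<tau> p v. p \<in> set ps \<Longrightarrow> I \<tau> \<Longrightarrow> I (upd \<tau> (fst p) (snd p) v)"
      "\<And>\<tau> p v. p \<in> set ps \<Longrightarrow> F \<tau> \<Longrightarrow> F (upd \<tau> (fst p) (snd p) v)"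
    and "\<And>\<tau>. I \<tau> \<Longrightarrow> (\<And>p. p \<in> set ps \<Longrightarrow> \<tau> (fst p) (snd p) = val p) \<Longrightarrow> F (sem c \<tau>)"
    and "\<And>\<tau>. I \<tau> \<Longrightarrow> \<tau> 2 0 = V" "\<And>p. p \<in> set ps \<Longrightarrow> val p < V" "distinct ps"
    and "\<And>p. p \<in> set ps \<Longrightarrow> 2 < fst p \<and> fst p \<notin> mods c"
    and "I \<tau>"
  shows "F (sem (nest ps s c) \<tau>)"
  using assms(1-3,5-)
proof (induction ps arbitrary: s \<tau> I)
  case (Cons p ps)
  let ?c = "Put (fst p) (Num (snd p)) (counter s) ;; nest ps (Suc s) c"
  have 2: "2 < fst p" "fst p \<notin> mods c" using Cons.prems(10)[of p] by auto
  let ?J = "\<lambda>i \<tau>. I \<tau> \<and> (val p < i \<longrightarrow> F \<tau>)"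
  have "?J V (sem (For s limit ?c) \<tau>)"
  proof (rule For_rule[where I = ?J], goal_cases)
    case 1
    then show ?case using Cons.prems(11) by simp
  next
    case 2
    then show ?case using Cons.prems(7,11) by simp
  next
    case (5 i \<tau>')
    let ?\<tau> = "upd \<tau>' (fst p) (snd p) i"
    have sem: "sem ?c \<tau>' = sem (nest ps (Suc s) c) ?\<tau>" using 5 by simp
    have I: "I ?\<tau>" using 5 Cons.prems(4)[of p] by simp
    have keep: "I (sem (nest ps (Suc s) c) ?\<tau>)"
      by (rule nest_preserves[where I = I]) (use Cons.prems(1,3,4) I in auto)
    have "F (sem (nest ps (Suc s) c) ?\<tau>)" if F: "val p < i"
    proof -
      have "F ?\<tau>" using 5 F Cons.prems(5)[of p] by simp
      have "(\<lambda>\<tau>. I \<tau> \<and> F \<tau>) (sem (nest ps (Suc s) c) ?\<tau>)"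
        by (rule nest_preserves[where I = "\<lambda>\<tau>. I \<tau> \<and> F \<tau>"]) (use Cons.prems(1-5) assms(4) I \<open>F ?\<tau>\<close> in auto)
      then show ?thesis ..
    qed
    moreover have "F (sem (nest ps (Suc s) c) ?\<tau>)" if i: "i = val p"
    proof -
      let ?I = "\<lambda>\<tau>. I \<tau> \<and> \<tau> (fst p) (snd p) = val p"
      show ?thesis
      proof (rule Cons.IH[of ?I])
        show "?I (sem c \<tau>)" if "?I \<tau>" for \<tau> using that Cons.prems(1) 2 by simp
        show "F (sem c \<tau>)" if "?I \<tau>" "F \<tau>" for \<tau> using that Cons.prems(2) by simp
        show "?I (upd \<tau> j s v)" if "j < 2" "?I \<tau>" for \<tau> j s v using that Cons.prems(3) 2 by simp
        show "?I (upd \<tau> (fst q) (snd q) v)" if "q \<in> set ps" "?I \<tau>" for \<tau> q v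
        proof -
          have "q \<noteq> p" using that Cons.prems(9) by auto
          then have "upd \<tau> (fst q) (snd q) v (fst p) (snd p) = \<tau> (fst p) (snd p)"
            by (cases p, cases q) (auto simp: upd_def)
          then show ?thesis using that Cons.prems(4)[of q] by simp
        qed
        show "F (sem c \<tau>)" if "?I \<tau>" "\<And>q. q \<in> set ps \<Longrightarrow> \<tau> (fst q) (snd q) = val q" for \<tau>
          using that by (intro Cons.prems(6)) auto
        show "\<tau> 2 0 = V" if "?I \<tau>" for \<tau> using that Cons.prems(7) by blast
        show "?I ?\<tau>" using I i by simp
      qed (use Cons.prems(5,8-10) in auto)
    qed
    ultimately show ?case using keep unfolding sem by (auto simp: less_Suc_eq)
  qed (use Cons.prems(3) assms(4) in auto)
  then show ?case using Cons.prems(8)[of p] by simp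
qed simp

section \<open>Soundness for every guess\<close>

definition oriented :: "bool \<Rightarrow> store \<Rightarrow> bool" where
  "oriented rot \<tau> \<longleftrightarrow> (\<forall>i < \<tau> n_sc 0. \<tau> Pw_ar i = item_w \<tau> (\<tau> Rot_ar i \<noteq> 0) i \<and>
     \<tau> Ph_ar i = item_h \<tau> (\<tau> Rot_ar i \<noteq> 0) i \<and> (\<tau> Rot_ar i \<noteq> 0 \<longrightarrow> rot))"

definition found :: "bool \<Rightarrow> nat \<Rightarrow> store \<Rightarrow> bool" where
  "found rot A \<tau> \<longleftrightarrow> int_packing (\<tau> n_sc 0) A (\<tau> height_sc 0) (\<tau> Px_ar) (\<tau> Py_ar)
     (\<lambda>i. item_w \<tau> (\<tau> Rot_ar i \<noteq> 0) i) (\<lambda>i. item_h \<tau> (\<tau> Rot_ar i \<noteq> 0) i) \<and>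
     (\<forall>i < \<tau> n_sc 0. \<tau> Rot_ar i \<noteq> 0 \<longrightarrow> rot)"

text \<open>Wrong guesses are covered: the flag is raised only after a check, so it certifies a
  packing whose width is the one tried, which is at most \<open>A\<close>.\<close>

definition sound :: "bool \<Rightarrow> nat \<Rightarrow> store \<Rightarrow> bool" where
  "sound rot A \<tau> \<longleftrightarrow> \<tau> n_sc 0 \<le> \<tau> 2 0 \<and> \<tau> width_sc 0 \<le> A \<and> (\<tau> flag_sc 0 \<noteq> 0 \<longrightarrow> found rot A \<tau>)"

lemma found_upd: "j \<notin> {5, 6, 8, 11, 12, 26, 27} \<Longrightarrow> found rot A (upd \<tau> j i v) = found rot A \<tau>"
  by (simp add: found_def item_w_def item_h_def cong: if_cong)

lemma sound_upd: "j \<notin> {2, 5, 6, 8, 11, 12, 26, 27, 28, 30} \<Longrightarrow> sound rot A (upd \<tau> j i v) = sound rot A \<tau>"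
  by (simp add: sound_def found_upd)

lemma oriented_upd: "j \<notin> {5, 6, 8, 9, 10, 26} \<Longrightarrow> oriented rot (upd \<tau> j i v) = oriented rot \<tau>"
  by (simp add: oriented_def item_w_def item_h_def cong: if_cong)

text \<open>Nothing is touched any more once the flag is up, so the first success is the
  result.\<close>

definition try_layout :: "nat \<Rightarrow> cm" where
  "try_layout K = Test (scalar flag_sc) Nop
     (fill_boxes K ;; check ;; Test (scalar ok_sc) (assign flag_sc (Num 1)) Nop)"

lemma mods_try_layout [simp]: "mods (try_layout K) = {11, 12, 14, 30, 38, 39, 40, 41, 42}"
  and slots_try_layout [simp]: "slots (try_layout K) = {2, 3, 4, 5, 6}"
  and wf_try_layout [simp]: "wf_cm (try_layout K)"
  by (auto simp: try_layout_def)

lemma int_packing_mono: "int_packing n A B x y w h \<Longrightarrow> A \<le> A' \<Longrightarrow> int_packing n A' B x y w h"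
  unfolding int_packing_def by (meson order_trans)

lemma int_packing_cong:
  assumes "\<And>i. i < n \<Longrightarrow> w i = w' i \<and> h i = h' i"
  shows "int_packing n A B x y w h = int_packing n A B x y w' h'"
  using assms unfolding int_packing_def by auto

lemma sem_try_layout:
  fixes K :: nat
  assumes n: "\<tau> n_sc 0 \<le> \<tau> 2 0"
  defines "\<tau>1 \<equiv> sem (fill_boxes K) \<tau>"
  defines "ok \<equiv> int_packing (\<tau> n_sc 0) (\<tau> width_sc 0) (\<tau> height_sc 0) (\<tau>1 Px_ar) (\<tau>1 Py_ar) (\<tau> Pw_ar) (\<tau> Ph_ar)"
  shows "\<tau> flag_sc 0 \<noteq> 0 \<Longrightarrow> sem (try_layout K) \<tau> = \<tau>"
    and "\<tau> flag_sc 0 = 0 \<Longrightarrow> sem (try_layout K) \<tau> flag_sc 0 \<noteq> 0 \<longleftrightarrow> ok"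
    and "\<tau> flag_sc 0 = 0 \<Longrightarrow> sem (try_layout K) \<tau> Px_ar = \<tau>1 Px_ar \<and> sem (try_layout K) \<tau> Py_ar = \<tau>1 Py_ar"
proof -
  show "sem (try_layout K) \<tau> = \<tau>" if "\<tau> flag_sc 0 \<noteq> 0" using that by (simp add: try_layout_def)
  have "sem check \<tau>1 ok_sc 0 \<noteq> 0 \<longleftrightarrow> ok"
    using sem_check[of \<tau>1] n by (simp add: ok_def \<tau>1_def)
  then show "sem (try_layout K) \<tau> flag_sc 0 \<noteq> 0 \<longleftrightarrow> ok" if "\<tau> flag_sc 0 = 0"
    using that by (simp add: try_layout_def \<tau>1_def[symmetric]) (simp add: \<tau>1_def)
  show "sem (try_layout K) \<tau> Px_ar = \<tau>1 Px_ar \<and> sem (try_layout K) \<tau> Py_ar = \<tau>1 Py_ar" if "\<tau> flag_sc 0 = 0"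
    using that by (simp add: try_layout_def \<tau>1_def)
qed

lemma try_layout_sound:
  assumes "sound rot A \<tau>" "oriented rot \<tau>"
  shows "sound rot A (sem (try_layout K) \<tau>) \<and> oriented rot (sem (try_layout K) \<tau>)"
proof -
  let ?\<tau> = "sem (try_layout K) \<tau>"
  have o: "?\<tau> j = \<tau> j" if "j \<in> {2, 5, 6, 8, 9, 10, 26, 27, 28}" for j using that by auto
  have or: "oriented rot ?\<tau>" using assms(2) by (simp add: oriented_def item_w_def item_h_def o)
  moreover have "sound rot A ?\<tau>"
  proof (cases "\<tau> flag_sc 0 = 0")
    case False
    then show ?thesis using sem_try_layout(1)[of \<tau> K] assms(1) by (simp add: sound_def)
  next
    case True
    have n: "\<tau> n_sc 0 \<le> \<tau> 2 0" using assms(1) by (simp add: sound_def)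
    have "found rot A ?\<tau>" if "?\<tau> flag_sc 0 \<noteq> 0"
    proof -
      have "int_packing (\<tau> n_sc 0) (\<tau> width_sc 0) (\<tau> height_sc 0) (?\<tau> Px_ar) (?\<tau> Py_ar) (\<tau> Pw_ar) (\<tau> Ph_ar)"
        using that sem_try_layout(2,3)[of \<tau> K, OF n True] by simp
      moreover have "\<tau> width_sc 0 \<le> A" using assms(1) by (simp add: sound_def)
      ultimately have "int_packing (\<tau> n_sc 0) A (\<tau> height_sc 0) (?\<tau> Px_ar) (?\<tau> Py_ar) (\<tau> Pw_ar) (\<tau> Ph_ar)"
        by (rule int_packing_mono)
      also have "int_packing (\<tau> n_sc 0) A (\<tau> height_sc 0) (?\<tau> Px_ar) (?\<tau> Py_ar) (\<tau> Pw_ar) (\<tau> Ph_ar) =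
         int_packing (\<tau> n_sc 0) A (\<tau> height_sc 0) (?\<tau> Px_ar) (?\<tau> Py_ar)
          (\<lambda>i. item_w ?\<tau> (?\<tau> Rot_ar i \<noteq> 0) i) (\<lambda>i. item_h ?\<tau> (?\<tau> Rot_ar i \<noteq> 0) i)"
        using or by (intro int_packing_cong) (simp add: oriented_def o)
      finally show ?thesis using or by (simp add: found_def oriented_def o)
    qed
    then show ?thesis using assms(1) by (simp add: sound_def o)
  qed
  ultimately show ?thesis by blast
qed

text \<open>\<open>Side_ar\<close> is guessed only after the trace, since the suitable numbers
  depend on the assignment that has been found.\<close>

definition try_params :: "nat \<Rightarrow> bool \<Rightarrow> nat \<Rightarrow> cm" where
  "try_params K rot s = Test (scalar flag_sc) Nop
     (fill_table K rot ;; trace K rot ;; orient rot ;; nest (map (\<lambda>k. (Side_ar, k)) [0..<K]) s (try_layout K))"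

lemma mods_try_params: "mods (try_params K rot s) \<subseteq> {7, 8, 9, 10, 11, 12, 13, 14, 22} \<union> {30..42}"
  using mods_orient[of rot] by (auto simp: try_params_def)

lemma slots_try_params: "slots (try_params K rot s) = {2, 3, 4, 5, 6} \<union> {s..<s + K}"
  and wf_try_params: "6 < s \<Longrightarrow> wf_cm (try_params K rot s)"
  by (auto simp: try_params_def intro!: wf_nest)

lemma try_params_other: "1 < j \<Longrightarrow> j \<notin> {7, 8, 9, 10, 11, 12, 13, 14, 22} \<union> {30..42} \<Longrightarrow>
    sem (try_params K rot s) \<tau> j = \<tau> j"
  using mods_try_params[of K rot s] by (intro sem_unmodified) blast+

lemma try_params_found: "\<tau> flag_sc 0 \<noteq> 0 \<Longrightarrow> sem (try_params K rot s) \<tau> = \<tau>"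
  by (simp add: try_params_def)

lemma oriented_orient:
  assumes "\<tau> n_sc 0 \<le> \<tau> 2 0"
  shows "oriented rot (sem (orient rot) \<tau>)"
  using sem_orient[of \<tau> "sem (orient rot) \<tau>" rot] assms by (auto simp: oriented_def item_w_def item_h_def)

lemma try_params_sound:
  assumes "sound rot A \<tau>"
  shows "sound rot A (sem (try_params K rot s) \<tau>)"
proof (cases "\<tau> flag_sc 0 = 0")
  case False
  then show ?thesis using assms by (simp add: try_params_found)
next
  case True
  let ?\<tau> = "sem (orient rot) (sem (trace K rot) (sem (fill_table K rot) \<tau>))"
  have "sound rot A ?\<tau>" "oriented rot ?\<tau>"
    using assms True by (auto simp: sound_def intro!: oriented_orient)
  then have "(\<lambda>\<tau>. sound rot A \<tau> \<and> oriented rot \<tau>)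
      (sem (nest (map (\<lambda>k. (Side_ar, k)) [0..<K]) s (try_layout K)) ?\<tau>)"
    by (intro nest_preserves[where I = "\<lambda>\<tau>. sound rot A \<tau> \<and> oriented rot \<tau>"] conjI)
      (auto simp: sound_upd oriented_upd try_layout_sound)
  then show ?thesis using True by (simp add: try_params_def)
qed

text \<open>The powers of the base that serve as coefficients are guessed like all other numbers
  instead of being computed. They are below the truncation number, so the loops reach them.\<close>

definition params :: "nat \<Rightarrow> (nat \<times> nat) list" where
  "params K = (target_sc, 0) # concat (map (\<lambda>k. map (\<lambda>j. (j, k)) [15, 16, 17, 18, 19, 20, 21, 23, 24, 25]) [0..<K])"

lemma set_params: "set (params K) = insert (target_sc, 0) ({15, 16, 17, 18, 19, 20, 21, 23, 24, 25} \<times> {..<K})"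
  by (auto simp: params_def)

lemma distinct_params: "distinct (params K)"
proof -
  have "distinct (concat (map (\<lambda>k. map (\<lambda>j. (j, k)) [15::nat, 16, 17, 18, 19, 20, 21, 23, 24, 25]) [0..<K]))"
    by (induction K) auto
  then show ?thesis by (auto simp: params_def)
qed

text \<open>The inner programs use slots 2 to 6 and the widths slot 7; from 8 on, every guessed cell
  gets a slot of its own.\<close>

definition search :: "nat \<Rightarrow> bool \<Rightarrow> cm" where
  "search K rot =
     assign flag_sc (Num 0) ;;
     For 7 limit (assign width_sc (counter 7) ;;
       nest (params K) 8 (try_params K rot (8 + length (params K))))"

lemma wf_search: "wf_cm (search K rot)"
  unfolding search_def by (auto simp: slots_try_params set_params intro!: wf_nest wf_try_params)

lemma search_other: "sem (search K rot) \<tau> j = \<tau> j" if "j \<in> {2, 5, 6, 26, 27}"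
proof -
  have "mods (try_params K rot s) \<inter> {2, 5, 6, 26, 27} = {}" for s
    using mods_try_params[of K rot s] by fastforce
  then have "j \<notin> mods (search K rot)" using that by (auto simp: search_def set_params)
  then show ?thesis using that by (intro sem_unmodified) auto
qed

lemma box_sums_bound:
  assumes "finite D" "card D \<le> n" "\<And>i. i \<in> D \<Longrightarrow> w i \<le> M \<and> h i \<le> M" "0 < M"
  shows "box_sums w h t D c \<le> n * (M * M)"
proof -
  have le: "(\<Sum>i\<in>D. f i) \<le> n * (M * M)" if "\<And>i. i \<in> D \<Longrightarrow> f i \<le> M * M" for f :: "nat \<Rightarrow> nat"
  proof -
    have "(\<Sum>i\<in>D. f i) \<le> card D * (M * M)" using sum_bounded_above[of D f "M * M"] that by simp
    also have "\<dots> \<le> n * (M * M)" using assms(2) by simp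
    finally show ?thesis .
  qed
  have MM: "M \<le> M * M" using assms(4) by simp
  have b: "w i \<le> M * M" "h i \<le> M * M" "h i * w i \<le> M * M" if "i \<in> D" for i
    using assms(3)[OF that] MM by (auto intro: mult_le_mono order_trans)
  show ?thesis unfolding box_sums_def by (auto intro!: le simp: b)
qed

section \<open>Success of the right guess\<close>

locale solvable =
  fixes rs :: "rect list" and rot :: bool and K a b A K0 V :: nat and bx :: "nat \<Rightarrow> nat" and rt :: "nat \<Rightarrow> bool"
    and BX BY BW BH BT M1 M2 :: "nat \<Rightarrow> nat"
  assumes valid: "valid_instance a b rs"
    and K0: "K0 \<le> K"
    and items: "\<And>i. i < length rs \<Longrightarrow> bx i < K0 \<and> (rt i \<longrightarrow> rot) \<and> rect_w rs (rt i) i \<le> M1 (bx i) \<and> rect_h rs (rt i) i \<le> M2 (bx i)"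
    and bounds: "\<And>k. k < K0 \<Longrightarrow> BX k + BW k \<le> A \<and> BY k + BH k \<le> b \<and> BT k \<le> b \<and> M1 k \<le> a \<and> M2 k \<le> b"
    and sep: "\<And>k l. k < K0 \<Longrightarrow> l < K0 \<Longrightarrow> k \<noteq> l \<Longrightarrow> BX k + BW k \<le> BX l \<or> BX l + BW l \<le> BX k \<or>
       BY k + BH k \<le> BY l \<or> BY l + BH l \<le> BY k"
    and robust: "\<And>k. k < K0 \<Longrightarrow> robust_box (BW k) (BH k) (M1 k) (M2 k) (BT k)
       (box_sums (\<lambda>i. rect_w rs (rt i) i) (\<lambda>i. rect_h rs (rt i) i) (BT k) {i. i < length rs \<and> bx i = k} 0)
       (box_sums (\<lambda>i. rect_w rs (rt i) i) (\<lambda>i. rect_h rs (rt i) i) (BT k) {i. i < length rs \<and> bx i = k} 1)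
       (box_sums (\<lambda>i. rect_w rs (rt i) i) (\<lambda>i. rect_h rs (rt i) i) (BT k) {i. i < length rs \<and> bx i = k} 2)"
    and V: "length rs < V" "K \<le> V" "A < V" "a < V" "b < V" "(a + b) * (a + b) \<le> V"
      "(length rs * ((a + b) * (a + b)) + 1) ^ (3 * K) < V"
begin

abbreviation n :: nat where "n \<equiv> length rs"

text \<open>One more than a bound on all sums, so that no digit ever carries.\<close>

definition B :: nat where "B = n * ((a + b) * (a + b)) + 1"

text \<open>If the packing has fewer than \<open>K\<close> containers, the spare boxes get the size
  bounds 0. As rectangles have positive sizes, none is allowed in them.\<close>

definition ext :: "(nat \<Rightarrow> nat) \<Rightarrow> nat \<Rightarrow> nat" where "ext f k = (if k < K0 then f k else 0)"

definition digit :: "(nat \<Rightarrow> nat) \<Rightarrow> (nat \<Rightarrow> bool) \<Rightarrow> nat \<Rightarrow> nat" where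
  "digit b' r' j = box_sums (\<lambda>i. rect_w rs (r' i) i) (\<lambda>i. rect_h rs (r' i) i) (ext BT (j div 3))
     {i. i < n \<and> b' i = j div 3} (j mod 3)"

definition total :: "(nat \<Rightarrow> nat) \<Rightarrow> (nat \<Rightarrow> bool) \<Rightarrow> nat" where
  "total b' r' = (\<Sum>j<3 * K. digit b' r' j * B ^ j)"

definition val :: "nat \<times> nat \<Rightarrow> nat" where
  "val p = (let k = snd p in
     if fst p = 15 then ext BX k else if fst p = 16 then ext BY k else if fst p = 17 then ext BW k else
     if fst p = 18 then ext BH k else if fst p = 19 then ext BT k else if fst p = 20 then ext M1 k else
     if fst p = 21 then ext M2 k else if fst p = 23 then B ^ (3 * k) else if fst p = 24 then B ^ (3 * k + 1) else
     if fst p = 25 then B ^ (3 * k + 2) else total bx rt)"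

definition input :: "store \<Rightarrow> bool" where
  "input \<tau> \<longleftrightarrow> \<tau> n_sc 0 = n \<and> \<tau> height_sc 0 = b \<and> \<tau> 2 0 = V \<and>
     (\<forall>i<n. \<tau> W_ar i = fst (rs ! i) \<and> \<tau> H_ar i = snd (rs ! i))"

lemma item_rect:
  assumes "input \<tau>" "i < n"
  shows "item_w \<tau> r i = rect_w rs r i" "item_h \<tau> r i = rect_h rs r i"
  using assms by (auto simp: input_def item_w_def item_h_def rect_w_def rect_h_def)

lemma ab_pos: "0 < a" "0 < b"
  using valid by (auto simp: valid_instance_def)

lemma rect_bounds:
  assumes "i < n"
  shows "0 < rect_w rs r i" "0 < rect_h rs r i" "rect_w rs r i \<le> a + b" "rect_h rs r i \<le> a + b"
proof -
  have "rs ! i \<in> set rs" using assms by simp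
  then show "0 < rect_w rs r i" "0 < rect_h rs r i"
    using valid by (auto simp: valid_instance_def rect_w_def rect_h_def)
  have "rect_w rs (rt i) i \<le> a" "rect_h rs (rt i) i \<le> b"
    using items[OF assms] bounds[of "bx i"] by linarith+
  then show "rect_w rs r i \<le> a + b" "rect_h rs r i \<le> a + b"
    by (auto simp: rect_w_def rect_h_def split: if_splits)
qed

lemma digit_less: "digit b' r' j < B"
proof -
  have "card {i. i < n \<and> b' i = j div 3} \<le> card {..<n}" by (intro card_mono) auto
  then have "digit b' r' j \<le> n * ((a + b) * (a + b))"
    unfolding digit_def using rect_bounds ab_pos by (intro box_sums_bound) auto
  then show ?thesis by (simp add: B_def)
qed

lemma total_less: "total b' r' < V"
proof -
  have "total b' r' < B ^ (3 * K)" unfolding total_def by (rule digits_less) (rule digit_less)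
  then show ?thesis using V(7) by (simp add: B_def)
qed

lemma val_less:
  assumes "p \<in> set (params K)"
  shows "val p < V"
proof -
  have e: "ext BX k < V" "ext BY k < V" "ext BW k < V" "ext BH k < V" "ext BT k < V" "ext M1 k < V" "ext M2 k < V" for k
    using bounds[of k] V(3,4,5) by (auto simp: ext_def)
  have pw: "B ^ x < V" if "x \<le> 3 * K" for x
    using power_increasing[OF that, of B] V(7) by (simp add: B_def)
  have "snd p < K \<or> fst p = target_sc" using assms by (auto simp: set_params)
  then have "fst p = target_sc \<or> B ^ (3 * snd p) < V \<and> B ^ (3 * snd p + 1) < V \<and> B ^ (3 * snd p + 2) < V"
    using pw[of "3 * snd p"] pw[of "3 * snd p + 1"] pw[of "3 * snd p + 2"] by linarith
  then show ?thesis unfolding val_def Let_def using e total_less by (simp only: split: if_split) auto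
qed

definition guessed :: "store \<Rightarrow> bool" where
  "guessed \<tau> \<longleftrightarrow> (\<forall>p \<in> set (params K). \<tau> (fst p) (snd p) = val p)"

lemma guessedD:
  assumes "guessed \<tau>"
  shows "\<tau> target_sc 0 = total bx rt"
    and "k < K \<Longrightarrow> \<tau> BoxX_ar k = ext BX k \<and> \<tau> BoxY_ar k = ext BY k \<and> \<tau> BoxW_ar k = ext BW k \<and> \<tau> BoxH_ar k = ext BH k \<and>
      \<tau> Tall_ar k = ext BT k \<and> \<tau> MaxW_ar k = ext M1 k \<and> \<tau> MaxH_ar k = ext M2 k \<and>
      \<tau> AreaC_ar k = B ^ (3 * k) \<and> \<tau> TallC_ar k = B ^ (3 * k + 1) \<and> \<tau> HeightC_ar k = B ^ (3 * k + 2)"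
  using assms unfolding guessed_def set_params by (auto simp: val_def Let_def)

text \<open>This holds for every assignment to the \<open>K\<close> boxes, so the given one and the
  one traced back can be compared through their totals.\<close>

lemma sum_weight:
  assumes inp: "input \<tau>" and g: "guessed \<tau>" and k: "\<And>i. i < n \<Longrightarrow> b' i < K"
  shows "(\<Sum>i<n. weight \<tau> (b' i) (r' i) i) = total b' r'"
proof -
  let ?w = "\<lambda>i. rect_w rs (r' i) i" and ?h = "\<lambda>i. rect_h rs (r' i) i"
  let ?D = "\<lambda>k. {i \<in> {..<n}. b' i = k}"
  let ?s = "\<lambda>k. box_sums ?w ?h (ext BT k) (?D k)"
  have D: "{i. i < n \<and> b' i = k} = ?D k" for k by auto
  have "(\<Sum>i<n. weight \<tau> (b' i) (r' i) i) = (\<Sum>k<K. \<Sum>i\<in>?D k. weight \<tau> (b' i) (r' i) i)"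
    using k by (intro sum.group[symmetric]) auto
  also have "\<dots> = (\<Sum>k<K. ?s k 0 * B ^ (3 * k) + ?s k 1 * B ^ (3 * k + 1) + ?s k 2 * B ^ (3 * k + 2))"
  proof (intro sum.cong refl)
    fix k assume "k \<in> {..<K}"
    then have k: "k < K" by simp
    note gk = guessedD(2)[OF g k]
    have "(\<Sum>i\<in>?D k. weight \<tau> (b' i) (r' i) i) = (\<Sum>i\<in>?D k. ?h i * ?w i * B ^ (3 * k) +
       (if ext BT k < ?h i then ?w i else 0) * B ^ (3 * k + 1) + ?h i * B ^ (3 * k + 2))"
      using gk by (intro sum.cong refl) (auto simp: weight_def item_rect[OF inp])
    then show "(\<Sum>i\<in>?D k. weight \<tau> (b' i) (r' i) i) = ?s k 0 * B ^ (3 * k) + ?s k 1 * B ^ (3 * k + 1) + ?s k 2 * B ^ (3 * k + 2)"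
      by (simp only: sum.distrib sum_distrib_right[symmetric]) (simp add: box_sums_def)
  qed
  also have "\<dots> = total b' r'"
  proof -
    have dm: "(3 * k) div 3 = k" "(3 * k + 1) div 3 = k" "(3 * k + 2) div 3 = k"
      "(3 * k) mod 3 = 0" "(3 * k + 1) mod 3 = 1" "(3 * k + 2) mod 3 = 2" for k :: nat
      by presburger+
    show ?thesis by (simp only: total_def sum_triple digit_def D dm)
  qed
  finally show ?thesis .
qed

end

lemma reach_same: "same_on input_ids \<tau> \<sigma> \<Longrightarrow> reach \<tau> K R i g = reach \<sigma> K R i g"
  by (induction i arbitrary: g) (simp_all add: same_on_inputs)

lemma row_ok_same: "same_on input_ids \<tau> \<sigma> \<Longrightarrow> row_ok \<tau> K R i T = row_ok \<sigma> K R i T"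
  unfolding row_ok_def by (simp only: same_on_inputs reach_same)

context solvable
begin

text \<open>The given assignment \<open>bx\<close>, \<open>rt\<close> shows that the target is
  reachable. The one traced back has the same total, hence the same digits, that is, the same three
  sums in every box.\<close>

lemma assignment_found:
  assumes inp: "input \<tau>" and g: "guessed \<tau>"
    and \<tau>2: "\<tau>2 = sem (trace K rot) (sem (fill_table K rot) \<tau>)" and i: "i < n"
  shows "\<tau>2 Box_ar i < K0" "\<tau>2 Rot_ar i \<noteq> 0 \<longrightarrow> rot"
    "rect_w rs (\<tau>2 Rot_ar i \<noteq> 0) i \<le> M1 (\<tau>2 Box_ar i)" "rect_h rs (\<tau>2 Rot_ar i \<noteq> 0) i \<le> M2 (\<tau>2 Box_ar i)"
    "j < 3 * K \<Longrightarrow> digit (\<tau>2 Box_ar) (\<lambda>i. \<tau>2 Rot_ar i \<noteq> 0) j = digit bx rt j"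
proof -
  let ?R = "rotations rot"
  have V2: "\<tau> 2 0 = V" "\<tau> n_sc 0 = n" using inp by (auto simp: input_def)
  have small: "small_items \<tau>"
  proof -
    have "a + b \<le> (a + b) * (a + b)" using ab_pos by simp
    then have "a + b \<le> V" using V(6) by linarith
    then have "rect_w rs r i \<le> V" "rect_h rs r i \<le> V" if "i < n" for r i
      using rect_bounds(3,4)[OF that, of r] by linarith+
    moreover have "rect_h rs r i * rect_w rs r i \<le> V" if "i < n" for r i
      using mult_le_mono[OF rect_bounds(4)[OF that] rect_bounds(3)[OF that]] V(6) le_trans by blast
    ultimately show ?thesis unfolding small_items_def V2
      by (auto simp: item_rect[OF inp])
  qed
  have all: "bx i < K \<and> rt i \<in> ?R \<and> allowed \<tau> (bx i) (rt i) i" if "i < n" for i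
    using items[OF that] K0 guessedD(2)[OF g, of "bx i"]
    by (auto simp: rotations_def allowed_def item_rect[OF inp that] ext_def)
  have tot: "(\<Sum>i<n. weight \<tau> (bx i) (rt i) i) = total bx rt" using all by (intro sum_weight[OF inp g]) blast
  have reach: "reach \<tau> K ?R n (total bx rt)" unfolding tot[symmetric] using all by (rule reach_sum)
  define \<tau>1 where "\<tau>1 = sem (fill_table K rot) \<tau>"
  have nV: "\<tau> n_sc 0 \<le> \<tau> 2 0" "K \<le> \<tau> 2 0" unfolding V2 using V(1,2) by auto
  have same: "same_on input_ids \<tau>1 \<tau>" unfolding \<tau>1_def by (auto simp: same_on_def)
  note eqs = same_on_inputs[OF same]
  have ft: "\<forall>i \<le> \<tau> n_sc 0. row_ok \<tau> K ?R i (\<tau>1 Tab_ar)" "\<tau>1 base_sc 0 = \<tau> n_sc 0 * \<tau> 2 0"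
    using sem_fill_table[OF small nV, of rot] unfolding \<tau>1_def by blast+
  have rows: "\<forall>i \<le> \<tau>1 n_sc 0. row_ok \<tau>1 K ?R i (\<tau>1 Tab_ar)"
    using ft(1) unfolding row_ok_same[OF same] eqs .
  have base: "\<tau>1 base_sc 0 = \<tau>1 n_sc 0 * \<tau>1 2 0"
    using ft(2) unfolding eqs .
  have tgt: "\<tau>1 target_sc 0 = total bx rt" using guessedD(1)[OF g] by (simp add: \<tau>1_def)
  have small1: "small_items \<tau>1" using small by (simp only: eqs)
  have nV1: "\<tau>1 n_sc 0 \<le> \<tau>1 2 0" "K \<le> \<tau>1 2 0" "\<tau>1 target_sc 0 < \<tau>1 2 0"
    unfolding eqs tgt using nV total_less V2 by auto
  have reach1: "reach \<tau>1 K ?R (\<tau>1 n_sc 0) (\<tau>1 target_sc 0)"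
    using reach unfolding reach_same[OF same] eqs tgt V2 .
  have tr: "\<tau>2 = sem (trace K rot) \<tau>1" using \<tau>2 by (simp add: \<tau>1_def)
  note res = sem_trace[OF small1 nV1(1,2) rows base nV1(3) reach1 tr]
  have al: "\<tau>2 Box_ar i < K \<and> (\<tau>2 Rot_ar i \<noteq> 0) \<in> ?R \<and> allowed \<tau> (\<tau>2 Box_ar i) (\<tau>2 Rot_ar i \<noteq> 0) i" if "i < n" for i
    using res(1) that unfolding eqs V2 by blast
  have al': "\<tau>2 Box_ar i < K0 \<and> rect_w rs (\<tau>2 Rot_ar i \<noteq> 0) i \<le> M1 (\<tau>2 Box_ar i) \<and>
     rect_h rs (\<tau>2 Rot_ar i \<noteq> 0) i \<le> M2 (\<tau>2 Box_ar i)" if "i < n" for i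
    using al[OF that] guessedD(2)[OF g, of "\<tau>2 Box_ar i"] rect_bounds(1)[OF that, of "\<tau>2 Rot_ar i \<noteq> 0"]
    unfolding allowed_def item_rect[OF inp that] ext_def by (auto split: if_splits)
  show "\<tau>2 Box_ar i < K0" "rect_w rs (\<tau>2 Rot_ar i \<noteq> 0) i \<le> M1 (\<tau>2 Box_ar i)"
    "rect_h rs (\<tau>2 Rot_ar i \<noteq> 0) i \<le> M2 (\<tau>2 Box_ar i)" using al'[OF i] by blast+
  show "\<tau>2 Rot_ar i \<noteq> 0 \<longrightarrow> rot" using al[OF i] by (auto simp: rotations_def split: if_splits)
  have "(\<Sum>i<n. weight \<tau> (\<tau>2 Box_ar i) (\<tau>2 Rot_ar i \<noteq> 0) i) = total bx rt"
    using res(2) unfolding eqs tgt V2 .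
  moreover have "(\<Sum>i<n. weight \<tau> (\<tau>2 Box_ar i) (\<tau>2 Rot_ar i \<noteq> 0) i) = total (\<tau>2 Box_ar) (\<lambda>i. \<tau>2 Rot_ar i \<noteq> 0)"
    using al by (intro sum_weight[OF inp g]) blast
  ultimately have "total (\<tau>2 Box_ar) (\<lambda>i. \<tau>2 Rot_ar i \<noteq> 0) = total bx rt" by simp
  then show "digit (\<tau>2 Box_ar) (\<lambda>i. \<tau>2 Rot_ar i \<noteq> 0) j = digit bx rt j" if "j < 3 * K"
    unfolding total_def by (rule digits_unique) (use digit_less that in blast)+
qed

end

context solvable
begin

definition good_side :: "store \<Rightarrow> nat \<Rightarrow> nat \<Rightarrow> bool" where
  "good_side \<tau> k q \<longleftrightarrow> q \<le> n \<and> (\<forall>X Y s. level s = ext BH k \<and> side s = q \<and> (\<forall>l<ext BH k. sky s l = 0) \<and> sky s (ext BH k) = ext BW k \<longrightarrow>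
    (let s' = fold (place X Y (ext BW k) (\<tau> Pw_ar) (\<tau> Ph_ar)) (fill_order n V (\<lambda>i. \<tau> Box_ar i = k) (\<tau> Ph_ar) V) s
     in packed_inside X Y (ext BW k) (ext BH k) {i. i < n \<and> \<tau> Box_ar i = k} (posx s') (posy s') (\<tau> Pw_ar) (\<tau> Ph_ar)))"

lemma ext_bounds: "k < K \<Longrightarrow> ext BH k < V" "ext BX k + ext BW k \<le> A" "ext BY k + ext BH k \<le> b"
  using bounds[of k] V(5) by (auto simp: ext_def)

text \<open>\<open>robust_box\<close> was established for the sums of the given packing; it applies
  to the traced assignment, whose sums and size bounds agree with it.\<close>

lemma good_side_exists:
  assumes dims: "\<And>i. i < n \<Longrightarrow> \<tau> Pw_ar i = rect_w rs (r i) i \<and> \<tau> Ph_ar i = rect_h rs (r i) i"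
    and al: "\<And>i. i < n \<Longrightarrow> \<tau> Box_ar i < K0 \<and> \<tau> Pw_ar i \<le> M1 (\<tau> Box_ar i) \<and> \<tau> Ph_ar i \<le> M2 (\<tau> Box_ar i)"
    and dig: "\<And>j. j < 3 * K \<Longrightarrow> digit (\<tau> Box_ar) r j = digit bx rt j"
    and k: "k < K"
  shows "\<exists>q. good_side \<tau> k q"
proof -
  let ?D = "{i. i < n \<and> \<tau> Box_ar i = k}"
  let ?xs = "fill_order n V (\<lambda>i. \<tau> Box_ar i = k) (\<tau> Ph_ar) V"
  have pos: "0 < \<tau> Pw_ar i \<and> 0 < \<tau> Ph_ar i \<and> \<tau> Ph_ar i \<le> V" if "i < n" for i
  proof -
    have "M2 (\<tau> Box_ar i) \<le> b" using al[OF that] bounds by blast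
    then show ?thesis using dims[OF that] rect_bounds(1,2)[OF that, of "r i"] al[OF that] V(5) by auto
  qed
  have xs: "set ?xs = ?D" using pos by (intro set_fill_order) auto
  have srt: "distinct ?xs" "sorted_wrt (\<lambda>i j. \<tau> Ph_ar j \<le> \<tau> Ph_ar i) ?xs"
    using fill_order_sorted[of V V n "\<lambda>i. \<tau> Box_ar i = k" "\<tau> Ph_ar"] by auto
  have "length ?xs = card ?D" using distinct_card[OF srt(1)] xs by simp
  also have "\<dots> \<le> card {..<n}" by (intro card_mono) auto
  finally have len: "length ?xs \<le> n" by simp
  show ?thesis
  proof (cases "k < K0")
    case False
    then have D: "?D = {}" using al by force
    have "good_side \<tau> k 0" unfolding good_side_def D packed_inside_def Let_def by simp
    then show ?thesis ..
  next
    case True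
    have dm: "(3 * k) div 3 = k" "(3 * k + 1) div 3 = k" "(3 * k + 2) div 3 = k"
      "(3 * k) mod 3 = 0" "(3 * k + 1) mod 3 = 1" "(3 * k + 2) mod 3 = 2"
      by presburger+
    have sums: "box_sums (\<tau> Pw_ar) (\<tau> Ph_ar) (BT k) ?D c = box_sums (\<lambda>i. rect_w rs (r i) i) (\<lambda>i. rect_h rs (r i) i) (BT k) ?D c" for c
      unfolding box_sums_def using dims by (auto intro!: sum.cong)
    have d: "box_sums (\<tau> Pw_ar) (\<tau> Ph_ar) (BT k) ?D c =
        box_sums (\<lambda>i. rect_w rs (rt i) i) (\<lambda>i. rect_h rs (rt i) i) (BT k) {i. i < n \<and> bx i = k} c"
      if "c \<in> {0, 1, 2}" for c
      using that k dig[of "3 * k"] dig[of "3 * k + 1"] dig[of "3 * k + 2"] True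
      unfolding sums digit_def dm ext_def by auto
    have "fillable (BW k) (BH k) ?D (\<tau> Pw_ar) (\<tau> Ph_ar)"
    proof (rule robust[OF True, unfolded robust_box_def, rule_format], intro conjI ballI)
      show "(\<Sum>i\<in>?D. \<tau> Ph_ar i * \<tau> Pw_ar i) =
        box_sums (\<lambda>i. rect_w rs (rt i) i) (\<lambda>i. rect_h rs (rt i) i) (BT k) {i. i < n \<and> bx i = k} 0"
        using d[of 0] by (simp add: box_sums_def)
      show "(\<Sum>i\<in>?D. if BT k < \<tau> Ph_ar i then \<tau> Pw_ar i else 0) =
        box_sums (\<lambda>i. rect_w rs (rt i) i) (\<lambda>i. rect_h rs (rt i) i) (BT k) {i. i < n \<and> bx i = k} 1"
        using d[of 1] by (simp add: box_sums_def)
      show "(\<Sum>i\<in>?D. \<tau> Ph_ar i) =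
        box_sums (\<lambda>i. rect_w rs (rt i) i) (\<lambda>i. rect_h rs (rt i) i) (BT k) {i. i < n \<and> bx i = k} 2"
        using d[of 2] by (simp add: box_sums_def)
    qed (use pos al in auto)
    then have "fillable (BW k) (BH k) (set ?xs) (\<tau> Pw_ar) (\<tau> Ph_ar)" unfolding xs .
    from fillable_imp_packed[OF srt _ this] pos xs
    obtain q where "q \<le> length ?xs" "\<forall>X Y s. level s = BH k \<and> side s = q \<and> (\<forall>l<BH k. sky s l = 0) \<and> sky s (BH k) = BW k \<longrightarrow>
      packed_inside X Y (BW k) (BH k) (set ?xs) (posx (fold (place X Y (BW k) (\<tau> Pw_ar) (\<tau> Ph_ar)) ?xs s))
        (posy (fold (place X Y (BW k) (\<tau> Pw_ar) (\<tau> Ph_ar)) ?xs s)) (\<tau> Pw_ar) (\<tau> Ph_ar)"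
      by auto
    then have "good_side \<tau> k q" using len True unfolding good_side_def xs ext_def Let_def by simp
    then show ?thesis ..
  qed
qed

lemma try_layout_success:
  assumes inp: "input \<tau>" and w: "\<tau> width_sc 0 = A" and fl: "\<tau> flag_sc 0 = 0"
    and box: "\<And>k. k < K \<Longrightarrow> \<tau> BoxX_ar k = ext BX k \<and> \<tau> BoxY_ar k = ext BY k \<and> \<tau> BoxW_ar k = ext BW k \<and> \<tau> BoxH_ar k = ext BH k"
    and al: "\<And>i. i < n \<Longrightarrow> \<tau> Box_ar i < K0 \<and> 0 < \<tau> Ph_ar i \<and> \<tau> Ph_ar i \<le> V"
    and good: "\<And>k. k < K \<Longrightarrow> good_side \<tau> k (\<tau> Side_ar k)"
  shows "sem (try_layout K) \<tau> flag_sc 0 \<noteq> 0"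
proof -
  have t: "\<tau> n_sc 0 = n" "\<tau> 2 0 = V" "\<tau> height_sc 0 = b" using inp by (auto simp: input_def)
  let ?\<tau> = "sem (fill_boxes K) \<tau>"
  let ?x = "?\<tau> Px_ar" and ?y = "?\<tau> Py_ar" and ?w = "\<tau> Pw_ar" and ?h = "\<tau> Ph_ar"
  have packed: "packed_inside (ext BX k) (ext BY k) (ext BW k) (ext BH k) {i. i < n \<and> \<tau> Box_ar i = k} ?x ?y ?w ?h"
    if k: "k < K" for k
  proof -
    have nV: "\<tau> n_sc 0 \<le> \<tau> 2 0" "K \<le> \<tau> 2 0" unfolding t using V(1,2) by auto
    have h: "\<tau> BoxH_ar k < \<tau> 2 0" if "k < K" for k using box[OF that] ext_bounds(1)[OF that] t by simp
    have ph: "0 < \<tau> Ph_ar i \<and> \<tau> Ph_ar i \<le> \<tau> 2 0" if "i < \<tau> n_sc 0" for i using al that t by simp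
    have bk: "\<tau> BoxX_ar k = ext BX k" "\<tau> BoxY_ar k = ext BY k" "\<tau> BoxW_ar k = ext BW k" "\<tau> BoxH_ar k = ext BH k"
      using box[OF k] by auto
    let ?f = "fold (place (ext BX k) (ext BY k) (ext BW k) ?w ?h) (fill_order n V (\<lambda>i. \<tau> Box_ar i = k) ?h V)"
    from sem_fill_boxes[of \<tau> K k, OF nV h ph k] obtain s where
      s: "level s = ext BH k" "side s = \<tau> Side_ar k" "\<forall>l<ext BH k. sky s l = 0" "sky s (ext BH k) = ext BW k"
      and pos: "\<And>i. i < n \<Longrightarrow> \<tau> Box_ar i = k \<Longrightarrow> ?x i = posx (?f s) i \<and> ?y i = posy (?f s) i"
      unfolding bk t Let_def by blast
    have "packed_inside (ext BX k) (ext BY k) (ext BW k) (ext BH k) {i. i < n \<and> \<tau> Box_ar i = k}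
        (posx (?f s)) (posy (?f s)) ?w ?h"
      using good[OF k] s unfolding good_side_def Let_def by blast
    then show ?thesis using pos unfolding packed_inside_def by simp
  qed
  have inside: "ext BX k \<le> ?x i \<and> ext BY k \<le> ?y i \<and> ?x i + ?w i \<le> ext BX k + ext BW k \<and> ?y i + ?h i \<le> ext BY k + ext BH k"
    if "i < n" "\<tau> Box_ar i = k" for i k
  proof -
    have "k < K" using al[OF that(1)] that(2) K0 by simp
    from packed[OF this] that show ?thesis unfolding packed_inside_def by blast
  qed
  have "int_packing n A b ?x ?y ?w ?h"
    unfolding int_packing_def
  proof (intro allI impI conjI)
    fix i assume i: "i < n"
    show "?x i + ?w i \<le> A" "?y i + ?h i \<le> b"
      using inside[OF i refl] ext_bounds(2,3)[of "\<tau> Box_ar i"] by linarith+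
    fix j assume j: "j < n" "i \<noteq> j"
    show "?x i + ?w i \<le> ?x j \<or> ?x j + ?w j \<le> ?x i \<or> ?y i + ?h i \<le> ?y j \<or> ?y j + ?h j \<le> ?y i"
    proof (cases "\<tau> Box_ar i = \<tau> Box_ar j")
      case True
      have "\<tau> Box_ar j < K" using al[OF j(1)] K0 by simp
      from packed[OF this] i j True show ?thesis unfolding packed_inside_def by blast
    next
      case False
      have k: "\<tau> Box_ar i < K0" "\<tau> Box_ar j < K0" using al i j by blast+
      show ?thesis using sep[OF k False] inside[OF i refl] inside[OF j(1) refl] k unfolding ext_def by auto
    qed
  qed
  then show ?thesis using sem_try_layout(2)[of \<tau> K] fl t w V(1) by simp
qed

lemma try_params_success:
  assumes inp: "input \<tau>" and g: "guessed \<tau>" and snd: "sound rot A \<tau>" and w: "\<tau> width_sc 0 = A"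
  shows "sem (try_params K rot s) \<tau> flag_sc 0 \<noteq> 0"
proof (cases "\<tau> flag_sc 0 = 0")
  case False
  then show ?thesis by (simp add: try_params_found)
next
  case True
  define \<tau>2 where "\<tau>2 = sem (trace K rot) (sem (fill_table K rot) \<tau>)"
  define \<tau>3 where "\<tau>3 = sem (orient rot) \<tau>2"
  have o2: "\<tau>2 j = \<tau> j" if "j \<in> {2, 5, 6, 15, 16, 17, 18, 22, 26, 27, 28, 30}" for j
    using that by (auto simp: \<tau>2_def)
  have o3: "\<tau>3 j = \<tau> j" if "j \<in> {2, 5, 6, 15, 16, 17, 18, 22, 26, 27, 28, 30}" for j
    using that o2[OF that] by (auto simp: \<tau>3_def)
  have t: "\<tau> n_sc 0 = n" "\<tau> 2 0 = V" using inp by (auto simp: input_def)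
  have n2: "\<tau>2 n_sc 0 \<le> \<tau>2 2 0" using o2 t V(1) by simp
  have inp3: "input \<tau>3" and inp2: "input \<tau>2" using inp by (auto simp: input_def o3 o2)
  have B3: "\<tau>3 Box_ar = \<tau>2 Box_ar" by (simp add: \<tau>3_def)
  note asg = assignment_found[OF inp g \<tau>2_def]
  define r where "r i \<longleftrightarrow> \<tau>2 Rot_ar i \<noteq> 0" for i
  have rot3: "(\<tau>3 Rot_ar i \<noteq> 0) = r i" if "i < n" for i
    using sem_orient(1)[of \<tau>2 \<tau>3 rot i] n2 asg(2)[OF that] that o2 t by (auto simp: \<tau>3_def r_def)
  have dims: "\<tau>3 Pw_ar i = rect_w rs (r i) i \<and> \<tau>3 Ph_ar i = rect_h rs (r i) i" if i: "i < n" for i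
    using sem_orient(2,3)[of \<tau>2 \<tau>3 rot i] n2 i o2 t rot3[OF i] item_rect[OF inp2 i] by (simp add: \<tau>3_def)
  have al: "\<tau>3 Box_ar i < K0 \<and> \<tau>3 Pw_ar i \<le> M1 (\<tau>3 Box_ar i) \<and> \<tau>3 Ph_ar i \<le> M2 (\<tau>3 Box_ar i)" if "i < n" for i
    using asg(1,3,4)[OF that] dims[OF that] unfolding B3 r_def by simp
  \<comment> \<open>\<open>assignment_found\<close> is stated for some rectangle, hence the separate
    case without rectangles.\<close>
  have dig: "digit (\<tau>3 Box_ar) r j = digit bx rt j" if "j < 3 * K" for j
  proof (cases "n = 0")
    case True
    then have E: "{i. i < n \<and> f i = k} = {}" for f and k :: nat by simp
    show ?thesis unfolding digit_def E box_sums_def by simp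
  next
    case False
    then show ?thesis using asg(5)[of 0 j] that unfolding B3 r_def by simp
  qed
  obtain q where q: "\<And>k. k < K \<Longrightarrow> good_side \<tau>3 k (q k)"
    using good_side_exists[OF dims al dig] by metis
  let ?ids = "{2, 5, 6, 7, 9, 10, 15, 16, 17, 18, 26, 27, 28}"
  let ?I = "\<lambda>\<tau>. same_on ?ids \<tau> \<tau>3" and ?F = "\<lambda>\<tau> :: store. \<tau> flag_sc 0 \<noteq> 0"
  have "?F (sem (nest (map (\<lambda>k. (Side_ar, k)) [0..<K]) s (try_layout K)) \<tau>3)"
  proof (rule nest_success[where I = ?I and V = V and val = "\<lambda>p. q (snd p)"])
    show "?I (sem (try_layout K) \<tau>)" if "?I \<tau>" for \<tau> by (rule same_on_sem[OF that]) auto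
    show "?F (sem (try_layout K) \<tau>)" if "?F \<tau>" for \<tau> using that by (simp add: try_layout_def)
    show "?F (sem (try_layout K) \<tau>')"
      if I: "?I \<tau>'" and v: "\<And>p. p \<in> set (map (\<lambda>k. (Side_ar, k)) [0..<K]) \<Longrightarrow> \<tau>' (fst p) (snd p) = q (snd p)" for \<tau>'
    proof (cases "\<tau>' flag_sc 0 = 0")
      case False
      then show ?thesis by (simp add: try_layout_def)
    next
      case fl: True
      have e: "\<tau>' j = \<tau>3 j" if "j \<in> ?ids" for j using I that unfolding same_on_def by blast
      have side: "\<tau>' Side_ar k = q k" if "k < K" for k using v[of "(Side_ar, k)"] that by simp
      show ?thesis
      proof (rule try_layout_success)
        show "\<tau>' flag_sc 0 = 0" by (rule fl)
        show "input \<tau>'" using inp3 by (simp add: input_def e)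
        show "\<tau>' width_sc 0 = A" using w by (simp add: e o3)
        show "\<tau>' BoxX_ar k = ext BX k \<and> \<tau>' BoxY_ar k = ext BY k \<and> \<tau>' BoxW_ar k = ext BW k \<and> \<tau>' BoxH_ar k = ext BH k"
          if "k < K" for k using guessedD(2)[OF g that] by (simp add: e o3)
        show "\<tau>' Box_ar i < K0 \<and> 0 < \<tau>' Ph_ar i \<and> \<tau>' Ph_ar i \<le> V" if "i < n" for i
        proof -
          have "M2 (\<tau>3 Box_ar i) \<le> b" using al[OF that] bounds by blast
          then show ?thesis using al[OF that] dims[OF that] rect_bounds(2)[OF that, of "r i"] V(5) by (simp add: e)
        qed
        show "good_side \<tau>' k (\<tau>' Side_ar k)" if "k < K" for k
          using q[OF that] side[OF that] by (simp add: good_side_def e)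
      qed
    qed
    show "\<tau>' 2 0 = V" if "?I \<tau>'" for \<tau>' using that t by (simp add: same_on_def o3)
    show "q (snd p) < V" if "p \<in> set (map (\<lambda>k. (Side_ar, k)) [0..<K])" for p
      using that q V(1) unfolding good_side_def by fastforce
    show "distinct (map (\<lambda>k. (Side_ar, k)) [0..<K])" by (simp add: distinct_map inj_on_def)
    show "?I \<tau>3" by (simp add: same_on_def)
  qed auto
  then show ?thesis using True by (simp add: try_params_def \<tau>2_def \<tau>3_def)
qed

text \<open>When the loop over the widths has passed \<open>A\<close>, the flag is up: either a
  smaller width succeeded, or the right guess was tried at width \<open>A\<close>. From then on the
  result is frozen, and before that any raised flag is sound.\<close>

theorem search_finds:
  assumes inp: "input \<sigma>"
  shows "found rot A (sem (search K rot) \<sigma>)"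
proof -
  let ?c = "nest (params K) 8 (try_params K rot (8 + length (params K)))"
  let ?F = "\<lambda>\<tau> :: store. \<tau> flag_sc 0 \<noteq> 0"
  let ?I = "\<lambda>i \<tau>. input \<tau> \<and> (if A < i then ?F \<tau> \<and> found rot A \<tau> else ?F \<tau> \<longrightarrow> found rot A \<tau>)"
  have inp_upd: "input (upd \<tau> j i v) = input \<tau>" if "j \<notin> {2, 5, 6, 26, 27}" for \<tau> j i v
    using that by (simp add: input_def)
  have inp_try: "input (sem (try_params K rot s) \<tau>) = input \<tau>" for \<tau> s
    by (simp add: input_def try_params_other)
  have ids: "fst p \<in> {15, 16, 17, 18, 19, 20, 21, 23, 24, 25, 29}" if "p \<in> set (params K)" for p
    using that by (auto simp: set_params)
  have "?I V (sem (For 7 limit (assign width_sc (counter 7) ;; ?c)) (sem (assign flag_sc (Num 0)) \<sigma>))"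
  proof (rule For_rule[where I = ?I], goal_cases)
    case 1
    then show ?case using inp by (simp add: inp_upd)
  next
    case 2
    then show ?case using inp by (simp add: input_def)
  next
    case (5 i \<tau>)
    let ?\<tau> = "upd \<tau> width_sc 0 i"
    have sem: "sem (assign width_sc (counter 7) ;; ?c) \<tau> = sem ?c ?\<tau>" using 5 by simp
    have inp1: "input ?\<tau>" using 5 by (simp add: inp_upd)
    have keep: "input (sem ?c ?\<tau>)"
    proof (rule nest_preserves[where I = input])
      show "input (upd \<tau> (fst p) (snd p) v)" if "p \<in> set (params K)" "input \<tau>" for \<tau> p v
        using that ids[OF that(1)] by (subst inp_upd) auto
    qed (use inp1 in \<open>auto simp: inp_upd inp_try\<close>)
    show ?case
    proof (cases "A < i")
      case True
      let ?J = "\<lambda>\<tau>. ?F \<tau> \<and> found rot A \<tau>"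
      have "?J (sem ?c ?\<tau>)"
      proof (rule nest_preserves[where I = ?J])
        show "?J (sem (try_params K rot (8 + length (params K))) \<tau>)" if "?J \<tau>" for \<tau>
          using that by (simp add: try_params_found)
        show "?J (upd \<tau> j s v)" if "j < 2" "?J \<tau>" for \<tau> j s v using that by (simp add: found_upd)
        show "?J (upd \<tau> (fst p) (snd p) v)" if "p \<in> set (params K)" "?J \<tau>" for \<tau> p v
          using that ids[OF that(1)] by (auto simp: found_upd)
        show "?J ?\<tau>" using 5 True by (simp add: found_upd)
      qed
      then show ?thesis using keep True unfolding sem by simp
    next
      case False
      let ?J = "\<lambda>\<tau>. input \<tau> \<and> sound rot A \<tau> \<and> \<tau> width_sc 0 = i"
      have J0: "?J ?\<tau>" using 5 False inp1 V(1) by (auto simp: sound_def found_upd input_def)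
      have Jtry: "?J (sem (try_params K rot s) \<tau>)" if "?J \<tau>" for \<tau> s
        using that by (simp add: inp_try try_params_sound try_params_other)
      have Jupd: "?J (upd \<tau> j s v)" if "j < 2" "?J \<tau>" for \<tau> j s v using that by (simp add: inp_upd sound_upd)
      have Jpar: "?J (upd \<tau> (fst p) (snd p) v)" if "p \<in> set (params K)" "?J \<tau>" for \<tau> p v
        using that ids[OF that(1)] by (auto simp: inp_upd sound_upd)
      have J: "?J (sem ?c ?\<tau>)"
        by (rule nest_preserves[where I = ?J, OF Jtry Jupd Jpar J0])
      have "?F (sem ?c ?\<tau>)" if i: "i = A"
      proof (rule nest_success[where I = ?J and V = V and val = val])
        show "?F (sem (try_params K rot (8 + length (params K))) \<tau>)" if "?F \<tau>" for \<tau>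
          using that by (simp add: try_params_found)
        show "?F (sem (try_params K rot (8 + length (params K))) \<tau>)"
          if "?J \<tau>" "\<And>p. p \<in> set (params K) \<Longrightarrow> \<tau> (fst p) (snd p) = val p" for \<tau>
          using that i by (intro try_params_success) (auto simp: guessed_def)
        show "\<tau> 2 0 = V" if "?J \<tau>" for \<tau> using that by (simp add: input_def)
        show "2 < fst p \<and> fst p \<notin> mods (try_params K rot (8 + length (params K)))" if "p \<in> set (params K)" for p
          using ids[OF that] mods_try_params[of K rot "8 + length (params K)"] by fastforce
        show "?F (upd \<tau> (fst p) (snd p) v)" if "p \<in> set (params K)" "?F \<tau>" for \<tau> p v
          using that ids[OF that(1)] by auto
      qed (use Jtry Jupd Jpar J0 val_less distinct_params in auto)
      then show ?thesis using J False unfolding sem sound_def by (auto simp: not_less_eq less_Suc_eq)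
    qed
  next
    case (3 i \<tau> v)
    then show ?case by (simp add: inp_upd found_upd split: if_splits)
  next
    case (4 i \<tau> v)
    then show ?case by (simp add: inp_upd found_upd split: if_splits)
  qed
  then show ?thesis using V(3) by (simp add: search_def)
qed

end

section \<open>The complete program\<close>

fun straight :: "com \<Rightarrow> bool" where
  "straight (Assign e f) = True"
| "straight (Seq c d) = (straight c \<and> straight d)"
| "straight c = False"

fun straight_cost :: "com \<Rightarrow> nat" where
  "straight_cost (Assign e f) = 1 + acost e + acost f"
| "straight_cost (Seq c d) = straight_cost c + straight_cost d"
| "straight_cost c = 0"

fun straight_run :: "com \<Rightarrow> memory \<Rightarrow> memory" where
  "straight_run (Assign e f) M = M(aval e M := aval f M)"
| "straight_run (Seq c d) M = straight_run d (straight_run c M)"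
| "straight_run c M = M"

lemma exec_straight: "straight c \<Longrightarrow> exec c M (straight_cost c) (straight_run c M)"
proof (induction c arbitrary: M)
  case (Assign e f)
  show ?case using exec_Assign[of e f M] by (simp only: straight_cost.simps straight_run.simps)
next
  case (Seq c d)
  then show ?case using exec_Seq[of c M "straight_cost c" "straight_run c M" d] by simp
qed auto

text \<open>Reading the input and writing the output disregard the division into arrays, so they are
  programmed on the machine directly. Indexing the invariant by the remaining iterations gives the
  exact running time.\<close>

lemma exec_While_straight:
  assumes c: "straight c" and step: "\<And>i M. Inv (Suc i) M \<Longrightarrow> aval e M \<noteq> 0 \<and> Inv i (straight_run c M)"
    and stop: "\<And>M. Inv 0 M \<Longrightarrow> aval e M = 0" and start: "Inv m M"
  shows "\<exists>M'. exec (While e c) M (m * (1 + acost e + straight_cost c) + (1 + acost e)) M' \<and> Inv 0 M'"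
  using start
proof (induction m arbitrary: M)
  case 0
  then show ?case using exec_WhileFalse[OF stop] by auto
next
  case (Suc m)
  obtain M' where M': "exec (While e c) (straight_run c M) (m * (1 + acost e + straight_cost c) + (1 + acost e)) M'" "Inv 0 M'"
    using Suc.IH step[OF Suc.prems] by blast
  have "exec (While e c) M (1 + acost e + straight_cost c + (m * (1 + acost e + straight_cost c) + (1 + acost e))) M'"
    using exec_WhileTrue[OF _ exec_straight[OF c] M'(1)] step[OF Suc.prems] by blast
  moreover have "1 + acost e + straight_cost c + (m * (1 + acost e + straight_cost c) + (1 + acost e)) =
      Suc m * (1 + acost e + straight_cost c) + (1 + acost e)" by simp
  ultimately show ?case using M'(2) by metis
qed

abbreviation cell :: "nat \<Rightarrow> aexp" where "cell k \<equiv> Mem (Const k)"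

text \<open>The rectangles are moved from the last to the first. The new cells of rectangle
  \<open>j\<close> lie behind the input of all earlier rectangles, so nothing unread is
  overwritten.\<close>

definition move_item :: "bool \<Rightarrow> com" where
  "move_item tr =
     Seq (Assign (Const 2) (Minus (cell 2) (Const 1)))
    (Seq (Assign (address (if tr then H_ar else W_ar) (cell 2)) (Mem (Plus (Const 3) (dbl (cell 2)))))
         (Assign (address (if tr then W_ar else H_ar) (cell 2)) (Mem (Plus (Const 4) (dbl (cell 2))))))"

text \<open>Any cell of fixed address beyond the first three may hold input, and cells 0 and 1 are
  still needed. So the number of rectangles in cell 2 is itself counted down, and afterwards
  recovered by counting up to the first width 0. Finally cell 2 receives the start value of the
  truncation number.\<close>

definition load :: "bool \<Rightarrow> com" where
  "load tr =
     Seq (While (cell 2) (move_item tr))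
    (Seq (While (Mem (address W_ar (cell 2))) (Assign (Const 2) (Plus (cell 2) (Const 1))))
    (Seq (Assign (Const n_sc) (cell 2))
    (Seq (Assign (Const height_sc) (cell (if tr then 0 else 1)))
         (Assign (Const 2) (Plus (Plus (cell 0) (cell 1)) (Plus (cell 2) (Const 2)))))))"

definition load_time :: "bool \<Rightarrow> nat" where
  "load_time tr = (1 + acost (cell 2) + straight_cost (move_item tr)) + (1 + acost (cell 2)) +
     (1 + acost (Mem (address W_ar (cell 2))) + straight_cost (Assign (Const 2) (Plus (cell 2) (Const 1)))) +
     (1 + acost (Mem (address W_ar (cell 2)))) +
     straight_cost (Seq (Assign (Const n_sc) (cell 2)) (Seq (Assign (Const height_sc) (cell (if tr then 0 else 1)))
         (Assign (Const 2) (Plus (Plus (cell 0) (cell 1)) (Plus (cell 2) (Const 2))))))"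

definition flip :: "bool \<Rightarrow> rect list \<Rightarrow> rect list" where
  "flip tr rs = (if tr then map prod.swap rs else rs)"

lemma length_flip [simp]: "length (flip tr rs) = length rs"
  by (simp add: flip_def)

lemma length_encode: "length (encode a b rs) = 3 + 2 * length rs"
  unfolding encode_def by (induction rs) auto

lemma encode_nth:
  "encode a b rs ! 0 = a" "encode a b rs ! 1 = b" "encode a b rs ! 2 = length rs"
  "j < length rs \<Longrightarrow> encode a b rs ! (3 + 2 * j) = fst (rs ! j) \<and> encode a b rs ! (4 + 2 * j) = snd (rs ! j)"
proof -
  have nth: "j < length rs \<Longrightarrow> concat (map (\<lambda>(w, h). [w, h]) rs) ! (2 * j) = fst (rs ! j) \<and>
     concat (map (\<lambda>(w, h). [w, h]) rs) ! (2 * j + 1) = snd (rs ! j)" for j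
  proof (induction rs arbitrary: j)
    case (Cons r rs)
    then show ?case by (cases j) (auto simp: split_beta)
  qed simp
  show "encode a b rs ! 0 = a" "encode a b rs ! 1 = b" "encode a b rs ! 2 = length rs" by (auto simp: encode_def)
  show "encode a b rs ! (3 + 2 * j) = fst (rs ! j) \<and> encode a b rs ! (4 + 2 * j) = snd (rs ! j)" if "j < length rs"
    using nth[OF that] by (simp add: encode_def numeral_3_eq_3 numeral_eq_Suc)
qed

lemma load_correct:
  assumes valid: "valid_instance a b rs"
  shows "\<exists>t M. exec (load tr) (initial_memory a b rs) t M \<and> t \<le> load_time tr * (length rs + 1) \<and>
    M 2 = a + b + (length rs + 2) \<and> M n_sc = length rs \<and> M height_sc = (if tr then a else b) \<and>
    (\<forall>j < length rs. M (64 * j + W_ar) = fst (flip tr rs ! j) \<and> M (64 * j + H_ar) = snd (flip tr rs ! j)) \<and>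
    M (64 * length rs + W_ar) = 0"
proof -
  let ?n = "length rs" and ?M0 = "initial_memory a b rs"
  let ?src = "\<lambda>M j. M (3 + 2 * j) = fst (rs ! j) \<and> M (4 + 2 * j) = snd (rs ! j)"
  let ?dst = "\<lambda>M j. M (64 * j + W_ar) = fst (flip tr rs ! j) \<and> M (64 * j + H_ar) = snd (flip tr rs ! j)"
  have fl: "flip tr rs ! j = (if tr then (snd (rs ! j), fst (rs ! j)) else rs ! j)" if "j < ?n" for j
    using that by (simp add: flip_def prod.swap_def)
  let ?I = "\<lambda>i M. i \<le> ?n \<and> M 0 = a \<and> M 1 = b \<and> M 2 = i \<and> (\<forall>j<i. ?src M j) \<and>
    (\<forall>j. i \<le> j \<and> j < ?n \<longrightarrow> ?dst M j) \<and> M (64 * ?n + W_ar) = 0"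
  have start: "?I ?n ?M0"
    using encode_nth(1-3)[of a b rs] encode_nth(4)[of _ rs] by (auto simp: initial_memory_def length_encode)
  have ex1: "\<exists>M. exec (While (cell 2) (move_item tr)) ?M0
      (?n * (1 + acost (cell 2) + straight_cost (move_item tr)) + (1 + acost (cell 2))) M \<and> ?I 0 M"
  proof (rule exec_While_straight[where Inv = ?I])
    show "straight (move_item tr)" by (simp add: move_item_def)
    show "aval (cell 2) M = 0" if "?I 0 M" for M using that by simp
    show "?I ?n ?M0" by (rule start)
    fix i M assume I: "?I (Suc i) M"
    then have i: "i < ?n" and src: "?src M i" by auto
    let ?M = "straight_run (move_item tr) M"
    have M: "?M = M(2 := i, 64 * i + (if tr then H_ar else W_ar) := fst (rs ! i),
        64 * i + (if tr then W_ar else H_ar) := snd (rs ! i))"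
      using I src by (simp add: move_item_def)
    have "?M k = M k" if "k \<noteq> 2" "k \<noteq> 64 * i + 5" "k \<noteq> 64 * i + 6" for k
      unfolding M using that by simp
    note other = this
    have "?src ?M j" if "j < i" for j
      using I that by (simp add: other)
    moreover have "?dst ?M j" if "i \<le> j" "j < ?n" for j
    proof (cases "j = i")
      case True
      show ?thesis unfolding True fl[OF i] M by simp
    next
      case False
      then have "64 * j + 5 \<noteq> 64 * i + 5" "64 * j + 5 \<noteq> 64 * i + 6" "64 * j + 6 \<noteq> 64 * i + 5" "64 * j + 6 \<noteq> 64 * i + 6"
        by presburger+
      then show ?thesis using I that False by (simp add: other)
    qed
    moreover have "64 * ?n + 5 \<noteq> 64 * i + 5" "64 * ?n + 5 \<noteq> 64 * i + 6" using i by presburger+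
    moreover have "?M 2 = i" unfolding M by simp
    ultimately show "aval (cell 2) M \<noteq> 0 \<and> ?I i ?M" using I i by (simp add: other)
  qed
  then obtain M1 where M1: "exec (While (cell 2) (move_item tr)) ?M0
      (?n * (1 + acost (cell 2) + straight_cost (move_item tr)) + (1 + acost (cell 2))) M1" "?I 0 M1" by blast
  have pos: "0 < fst (flip tr rs ! j)" if "j < ?n" for j
  proof -
    have "rs ! j \<in> set rs" using that by simp
    then show ?thesis using valid fl[OF that] by (auto simp: valid_instance_def)
  qed
  let ?J = "\<lambda>i M. i \<le> ?n \<and> M 2 = ?n - i \<and> M 0 = a \<and> M 1 = b \<and> (\<forall>j<?n. ?dst M j) \<and> M (64 * ?n + W_ar) = 0"
  let ?inc = "Assign (Const 2) (Plus (cell 2) (Const 1))"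
  have "\<exists>M. exec (While (Mem (address W_ar (cell 2))) ?inc) M1
      (?n * (1 + acost (Mem (address W_ar (cell 2))) + straight_cost ?inc) + (1 + acost (Mem (address W_ar (cell 2))))) M \<and> ?J 0 M"
  proof (rule exec_While_straight[where Inv = ?J])
    show "?J ?n M1" using M1(2) by simp
    fix i M assume J: "?J (Suc i) M"
    then have lt: "?n - Suc i < ?n" by linarith
    then have "M (64 * (?n - Suc i) + W_ar) = fst (flip tr rs ! (?n - Suc i))" using J by blast
    then have "0 < M (64 * (?n - Suc i) + W_ar)" using pos[OF lt] by simp
    then show "aval (Mem (address W_ar (cell 2))) M \<noteq> 0 \<and> ?J i (straight_run ?inc M)" using J by auto
  qed auto
  then obtain M2 where M2: "exec (While (Mem (address W_ar (cell 2))) ?inc) M1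
      (?n * (1 + acost (Mem (address W_ar (cell 2))) + straight_cost ?inc) + (1 + acost (Mem (address W_ar (cell 2))))) M2" "?J 0 M2"
    by blast
  let ?fin = "Seq (Assign (Const n_sc) (cell 2)) (Seq (Assign (Const height_sc) (cell (if tr then 0 else 1)))
         (Assign (Const 2) (Plus (Plus (cell 0) (cell 1)) (Plus (cell 2) (Const 2)))))"
  have M3: "exec ?fin M2 (straight_cost ?fin) (straight_run ?fin M2)" by (rule exec_straight) simp
  let ?M3 = "straight_run ?fin M2"
  have fin: "?M3 2 = a + b + (?n + 2)" "?M3 n_sc = ?n" "?M3 height_sc = (if tr then a else b)"
    using M2(2) by auto
  have other: "?M3 k = M2 k" if "k \<notin> {2, 26, 27}" for k using that by simp
  have "64 * j + 5 \<notin> {2, 26, 27}" "64 * j + 6 \<notin> {2, 26, 27}" for j :: nat by auto presburger+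
  then have dst: "(\<forall>j < ?n. ?dst ?M3 j) \<and> ?M3 (64 * ?n + W_ar) = 0" using M2(2) other by metis
  let ?a1 = "1 + acost (cell 2) + straight_cost (move_item tr)" and ?b1 = "1 + acost (cell 2)"
  let ?a2 = "1 + acost (Mem (address W_ar (cell 2))) + straight_cost ?inc" and ?b2 = "1 + acost (Mem (address W_ar (cell 2)))"
  have "?n * ?a1 + ?b1 + (?n * ?a2 + ?b2 + straight_cost ?fin) \<le> (?a1 + ?b1 + ?a2 + ?b2 + straight_cost ?fin) * (?n + 1)"
    by (simp only: distrib_left distrib_right mult.commute[of ?n] mult_1_right)
  also have "\<dots> = load_time tr * (?n + 1)" by (simp only: load_time_def)
  finally have "?n * ?a1 + ?b1 + (?n * ?a2 + ?b2 + straight_cost ?fin) \<le> load_time tr * (?n + 1)" .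
  moreover have "exec (load tr) ?M0 (?n * ?a1 + ?b1 + (?n * ?a2 + ?b2 + straight_cost ?fin)) ?M3"
    unfolding load_def by (rule exec_Seq[OF M1(1) exec_Seq[OF M2(1) M3]])
  ultimately show ?thesis using fin dst by blast
qed

definition output_item :: "bool \<Rightarrow> com" where
  "output_item tr =
     Seq (Assign (Plus (Const 1) (Plus (dbl (cell 0)) (cell 0))) (Mem (address (if tr then Py_ar else Px_ar) (cell 0))))
    (Seq (Assign (Plus (Const 2) (Plus (dbl (cell 0)) (cell 0))) (Mem (address (if tr then Px_ar else Py_ar) (cell 0))))
    (Seq (Assign (Plus (Const 3) (Plus (dbl (cell 0)) (cell 0))) (Mem (address Rot_ar (cell 0))))
         (Assign (Const 0) (Plus (cell 0) (Const 1)))))"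

text \<open>The output overwrites all registers except for cell 0, which therefore serves as the loop
  counter; the loop ends at the first cell of the array of widths that contains 0.\<close>

definition write_result :: "bool \<Rightarrow> com" where
  "write_result tr =
     Seq (Assign (Const 0) (Const 0))
    (Seq (While (Mem (address W_ar (cell 0))) (output_item tr))
         (Assign (Const 0) (Const 1)))"

definition output_time :: "bool \<Rightarrow> nat" where
  "output_time tr = straight_cost (Assign (Const 0) (Const 0)) +
     (1 + acost (Mem (address W_ar (cell 0))) + straight_cost (output_item tr)) +
     (1 + acost (Mem (address W_ar (cell 0)))) + straight_cost (Assign (Const 0) (Const 1))"

text \<open>Rectangle \<open>c\<close> writes up to cell \<open>3 * c + 3\<close>, while the data of
  the next one begin at cell \<open>64 * c + 69\<close>; so data are read before they are
  overwritten. The positions are integers, hence the common denominator is 1.\<close>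

lemma output_correct:
  assumes pos: "\<And>j. j < n \<Longrightarrow> 0 < M (64 * j + W_ar)" and stop: "M (64 * n + W_ar) = 0"
  shows "\<exists>t M'. exec (write_result tr) M t M' \<and> t \<le> output_time tr * (n + 1) \<and> M' 0 = 1 \<and>
    (\<forall>j<n. M' (3 * j + 1) = M (64 * j + (if tr then Py_ar else Px_ar)) \<and>
       M' (3 * j + 2) = M (64 * j + (if tr then Px_ar else Py_ar)) \<and> M' (3 * j + 3) = M (64 * j + Rot_ar))"
proof -
  let ?px = "if tr then Py_ar else Px_ar" and ?py = "if tr then Px_ar else Py_ar"
  let ?out = "\<lambda>M' j. M' (3 * j + 1) = M (64 * j + ?px) \<and> M' (3 * j + 2) = M (64 * j + ?py) \<and> M' (3 * j + 3) = M (64 * j + Rot_ar)"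
  let ?keep = "\<lambda>M' j. \<forall>k \<in> {5, 8, 11, 12}. M' (64 * j + k) = M (64 * j + k)"
  let ?I = "\<lambda>i M'. i \<le> n \<and> M' 0 = n - i \<and> (\<forall>j < n - i. ?out M' j) \<and> (\<forall>j \<ge> n - i. ?keep M' j)"
  let ?M0 = "straight_run (Assign (Const 0) (Const 0)) M"
  have ex0: "exec (Assign (Const 0) (Const 0)) M (straight_cost (Assign (Const 0) (Const 0))) ?M0"
    by (rule exec_straight) simp
  let ?e = "Mem (address W_ar (cell 0))"
  have "\<exists>M'. exec (While ?e (output_item tr)) ?M0
      (n * (1 + acost ?e + straight_cost (output_item tr)) + (1 + acost ?e)) M' \<and> ?I 0 M'"
  proof (rule exec_While_straight[where Inv = ?I])
    show "straight (output_item tr)" by (simp add: output_item_def)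
    show "aval ?e M' = 0" if I: "?I 0 M'" for M' using I stop by simp
    show "?I n ?M0" by simp
    fix i M' assume I: "?I (Suc i) M'"
    define c where "c = n - Suc i"
    have c: "n - i = Suc c" "c < n" "M' 0 = c" using I by (auto simp: c_def)
    have keep: "M' (64 * j + k) = M (64 * j + k)" if "c \<le> j" "k \<in> {5, 8, 11, 12}" for j k
      using I that unfolding c_def by blast
    have out: "?out M' j" if "j < c" for j using I that unfolding c_def by blast
    let ?M = "straight_run (output_item tr) M'"
    have M: "?M = M'(3 * c + 1 := M (64 * c + ?px), 3 * c + 2 := M (64 * c + ?py), 3 * c + 3 := M (64 * c + Rot_ar), 0 := Suc c)"
      using c(3) keep[of c 5] keep[of c 8] keep[of c 11] keep[of c 12] by (simp add: output_item_def add.commute)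
    have other: "?M k = M' k" if "k \<noteq> 0" "k < 3 * c + 1 \<or> 3 * c + 3 < k" for k
      unfolding M using that by auto
    have "?out ?M j" if "j < Suc c" for j
    proof (cases "j = c")
      case True
      show ?thesis unfolding True M by simp
    next
      case False
      then have "j < c" using that by simp
      then show ?thesis using out[of j] other[of "3 * j + 1"] other[of "3 * j + 2"] other[of "3 * j + 3"] by simp
    qed
    moreover have "?keep ?M j" if "Suc c \<le> j" for j
    proof
      fix k :: nat assume k: "k \<in> {5, 8, 11, 12}"
      have "?M (64 * j + k) = M' (64 * j + k)" using that k by (intro other) auto
      then show "?M (64 * j + k) = M (64 * j + k)" using keep[of j k] k that by simp
    qed
    moreover have "?M 0 = Suc c" unfolding M by simp
    moreover have "aval ?e M' \<noteq> 0" using c(3) keep[of c 5] pos[OF c(2)] by simp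
    ultimately show "aval ?e M' \<noteq> 0 \<and> ?I i ?M" unfolding c(1) using c by simp
  qed
  then obtain M1 where M1: "exec (While ?e (output_item tr)) ?M0
      (n * (1 + acost ?e + straight_cost (output_item tr)) + (1 + acost ?e)) M1" "?I 0 M1" by blast
  let ?M2 = "straight_run (Assign (Const 0) (Const 1)) M1"
  have ex2: "exec (Assign (Const 0) (Const 1)) M1 (straight_cost (Assign (Const 0) (Const 1))) ?M2"
    by (rule exec_straight) simp
  have fin: "?M2 0 = 1" "\<forall>j<n. ?out ?M2 j" using M1(2) by simp_all
  let ?a = "1 + acost ?e + straight_cost (output_item tr)" and ?b = "1 + acost ?e"
  let ?s0 = "straight_cost (Assign (Const 0) (Const 0))" and ?s1 = "straight_cost (Assign (Const 0) (Const 1))"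
  have "?s0 + (n * ?a + ?b + ?s1) \<le> (?s0 + ?a + ?b + ?s1) * (n + 1)"
    by (simp only: distrib_left distrib_right mult.commute[of n] mult_1_right)
  also have "\<dots> = output_time tr * (n + 1)" by (simp only: output_time_def)
  finally have "?s0 + (n * ?a + ?b + ?s1) \<le> output_time tr * (n + 1)" .
  moreover have "exec (write_result tr) M (?s0 + (n * ?a + ?b + ?s1)) ?M2"
    unfolding write_result_def by (rule exec_Seq[OF ex0 exec_Seq[OF M1(1) ex2]])
  ultimately show ?thesis using fin by blast
qed

section \<open>Raising the truncation number\<close>

definition square_cm :: cm where
  "square_cm = assign 43 (Num 0) ;; accum 43 limit limit"

text \<open>A loop cannot run longer than the present truncation number, but this is just long
  enough to square it. The result is stored by plain machine code, because the loop language must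
  not write array 2.\<close>

definition square :: com where
  "square = Seq (compile square_cm) (Assign (Const 2) (cell 43))"

lemma square_correct:
  "\<exists>t \<sigma>'. exec square (mem \<sigma>) t (mem \<sigma>') \<and> t \<le> (time_factor square_cm + 4) * (\<sigma> 2 0 + 1) ^ depth square_cm \<and>
    \<sigma>' 2 0 = (\<sigma> 2 0)\<^sup>2 \<and> (\<forall>j \<in> {5, 6, 26, 27}. \<sigma>' j = \<sigma> j)"
proof -
  let ?\<sigma> = "sem square_cm \<sigma>"
  have wf: "wf_cm square_cm" by (simp add: square_cm_def)
  from exec_compile[OF wf, of \<sigma>] obtain t where t: "exec (compile square_cm) (mem \<sigma>) t (mem ?\<sigma>)"
    "t \<le> time_factor square_cm * (\<sigma> 2 0 + 1) ^ depth square_cm" by blast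
  have "sem (accum 43 limit limit) (upd \<sigma> 43 0 0) 43 0 = upd \<sigma> 43 0 0 43 0 + min (ev limit (upd \<sigma> 43 0 0)) (upd \<sigma> 43 0 0 2 0) * \<sigma> 2 0"
    by (rule sem_accum) auto
  then have sq: "?\<sigma> 43 0 = (\<sigma> 2 0)\<^sup>2" by (simp add: square_cm_def power2_eq_square)
  have "exec (Assign (Const 2) (cell 43)) (mem ?\<sigma>) 4 ((mem ?\<sigma>)(2 := mem ?\<sigma> 43))"
  proof -
    have "1 + acost (Const 2) + acost (cell 43) = 4" by simp
    then show ?thesis using exec_Assign[of "Const 2" "cell 43" "mem ?\<sigma>"] by (simp only: aval.simps)
  qed
  moreover have "(mem ?\<sigma>)(2 := mem ?\<sigma> 43) = mem (upd ?\<sigma> 2 0 ((\<sigma> 2 0)\<^sup>2))"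
    using mem_upd[of 2 ?\<sigma> 0] mem_at[of 43 ?\<sigma> 0] sq by (simp add: numeral_2_eq_2)
  ultimately have 2: "exec (Assign (Const 2) (cell 43)) (mem ?\<sigma>) 4 (mem (upd ?\<sigma> 2 0 ((\<sigma> 2 0)\<^sup>2)))" by simp
  have "1 \<le> (\<sigma> 2 0 + 1) ^ depth square_cm" by (rule const_le_power)
  then have "t + 4 \<le> (time_factor square_cm + 4) * (\<sigma> 2 0 + 1) ^ depth square_cm"
    using add_mono[OF t(2) mult_le_mono2[of 1 _ 4]] by (simp only: distrib_right mult_1_right)
  moreover have "exec square (mem \<sigma>) (t + 4) (mem (upd ?\<sigma> 2 0 ((\<sigma> 2 0)\<^sup>2)))"
    unfolding square_def by (rule exec_Seq[OF t(1) 2])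
  moreover have "upd ?\<sigma> 2 0 ((\<sigma> 2 0)\<^sup>2) 2 0 = (\<sigma> 2 0)\<^sup>2"
    "\<forall>j \<in> {5, 6, 26, 27}. upd ?\<sigma> 2 0 ((\<sigma> 2 0)\<^sup>2) j = \<sigma> j"
    by (auto simp: square_cm_def)
  ultimately show ?thesis by blast
qed

primrec squares :: "nat \<Rightarrow> com" where
  "squares 0 = Skip"
| "squares (Suc q) = Seq square (squares q)"

lemma squares_correct:
  assumes "0 < \<sigma> 2 0"
  shows "\<exists>t \<sigma>'. exec (squares q) (mem \<sigma>) t (mem \<sigma>') \<and>
    t \<le> (q * (time_factor square_cm + 4) + 1) * ((\<sigma> 2 0) ^ (2 ^ q) + 1) ^ depth square_cm \<and>
    \<sigma>' 2 0 = (\<sigma> 2 0) ^ (2 ^ q) \<and> (\<forall>j \<in> {5, 6, 26, 27}. \<sigma>' j = \<sigma> j)"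
  using assms
proof (induction q arbitrary: \<sigma>)
  case 0
  then show ?case using exec_Skip[of "mem \<sigma>"] by (intro exI[of _ 1] exI[of _ \<sigma>]) simp
next
  case (Suc q)
  let ?k = "time_factor square_cm + 4" and ?d = "depth square_cm" and ?V = "\<sigma> 2 0"
  obtain t \<sigma>1 where 1: "exec square (mem \<sigma>) t (mem \<sigma>1)" "t \<le> ?k * (?V + 1) ^ ?d"
    "\<sigma>1 2 0 = ?V\<^sup>2" "\<forall>j \<in> {5, 6, 26, 27}. \<sigma>1 j = \<sigma> j"
    using square_correct[of \<sigma>] by blast
  have "0 < \<sigma>1 2 0" using 1(3) Suc.prems by simp
  from Suc.IH[of \<sigma>1, OF this] obtain u \<sigma>2 where 2: "exec (squares q) (mem \<sigma>1) u (mem \<sigma>2)"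
    "u \<le> (q * ?k + 1) * ((?V\<^sup>2) ^ (2 ^ q) + 1) ^ ?d" "\<sigma>2 2 0 = (?V\<^sup>2) ^ (2 ^ q)" "\<forall>j \<in> {5, 6, 26, 27}. \<sigma>2 j = \<sigma>1 j"
    unfolding 1(3) by blast
  have pw: "(?V\<^sup>2) ^ (2 ^ q) = ?V ^ (2 ^ Suc q)" by (simp add: power_mult[symmetric])
  have "?V ^ 1 \<le> ?V ^ (2 ^ Suc q)" using Suc.prems by (intro power_increasing) auto
  then have "(?V + 1) ^ ?d \<le> (?V ^ (2 ^ Suc q) + 1) ^ ?d" by (intro power_mono) auto
  then have "t \<le> ?k * (?V ^ (2 ^ Suc q) + 1) ^ ?d" using 1(2) mult_le_mono2 order_trans by blast
  then have "t + u \<le> (Suc q * ?k + 1) * (?V ^ (2 ^ Suc q) + 1) ^ ?d"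
    using 2(2) unfolding pw by (simp only: mult_Suc distrib_right)
  moreover have "exec (squares (Suc q)) (mem \<sigma>) (t + u) (mem \<sigma>2)"
    unfolding squares.simps by (rule exec_Seq[OF 1(1) 2(1)])
  ultimately show ?case using 2(3,4) 1(4) unfolding pw by (intro exI[of _ "t + u"] exI[of _ \<sigma>2]) simp
qed

section \<open>The whole program\<close>

definition program :: "bool \<Rightarrow> nat \<Rightarrow> bool \<Rightarrow> nat \<Rightarrow> com" where
  "program tr K rot q = Seq (load tr) (Seq (squares q) (Seq (compile (search K rot)) (write_result tr)))"

lemma program_correct:
  fixes q :: nat
  assumes valid: "valid_instance a b rs"
  defines "n \<equiv> length rs" and "V \<equiv> (a + b + (length rs + 2)) ^ (2 ^ q)"
  shows "\<exists>t M \<sigma>. exec (program tr K rot q) (initial_memory a b rs) t M \<and>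
    t \<le> (load_time tr + (q * (time_factor square_cm + 4) + 1) + time_factor (search K rot) + output_time tr) *
      (V + 1) ^ (1 + depth square_cm + depth (search K rot)) \<and>
    \<sigma> 2 0 = V \<and> \<sigma> n_sc 0 = n \<and> \<sigma> height_sc 0 = (if tr then a else b) \<and>
    (\<forall>j<n. \<sigma> W_ar j = fst (flip tr rs ! j) \<and> \<sigma> H_ar j = snd (flip tr rs ! j)) \<and> M 0 = 1 \<and>
    (\<forall>j<n. M (3 * j + 1) = sem (search K rot) \<sigma> (if tr then Py_ar else Px_ar) j \<and>
       M (3 * j + 2) = sem (search K rot) \<sigma> (if tr then Px_ar else Py_ar) j \<and>
       M (3 * j + 3) = sem (search K rot) \<sigma> Rot_ar j)"
proof -
  obtain t1 M1 where 1: "exec (load tr) (initial_memory a b rs) t1 M1" "t1 \<le> load_time tr * (n + 1)"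
    "M1 2 = a + b + (n + 2)" "M1 n_sc = n" "M1 height_sc = (if tr then a else b)"
    "\<forall>j < n. M1 (64 * j + W_ar) = fst (flip tr rs ! j) \<and> M1 (64 * j + H_ar) = snd (flip tr rs ! j)"
    "M1 (64 * n + W_ar) = 0"
    using load_correct[OF valid, of tr] unfolding n_def by blast
  define \<sigma>1 where "\<sigma>1 = (\<lambda>j i. M1 (64 * i + j))"
  have mem1: "mem \<sigma>1 = M1" unfolding \<sigma>1_def by (rule mem_surj)
  have X: "\<sigma>1 2 0 = a + b + (n + 2)" by (simp only: \<sigma>1_def mult_0_right add_0) (rule 1(3))
  have "0 < \<sigma>1 2 0" using X by simp
  from squares_correct[of \<sigma>1 q, OF this] obtain t2 \<sigma>2 where 2: "exec (squares q) M1 t2 (mem \<sigma>2)"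
    "t2 \<le> (q * (time_factor square_cm + 4) + 1) * (V + 1) ^ depth square_cm"
    "\<sigma>2 2 0 = V" "\<forall>j \<in> {5, 6, 26, 27}. \<sigma>2 j = \<sigma>1 j"
    unfolding mem1 X V_def n_def by blast
  let ?\<sigma> = "sem (search K rot) \<sigma>2"
  from exec_compile[OF wf_search, of K rot \<sigma>2] obtain t3 where
    3: "exec (compile (search K rot)) (mem \<sigma>2) t3 (mem ?\<sigma>)" "t3 \<le> time_factor (search K rot) * (V + 1) ^ depth (search K rot)"
    unfolding 2(3) by blast
  have s2: "\<sigma>2 W_ar j = M1 (64 * j + W_ar)" "\<sigma>2 H_ar j = M1 (64 * j + H_ar)" "\<sigma>2 n_sc 0 = n" "\<sigma>2 height_sc 0 = (if tr then a else b)" for j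
    using 2(4) 1(4,5) by (simp_all add: \<sigma>1_def)
  have W: "mem ?\<sigma> (64 * j + W_ar) = M1 (64 * j + W_ar)" for j
    using search_other[of W_ar K rot \<sigma>2] s2(1) by simp
  have pos: "0 < mem ?\<sigma> (64 * j + W_ar)" if "j < n" for j
  proof -
    obtain w h where wh: "rs ! j = (w, h)" by fastforce
    have "(w, h) \<in> set rs" using that unfolding wh[symmetric] by (simp add: n_def)
    then have "0 < w \<and> 0 < h" using valid unfolding valid_instance_def by blast
    then have "0 < fst (flip tr rs ! j)" using that by (simp add: flip_def n_def prod.swap_def wh)
    then show ?thesis using 1(6) that unfolding W by simp
  qed
  have stop: "mem ?\<sigma> (64 * n + W_ar) = 0" unfolding W by (rule 1(7))
  from output_correct[of n "mem ?\<sigma>" tr, OF pos stop] obtain t4 M4 where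
    4: "exec (write_result tr) (mem ?\<sigma>) t4 M4" "t4 \<le> output_time tr * (n + 1)" "M4 0 = 1"
    "\<forall>j<n. M4 (3 * j + 1) = mem ?\<sigma> (64 * j + (if tr then Py_ar else Px_ar)) \<and>
       M4 (3 * j + 2) = mem ?\<sigma> (64 * j + (if tr then Px_ar else Py_ar)) \<and> M4 (3 * j + 3) = mem ?\<sigma> (64 * j + Rot_ar)"
    by blast
  let ?D = "1 + depth square_cm + depth (search K rot)"
  have "exec (program tr K rot q) (initial_memory a b rs) (t1 + (t2 + (t3 + t4))) M4"
    unfolding program_def by (rule exec_Seq[OF 1(1) exec_Seq[OF 2(1) exec_Seq[OF 3(1) 4(1)]]])
  moreover have "t1 + (t2 + (t3 + t4)) \<le>
    (load_time tr + (q * (time_factor square_cm + 4) + 1) + time_factor (search K rot) + output_time tr) * (V + 1) ^ ?D"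
  proof -
    have "n + 1 \<le> (a + b + (n + 2)) ^ 1" by simp
    also have "\<dots> \<le> V" unfolding V_def n_def[symmetric] by (intro power_increasing) auto
    finally have nV: "n + 1 \<le> (V + 1) ^ 1" by simp
    have t1: "t1 \<le> load_time tr * (V + 1) ^ 1" using 1(2) nV mult_le_mono2 order_trans by blast
    have t4: "t4 \<le> output_time tr * (V + 1) ^ 1" using 4(2) nV mult_le_mono2 order_trans by blast
    have "t1 \<le> load_time tr * (V + 1) ^ ?D" by (rule le_mult_power[OF t1]) simp
    moreover have "t2 \<le> (q * (time_factor square_cm + 4) + 1) * (V + 1) ^ ?D" by (rule le_mult_power[OF 2(2)]) simp
    moreover have "t3 \<le> time_factor (search K rot) * (V + 1) ^ ?D" by (rule le_mult_power[OF 3(2)]) simp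
    moreover have "t4 \<le> output_time tr * (V + 1) ^ ?D" by (rule le_mult_power[OF t4]) simp
    ultimately show ?thesis by (simp only: distrib_right[of _ _ "(V + 1) ^ ?D"])
  qed
  moreover have "\<forall>j<n. \<sigma>2 W_ar j = fst (flip tr rs ! j) \<and> \<sigma>2 H_ar j = snd (flip tr rs ! j)" using 1(6) s2 by simp
  moreover have "\<forall>j<n. M4 (3 * j + 1) = ?\<sigma> (if tr then Py_ar else Px_ar) j \<and>
       M4 (3 * j + 2) = ?\<sigma> (if tr then Px_ar else Py_ar) j \<and> M4 (3 * j + 3) = ?\<sigma> Rot_ar j"
    using 4(4) by simp
  ultimately show ?thesis using 2(3) s2(3,4) 4(3) by blast
qed

section \<open>Transposition\<close>

lemma swap_add: "prod.swap (p + q) = prod.swap p + prod.swap q"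
  by (simp add: prod_eq_iff)

lemma swap_cbox: "prod.swap ` cbox p q = cbox (prod.swap p) (prod.swap q)" for p q :: "real \<times> real"
  by (cases p; cases q) (simp add: cbox_Pair_eq product_swap)

lemma interior_swap_cbox: "interior (prod.swap ` cbox p q) = prod.swap ` interior (cbox p q)" for p q :: "real \<times> real"
  by (cases p; cases q) (simp add: cbox_Pair_eq product_swap interior_Times)

text \<open>The rotation flag stays as it is: it refers to the list of rectangles, whose widths and
  heights are exchanged as well.\<close>

definition transpose_placement :: "placement \<Rightarrow> placement" where
  "transpose_placement P i = (prod.swap (fst (P i)), snd (P i))"

lemma region_transpose:
  assumes "i < length rs"
  shows "region (map prod.swap rs) (transpose_placement P) i = prod.swap ` region rs P i"
  using assms unfolding region_def swap_cbox
  by (simp add: placed_width_def placed_height_def transpose_placement_def swap_add)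

lemma interior_region_transpose:
  assumes "i < length rs"
  shows "interior (region (map prod.swap rs) (transpose_placement P) i) = prod.swap ` interior (region rs P i)"
  unfolding region_transpose[OF assms] unfolding region_def by (rule interior_swap_cbox)

lemma is_packing_transpose:
  assumes "is_packing rot A B rs P"
  shows "is_packing rot B A (map prod.swap rs) (transpose_placement P)"
  unfolding is_packing_def length_map
proof (intro conjI allI impI)
  fix i assume i: "i < length rs"
  then have "region rs P i \<subseteq> cbox (0, 0) (A, B)" using assms unfolding is_packing_def by blast
  then have "prod.swap ` region rs P i \<subseteq> prod.swap ` cbox (0, 0) (A, B)" by (rule image_mono)
  then show "region (map prod.swap rs) (transpose_placement P) i \<subseteq> cbox (0, 0) (B, A)"
    unfolding region_transpose[OF i] swap_cbox by simp
next
  fix i j assume ij: "i < length rs" "j < length rs" "i \<noteq> j"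
  then have "interior (region rs P i) \<inter> interior (region rs P j) = {}" using assms unfolding is_packing_def by blast
  then show "interior (region (map prod.swap rs) (transpose_placement P) i) \<inter>
    interior (region (map prod.swap rs) (transpose_placement P) j) = {}"
    unfolding interior_region_transpose[OF ij(1)] interior_region_transpose[OF ij(2)]
    by (simp flip: image_Int)
next
  fix i assume "\<not> rot" "i < length rs"
  then show "\<not> snd (transpose_placement P i)" using assms unfolding is_packing_def transpose_placement_def by simp
qed

primrec transpose_kind :: "container_kind \<Rightarrow> container_kind" where
  "transpose_kind Horizontal = Vertical"
| "transpose_kind Vertical = Horizontal"
| "transpose_kind Area = Area"

definition transpose_container :: "container \<Rightarrow> container" where
  "transpose_container C = \<lparr>corner = prod.swap (corner C), cwidth = cheight C, cheight = cwidth C,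
     kind = transpose_kind (kind C), contents = contents C\<rparr>"

lemma cregion_transpose: "cregion (transpose_container C) = prod.swap ` cregion C"
  unfolding cregion_def swap_cbox by (simp add: transpose_container_def swap_add)

lemma interior_cregion_transpose: "interior (cregion (transpose_container C)) = prod.swap ` interior (cregion C)"
  unfolding cregion_transpose unfolding cregion_def by (rule interior_swap_cbox)

lemma swap_line: "prod.swap ` S \<inter> {p. fst p = y} \<noteq> {} \<longleftrightarrow> S \<inter> {p. snd p = y} \<noteq> {}"
  "prod.swap ` S \<inter> {p. snd p = y} \<noteq> {} \<longleftrightarrow> S \<inter> {p. fst p = y} \<noteq> {}"
  by force+

lemma is_container_transpose:
  assumes "is_container \<epsilon> rs P C"
  shows "is_container \<epsilon> (map prod.swap rs) (transpose_placement P) (transpose_container C)"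
proof -
  have sub: "contents C \<subseteq> {..<length rs}" using assms unfolding is_container_def by blast
  have resp: "respects_kind \<epsilon> rs P C (kind C)" using assms unfolding is_container_def by blast
  have i: "i < length rs" if "i \<in> contents C" for i using sub that by blast
  have "respects_kind \<epsilon> (map prod.swap rs) (transpose_placement P) (transpose_container C) (transpose_kind (kind C))"
  proof (cases "kind C")
    case Horizontal
    show ?thesis using resp unfolding Horizontal transpose_kind.simps respects_kind.simps
      by (simp add: transpose_container_def interior_region_transpose i swap_line)
  next
    case Vertical
    show ?thesis using resp unfolding Vertical transpose_kind.simps respects_kind.simps
      by (simp add: transpose_container_def interior_region_transpose i swap_line)
  next
    case Area
    show ?thesis using resp unfolding Area transpose_kind.simps respects_kind.simps
      by (auto simp: transpose_container_def transpose_placement_def placed_width_def placed_height_def i split: if_splits)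
  qed
  moreover have "region (map prod.swap rs) (transpose_placement P) j \<subseteq> cregion (transpose_container C)"
    if "j \<in> contents C" for j
  proof -
    have "region rs P j \<subseteq> cregion C" using assms that unfolding is_container_def by blast
    then show ?thesis unfolding region_transpose[OF i[OF that]] cregion_transpose by (rule image_mono)
  qed
  ultimately show ?thesis using assms unfolding is_container_def by (simp add: transpose_container_def)
qed

lemma admits_container_packing_transpose:
  assumes "admits_container_packing rot \<epsilon> K A B rs"
  shows "admits_container_packing rot \<epsilon> K B A (map prod.swap rs)"
proof -
  obtain P Cs where Cs: "length Cs \<le> K" "is_container_packing rot \<epsilon> A B rs P Cs"
    using assms unfolding admits_container_packing_def by blast
  let ?Cs = "map transpose_container Cs"
  have "is_container_packing rot \<epsilon> B A (map prod.swap rs) (transpose_placement P) ?Cs"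
    unfolding is_container_packing_def length_map
  proof (intro conjI allI impI ballI)
    show "is_packing rot B A (map prod.swap rs) (transpose_placement P)"
      using Cs(2) unfolding is_container_packing_def by (blast intro: is_packing_transpose)
  next
    fix D assume "D \<in> set ?Cs"
    then obtain C where C: "C \<in> set Cs" "D = transpose_container C" by auto
    then have cont: "is_container \<epsilon> rs P C" "cregion C \<subseteq> cbox (0, 0) (A, B)"
      using Cs(2) unfolding is_container_packing_def by blast+
    show "is_container \<epsilon> (map prod.swap rs) (transpose_placement P) D"
      unfolding C(2) by (rule is_container_transpose[OF cont(1)])
    have "prod.swap ` cregion C \<subseteq> prod.swap ` cbox (0, 0) (A, B)" by (rule image_mono[OF cont(2)])
    then show "cregion D \<subseteq> cbox (0, 0) (B, A)" unfolding C(2) cregion_transpose swap_cbox by simp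
  next
    fix k l assume kl: "k < length Cs" "l < length Cs" "k \<noteq> l"
    then have "interior (cregion (Cs ! k)) \<inter> interior (cregion (Cs ! l)) = {}"
      using Cs(2) unfolding is_container_packing_def by blast
    then show "interior (cregion (?Cs ! k)) \<inter> interior (cregion (?Cs ! l)) = {}"
      using kl by (simp add: interior_cregion_transpose flip: image_Int)
  next
    fix i assume "i < length rs"
    then obtain C where "C \<in> set Cs" "i \<in> contents C" using Cs(2) unfolding is_container_packing_def by blast
    then show "\<exists>C \<in> set ?Cs. i \<in> contents C" by (auto simp: transpose_container_def)
  qed
  then show ?thesis using Cs(1) unfolding admits_container_packing_def by (metis length_map)
qed

section \<open>Correctness and running time\<close>

lemma is_packing_cong:
  assumes "\<And>i. i < length rs \<Longrightarrow> P i = Q i"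
  shows "is_packing rot A B rs P = is_packing rot A B rs Q"
proof -
  have "region rs P i = region rs Q i" if "i < length rs" for i
    by (simp add: region_def placed_width_def placed_height_def assms[OF that])
  then show ?thesis using assms unfolding is_packing_def by simp
qed

lemma int_packing_is_packing:
  assumes pack: "int_packing (length rs) m k x y (\<lambda>i. rect_w rs (r i) i) (\<lambda>i. rect_h rs (r i) i)"
    and r: "\<And>i. i < length rs \<Longrightarrow> r i \<Longrightarrow> rot" and A: "real m \<le> A" and B: "real k \<le> B"
  shows "is_packing rot A B rs (\<lambda>i. ((real (x i), real (y i)), r i))" (is "is_packing rot A B rs ?P")
proof -
  let ?w = "\<lambda>i. rect_w rs (r i) i" and ?h = "\<lambda>i. rect_h rs (r i) i"
  have reg: "region rs ?P i = {real (x i)..real (x i + ?w i)} \<times> {real (y i)..real (y i + ?h i)}" for i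
    by (simp add: region_def placed_width_def placed_height_def rect_w_def rect_h_def cbox_Pair_eq)
  have int: "interior (region rs ?P i) = {real (x i)<..<real (x i + ?w i)} \<times> {real (y i)<..<real (y i + ?h i)}" for i
    unfolding reg interior_Times by (simp add: interior_atLeastAtMost_real)
  show ?thesis unfolding is_packing_def
  proof (intro conjI allI impI)
    fix i assume i: "i < length rs"
    have "x i + ?w i \<le> m" "y i + ?h i \<le> k" using pack i unfolding int_packing_def by blast+
    then have "real (x i + ?w i) \<le> A" "real (y i + ?h i) \<le> B" using A B by linarith+
    then show "region rs ?P i \<subseteq> cbox (0, 0) (A, B)"
      unfolding reg cbox_Pair_eq by (intro Sigma_mono) (auto simp: box_real)
  next
    fix i j assume ij: "i < length rs" "j < length rs" "i \<noteq> j"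
    then have "x i + ?w i \<le> x j \<or> x j + ?w j \<le> x i \<or> y i + ?h i \<le> y j \<or> y j + ?h j \<le> y i"
      using pack unfolding int_packing_def by blast
    then have "real (x i + ?w i) \<le> real (x j) \<or> real (x j + ?w j) \<le> real (x i) \<or>
       real (y i + ?h i) \<le> real (y j) \<or> real (y j + ?h j) \<le> real (y i)"
      unfolding of_nat_le_iff .
    then show "interior (region rs ?P i) \<inter> interior (region rs ?P j) = {}"
      unfolding int by fastforce
  next
    fix i assume "\<not> rot" "i < length rs"
    then show "\<not> snd (?P i)" using r by auto
  qed
qed

lemma valid_instance_flip:
  "valid_instance a b rs \<Longrightarrow> valid_instance (if tr then b else a) (if tr then a else b) (flip tr rs)"
  by (auto simp: valid_instance_def flip_def)

text \<open>The origin of \<open>q\<close>: the base is at most \<open>X ^ 3\<close>, so its power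
  with exponent \<open>3 * K\<close> is at most \<open>X ^ (9 * K)\<close>; \<open>e\<close> pays
  for the factor \<open>1 + 2 * \<epsilon>\<close>, and the 5 leaves room for the small powers.
  Repeated squaring reaches \<open>X ^ 2 ^ q\<close>, far more than \<open>X ^ q\<close>, which is
  harmless as long as the exponent is independent of the instance.\<close>

lemma limit_bounds:
  fixes a b n m K e q :: nat and \<epsilon> :: real
  assumes e: "1 + 2 * \<epsilon> \<le> 2 ^ e" and q: "q = 9 * K + e + 5" and m: "m \<le> a + b"
  defines "X \<equiv> a + b + (n + 2)"
  shows "n < X ^ 2 ^ q" "K \<le> X ^ 2 ^ q" "nat \<lfloor>(1 + 2 * \<epsilon>) * real m\<rfloor> < X ^ 2 ^ q" "m < X ^ 2 ^ q"
    "(a + b) * (a + b) \<le> X ^ 2 ^ q" "(n * ((a + b) * (a + b)) + 1) ^ (3 * K) < X ^ 2 ^ q"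
proof -
  have X: "2 \<le> X" "n < X" "a + b < X" by (simp_all add: X_def)
  have "q \<le> 2 ^ q" using less_exp[of q] by simp
  then have low: "X ^ k \<le> X ^ 2 ^ q" if "k \<le> q" for k using X le_trans[OF that] by (intro power_increasing) auto
  have X1: "X \<le> X ^ 2 ^ q" using low[of 1] q by simp
  show "n < X ^ 2 ^ q" "m < X ^ 2 ^ q" using X X1 m by linarith+
  have "K \<le> 2 ^ K" using less_exp[of K] by simp
  also have "\<dots> \<le> X ^ K" by (rule power_mono[OF X(1)]) simp
  also have "\<dots> \<le> X ^ 2 ^ q" using q by (intro low) simp
  finally show "K \<le> X ^ 2 ^ q" .
  have "(a + b) * (a + b) \<le> X * X" using X(3) by (intro mult_le_mono) auto
  also have "\<dots> = X ^ 2" by (simp add: power2_eq_square)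
  also have "\<dots> \<le> X ^ 2 ^ q" using q by (intro low) simp
  finally show "(a + b) * (a + b) \<le> X ^ 2 ^ q" .
  have "(1 + 2 * \<epsilon>) * real m \<le> 2 ^ e * real m" using e by (intro mult_right_mono) auto
  then have "nat \<lfloor>(1 + 2 * \<epsilon>) * real m\<rfloor> \<le> nat \<lfloor>2 ^ e * real m\<rfloor>" by (intro nat_mono floor_mono)
  also have "2 ^ e * real m = real (2 ^ e * m)" by simp
  also have "nat \<lfloor>real (2 ^ e * m)\<rfloor> = 2 ^ e * m" by (simp only: floor_of_nat nat_int)
  also have "2 ^ e * m < 2 ^ e * X" using X(3) m by simp
  also have "\<dots> \<le> X ^ e * X" by (intro mult_le_mono power_mono X(1)) auto
  also have "\<dots> = X ^ (e + 1)" by simp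
  also have "\<dots> \<le> X ^ 2 ^ q" using q by (intro low) simp
  finally show "nat \<lfloor>(1 + 2 * \<epsilon>) * real m\<rfloor> < X ^ 2 ^ q" .
  have "n * ((a + b) * (a + b)) + 1 \<le> (n + 1) * ((a + b + 1) * (a + b + 1))" by (simp add: algebra_simps)
  also have "\<dots> \<le> X * (X * X)" using X by (intro mult_le_mono) auto
  also have "\<dots> = X ^ 3" by (simp add: power3_eq_cube)
  finally have "(n * ((a + b) * (a + b)) + 1) ^ (3 * K) \<le> (X ^ 3) ^ (3 * K)" by (rule power_mono) simp
  also have "\<dots> = X ^ (9 * K)" by (simp flip: power_mult)
  also have "\<dots> < X ^ q" using X(1) q by (intro power_strict_increasing) auto
  also have "\<dots> \<le> X ^ 2 ^ q" by (rule low) simp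
  finally show "(n * ((a + b) * (a + b)) + 1) ^ (3 * K) < X ^ 2 ^ q" .
qed

text \<open>With \<open>tr\<close>, the search runs on the transposed instance; widths and heights
  are exchanged when loading, and the coordinates are exchanged back when writing.\<close>

lemma program_packs:
  fixes \<epsilon> :: real
  assumes inst: "valid_instance a b rs" and eps: "0 < \<epsilon>"
    and adm: "admits_container_packing rot \<epsilon> K (real a) (real b) rs"
    and e: "1 + 2 * \<epsilon> \<le> 2 ^ e" and q: "q = 9 * K + e + 5"
  shows "computes_packing (program tr K rot q) rot a b rs
    (if tr then real a else (1 + 2 * \<epsilon>) * real a) (if tr then (1 + 2 * \<epsilon>) * real b else real b)"
proof -
  let ?n = "length rs" and ?rs = "flip tr rs" and ?a = "if tr then b else a" and ?b = "if tr then a else b"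
  let ?A = "nat \<lfloor>(1 + 2 * \<epsilon>) * real ?a\<rfloor>" and ?V = "(a + b + (length rs + 2)) ^ 2 ^ q"
  have valid': "valid_instance ?a ?b ?rs" by (rule valid_instance_flip[OF inst])
  have adm': "admits_container_packing rot \<epsilon> K (real ?a) (real ?b) ?rs"
    using adm admits_container_packing_transpose[OF adm] by (simp add: flip_def)
  obtain K0 bx rt BX BY BW BH BT M1 M2 where boxes:
    "K0 \<le> K"
    "\<And>i. i < length ?rs \<Longrightarrow> bx i < K0 \<and> (rt i \<longrightarrow> rot) \<and> rect_w ?rs (rt i) i \<le> M1 (bx i) \<and> rect_h ?rs (rt i) i \<le> M2 (bx i)"
    "\<And>k. k < K0 \<Longrightarrow> BX k + BW k \<le> ?A \<and> BY k + BH k \<le> ?b \<and> BT k \<le> ?b \<and> M1 k \<le> ?a \<and> M2 k \<le> ?b"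
    "\<And>k l. k < K0 \<Longrightarrow> l < K0 \<Longrightarrow> k \<noteq> l \<Longrightarrow> BX k + BW k \<le> BX l \<or> BX l + BW l \<le> BX k \<or>
       BY k + BH k \<le> BY l \<or> BY l + BH l \<le> BY k"
    "\<And>k. k < K0 \<Longrightarrow> robust_box (BW k) (BH k) (M1 k) (M2 k) (BT k)
       (box_sums (\<lambda>i. rect_w ?rs (rt i) i) (\<lambda>i. rect_h ?rs (rt i) i) (BT k) {i. i < length ?rs \<and> bx i = k} 0)
       (box_sums (\<lambda>i. rect_w ?rs (rt i) i) (\<lambda>i. rect_h ?rs (rt i) i) (BT k) {i. i < length ?rs \<and> bx i = k} 1)
       (box_sums (\<lambda>i. rect_w ?rs (rt i) i) (\<lambda>i. rect_h ?rs (rt i) i) (BT k) {i. i < length ?rs \<and> bx i = k} 2)"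
    by (rule container_packing_boxes[OF adm' eps valid']) (rule that)
  have ab: "?a + ?b = a + b" "?a \<le> a + b" "?b \<le> a + b" by simp_all
  note lim = limit_bounds[OF e q ab(2), of ?n]
  have "?b < ?V" by (rule limit_bounds(4)[OF e q ab(3)])
  then have V: "length ?rs < ?V" "K \<le> ?V" "?A < ?V" "?a < ?V" "?b < ?V" "(?a + ?b) * (?a + ?b) \<le> ?V"
    "(length ?rs * ((?a + ?b) * (?a + ?b)) + 1) ^ (3 * K) < ?V"
    using lim by (simp_all only: ab(1) length_flip)
  interpret solvable ?rs rot K ?a ?b ?A K0 ?V bx rt BX BY BW BH BT M1 M2
    by (rule solvable.intro) (fact valid' boxes V)+
  obtain t M \<sigma> where run: "exec (program tr K rot q) (initial_memory a b rs) t M"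
    "\<sigma> 2 0 = ?V" "\<sigma> n_sc 0 = ?n" "\<sigma> height_sc 0 = ?b"
    "\<forall>j<?n. \<sigma> W_ar j = fst (?rs ! j) \<and> \<sigma> H_ar j = snd (?rs ! j)" "M 0 = 1"
    "\<forall>j<?n. M (3 * j + 1) = sem (search K rot) \<sigma> (if tr then Py_ar else Px_ar) j \<and>
       M (3 * j + 2) = sem (search K rot) \<sigma> (if tr then Px_ar else Py_ar) j \<and>
       M (3 * j + 3) = sem (search K rot) \<sigma> Rot_ar j"
    using program_correct[OF inst, of tr K rot q] by blast
  let ?\<sigma> = "sem (search K rot) \<sigma>"
  have inp: "input \<sigma>" unfolding input_def using run(2-5) by simp
  have "found rot ?A ?\<sigma>" by (rule search_finds[OF inp])
  moreover have inp': "input ?\<sigma>" using inp unfolding input_def by (simp only: search_other insert_iff simp_thms) blast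
  moreover have "?\<sigma> n_sc 0 = length ?rs" "?\<sigma> height_sc 0 = ?b" using inp' unfolding input_def by blast+
  ultimately have pack: "int_packing (length ?rs) ?A ?b (?\<sigma> Px_ar) (?\<sigma> Py_ar)
      (\<lambda>i. item_w ?\<sigma> (?\<sigma> Rot_ar i \<noteq> 0) i) (\<lambda>i. item_h ?\<sigma> (?\<sigma> Rot_ar i \<noteq> 0) i)"
    and rt: "\<forall>i < length ?rs. ?\<sigma> Rot_ar i \<noteq> 0 \<longrightarrow> rot"
    unfolding found_def by (simp_all only:) blast
  have pack': "int_packing (length ?rs) ?A ?b (?\<sigma> Px_ar) (?\<sigma> Py_ar)
      (\<lambda>i. rect_w ?rs (?\<sigma> Rot_ar i \<noteq> 0) i) (\<lambda>i. rect_h ?rs (?\<sigma> Rot_ar i \<noteq> 0) i)"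
    by (rule int_packing_cong[THEN iffD1, OF _ pack]) (intro conjI item_rect[OF inp'])
  have "real ?A \<le> (1 + 2 * \<epsilon>) * real ?a" using eps by (intro of_nat_floor mult_nonneg_nonneg) auto
  from int_packing_is_packing[OF pack' _ this order_refl, of rot] rt
  have P: "is_packing rot ((1 + 2 * \<epsilon>) * real ?a) (real ?b) ?rs
    (\<lambda>i. ((real (?\<sigma> Px_ar i), real (?\<sigma> Py_ar i)), ?\<sigma> Rot_ar i \<noteq> 0))" (is "is_packing _ _ _ _ ?P") by blast
  have "is_packing rot (if tr then real a else (1 + 2 * \<epsilon>) * real a) (if tr then (1 + 2 * \<epsilon>) * real b else real b) rs
    (output_placement M)"
  proof (cases tr)
    case True
    have "is_packing rot (real a) ((1 + 2 * \<epsilon>) * real b) rs (transpose_placement ?P)"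
      using is_packing_transpose[OF P] by (simp add: True flip_def o_def)
    moreover have "output_placement M i = transpose_placement ?P i" if "i < ?n" for i
      using run(6,7) that by (simp add: output_placement_def transpose_placement_def True)
    ultimately show ?thesis using is_packing_cong[of rs "output_placement M" "transpose_placement ?P"] by (simp add: True)
  next
    case False
    have "output_placement M i = ?P i" if "i < ?n" for i
      using run(6,7) that by (simp add: output_placement_def False)
    then show ?thesis using P is_packing_cong[of rs "output_placement M" ?P] by (simp add: False flip_def)
  qed
  then show ?thesis unfolding computes_packing_def using run(1,6) zero_less_one by metis
qed

text \<open>The sides of the knapsack and the number of rectangles are all part of the encoded
  input, and its maximum is positive; so the start value of the truncation number is at most 5 times
  the maximum. The exponent depends on the program alone.\<close>

lemma program_pseudo_polynomial: "pseudo_polynomial_time (program tr K rot q)"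
proof -
  let ?c = "load_time tr + (q * (time_factor square_cm + 4) + 1) + time_factor (search K rot) + output_time tr"
  let ?d = "1 + depth square_cm + depth (search K rot)"
  have "\<exists>t M. exec (program tr K rot q) (initial_memory a b rs) t M \<and>
     t \<le> (?c * (2 * 5 ^ 2 ^ q) ^ ?d) * (input_size a b rs + max_value a b rs) ^ (2 ^ q * ?d)"
    if valid: "valid_instance a b rs" for a b rs
  proof -
    let ?m = "max_value a b rs" and ?X = "a + b + (length rs + 2)"
    have le: "x \<le> ?m" if "x \<in> set (encode a b rs)" for x
      unfolding max_value_def by (rule Max_ge[OF _ that]) simp
    have "a \<le> ?m" "b \<le> ?m" "length rs \<le> ?m" by (rule le, simp add: encode_def)+
    moreover have "0 < a" using valid by (simp add: valid_instance_def)
    ultimately have X: "?X \<le> 5 * ?m" by linarith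
    have "?X ^ 2 ^ q + 1 \<le> 2 * ?X ^ 2 ^ q" by simp
    also have "\<dots> \<le> 2 * (5 * ?m) ^ 2 ^ q" by (intro mult_le_mono2 power_mono X) simp
    also have "\<dots> = (2 * 5 ^ 2 ^ q) * ?m ^ 2 ^ q" by (simp only: power_mult_distrib mult.assoc)
    also have "\<dots> \<le> (2 * 5 ^ 2 ^ q) * (input_size a b rs + ?m) ^ 2 ^ q" by (intro mult_le_mono2 power_mono) auto
    finally have "(?X ^ 2 ^ q + 1) ^ ?d \<le> ((2 * 5 ^ 2 ^ q) * (input_size a b rs + ?m) ^ 2 ^ q) ^ ?d"
      by (rule power_mono) simp
    also have "\<dots> = (2 * 5 ^ 2 ^ q) ^ ?d * (input_size a b rs + ?m) ^ (2 ^ q * ?d)"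
      by (simp only: power_mult_distrib[of _ _ ?d] power_mult)
    finally have bound: "?c * (?X ^ 2 ^ q + 1) ^ ?d \<le> ?c * ((2 * 5 ^ 2 ^ q) ^ ?d * (input_size a b rs + ?m) ^ (2 ^ q * ?d))"
      by (rule mult_le_mono2)
    obtain t M where "exec (program tr K rot q) (initial_memory a b rs) t M" "t \<le> ?c * (?X ^ 2 ^ q + 1) ^ ?d"
      using program_correct[OF valid, of tr K rot q] by blast
    then show ?thesis using order_trans[OF _ bound] unfolding mult.assoc by blast
  qed
  then show ?thesis unfolding pseudo_polynomial_time_def by blast
qed

theorem theorem2p14:
  fixes \<epsilon> :: real and K :: "real \<Rightarrow> nat" and rot :: bool
  assumes "\<epsilon> > 0"
  shows
    "(\<exists>p. pseudo_polynomial_time p \<and>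
        (\<forall>a b rs. valid_instance a b rs \<and>
           admits_container_packing rot \<epsilon> (K \<epsilon>) (real a) (real b) rs \<longrightarrow>
           computes_packing p rot a b rs ((1 + 2 * \<epsilon>) * real a) (real b))) \<and>
     (\<exists>p. pseudo_polynomial_time p \<and>
        (\<forall>a b rs. valid_instance a b rs \<and>
           admits_container_packing rot \<epsilon> (K \<epsilon>) (real a) (real b) rs \<longrightarrow>
           computes_packing p rot a b rs (real a) ((1 + 2 * \<epsilon>) * real b)))"
  proof -
  \<comment> \<open>Only a power of 2 above \<open>1 + 2 * \<epsilon>\<close> enters the program, so
    \<open>\<epsilon>\<close> may be an arbitrary positive real number.\<close>
  obtain e :: nat where e: "1 + 2 * \<epsilon> < 2 ^ e" using real_arch_pow[of 2 "1 + 2 * \<epsilon>"] by auto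
  note packs = program_packs[OF _ assms _ less_imp_le[OF e] refl, where K = "K \<epsilon>" and rot = rot]
  show ?thesis
    using program_pseudo_polynomial packs[where tr = False, simplified] packs[where tr = True, simplified] by blast
qed


end
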